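(* Let $K$ be a field, let $k,k',n,n'$ be positive integers, where $n$ is prime, and let $\lambda_1,\dots,\lambda_k,\gamma_1,\dots,\gamma_{k'}\in\mathbb{Z}$. Then \[\mathbb{M}_k(\mathcal{L}_n)(\lambda_1,\dots,\lambda_k)\cong_{\mathrm{gr}}\mathbb{M}_{k'}(\mathcal{L}_{n'})(\gamma_1,\dots,\gamma_{k'})\] if and only if $n=n'$ and there is $j\in\mathbb{Z}$ such that $n^j\sum_{i=1}^kn^{-\lambda_i}=\sum_{i=1}^{k'}n^{-\gamma_i}$.
   Context: $\mathcal{L}_n=\mathcal{L}(1,n)$ is the Leavitt algebra over $K$: the unital $K$-algebra generated by $x_1,\dots,x_n,y_1,\dots,y_n$ subject to $x_iy_j=\delta_{ij}$ for all $i,j$ and $\sum_{i=1}^ny_ix_i=1$ (so $\mathcal{L}_1\cong K[x,x^{-1}]$), $\mathbb{Z}$-graded by $\deg(y_i)=1$, $\deg(x_i)=-1$. For a $\mathbb{Z}$-graded ring $A$ and integers $\delta_1,\dots,\delta_m$, $\mathbb{M}_m(A)(\delta_1,\dots,\delta_m)$ is the ring of $m\times m$ matrices over $A$ with the $\mathbb{Z}$-grading whose component of degree $\lambda$ consists of the matrices with $(i,j)$-entry in $A_{\lambda+\delta_j-\delta_i}$; thus $\deg(e_{ij}(a))=\deg(a)+\delta_i-\delta_j$. $\cong_{\mathrm{gr}}$ denotes degree-preserving isomorphism of graded rings. *)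

theory Defs
  imports
    "HOL-Algebra.QuotRing"
    "HOL-Library.Poly_Mapping"
    "HOL-Computational_Algebra.Primes"
    "Jordan_Normal_Form.Matrix"
begin

section \<open>\<open>\<int>\<close>-graded rings\<close>

record 'a graded_ring = "'a ring" +
  hcomp :: "int \<Rightarrow> 'a set"

definition graded_iso ::
    "('a, 'c) graded_ring_scheme \<Rightarrow> ('b, 'd) graded_ring_scheme \<Rightarrow> bool"
    (infix \<open>\<cong>\<^sub>g\<^sub>r\<close> 50)
  where "A \<cong>\<^sub>g\<^sub>r B \<longleftrightarrow> (\<exists>h \<in> ring_iso A B. \<forall>d. h ` hcomp A d \<subseteq> hcomp B d)"


section \<open>The free unital algebra\<close>

text \<open>
  Words form the free monoid, written additively because \<^typ>\<open>'m \<Rightarrow>\<^sub>0 'k\<close> is the monoid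
  algebra of an additively written (possibly noncommutative) monoid.  Thus
  \<open>'g fword \<Rightarrow>\<^sub>0 'k\<close> is the free unital \<open>'k\<close>-algebra on the letters \<open>'g\<close>.
\<close>

datatype 'a fword = FWord (letters: "'a list")

instantiation fword :: (type) monoid_add
begin

definition zero_fword :: "'a fword" where "0 = FWord []"

definition plus_fword :: "'a fword \<Rightarrow> 'a fword \<Rightarrow> 'a fword"
  where "v + w = FWord (letters v @ letters w)"

instance
  by standard (simp_all add: zero_fword_def plus_fword_def)

end

definition free_algebra :: "'g set \<Rightarrow> ('g fword \<Rightarrow>\<^sub>0 'k::field) ring"
  where "free_algebra G =
    \<lparr> carrier = {p. \<forall>w \<in> Poly_Mapping.keys p. set (letters w) \<subseteq> G},
      monoid.mult = (*), monoid.one = 1, ring.zero = 0, ring.add = (+) \<rparr>"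

definition gen :: "'g \<Rightarrow> ('g fword \<Rightarrow>\<^sub>0 'k::field)"
  where "gen g = Poly_Mapping.single (FWord [g]) 1"

lemma letters_zero [simp]: "letters 0 = []"
  by (simp add: zero_fword_def)

lemma letters_plus [simp]: "letters (v + w) = letters v @ letters w"
  by (simp add: plus_fword_def)

lemma free_algebra_simps [simp]:
  "carrier (free_algebra G) = {p. \<forall>w \<in> Poly_Mapping.keys p. set (letters w) \<subseteq> G}"
  "monoid.mult (free_algebra G) = (*)" "monoid.one (free_algebra G) = 1"
  "ring.zero (free_algebra G) = 0" "ring.add (free_algebra G) = (+)"
  by (simp_all add: free_algebra_def)

lemma ring_free_algebra: "ring (free_algebra G :: ('g fword \<Rightarrow>\<^sub>0 'k::field) ring)"
proof (rule ringI)
  show "abelian_group (free_algebra G :: ('g fword \<Rightarrow>\<^sub>0 'k) ring)"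
  proof (rule abelian_groupI)
    fix p q :: "'g fword \<Rightarrow>\<^sub>0 'k"
    assume p: "p \<in> carrier (free_algebra G)"
    then show "\<exists>q \<in> carrier (free_algebra G). q \<oplus>\<^bsub>free_algebra G\<^esub> p = \<zero>\<^bsub>free_algebra G\<^esub>"
      by (intro bexI[of _ "- p"]) simp_all
    assume "q \<in> carrier (free_algebra G)"
    with p show "p \<oplus>\<^bsub>free_algebra G\<^esub> q \<in> carrier (free_algebra G)"
      using Poly_Mapping.keys_add[of p q] by auto
  qed (simp_all add: algebra_simps)
  show "monoid (free_algebra G :: ('g fword \<Rightarrow>\<^sub>0 'k) ring)"
  proof (rule monoidI)
    fix p q :: "'g fword \<Rightarrow>\<^sub>0 'k"
    assume "p \<in> carrier (free_algebra G)" "q \<in> carrier (free_algebra G)"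
    then show "p \<otimes>\<^bsub>free_algebra G\<^esub> q \<in> carrier (free_algebra G)"
      using Poly_Mapping.keys_mult[of p q] by fastforce
  qed (auto simp: algebra_simps)
qed (auto simp: algebra_simps)


section \<open>The Leavitt algebra of type \<open>(1, n)\<close>\<close>

datatype leavitt_gen = XG nat | YG nat

definition leavitt_gens :: "nat \<Rightarrow> leavitt_gen set"
  where "leavitt_gens n = XG ` {1..n} \<union> YG ` {1..n}"

definition leavitt_relators :: "nat \<Rightarrow> (leavitt_gen fword \<Rightarrow>\<^sub>0 'k::field) set"
  where "leavitt_relators n =
    {gen (XG i) * gen (YG j) - (if i = j then 1 else 0) | i j. i \<in> {1..n} \<and> j \<in> {1..n}}
    \<union> {(\<Sum>i = 1..n. gen (YG i) * gen (XG i)) - 1}"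

fun gen_degree :: "leavitt_gen \<Rightarrow> int"
  where
    "gen_degree (XG i) = -1"
  | "gen_degree (YG i) = 1"

definition word_degree :: "leavitt_gen fword \<Rightarrow> int"
  where "word_degree w = (\<Sum>g \<leftarrow> letters w. gen_degree g)"

definition leavitt_ideal :: "nat \<Rightarrow> (leavitt_gen fword \<Rightarrow>\<^sub>0 'k::field) set"
  where "leavitt_ideal n = genideal (free_algebra (leavitt_gens n)) (leavitt_relators n)"

text \<open>
  A ring ideal of a unital \<open>'k\<close>-algebra is automatically an algebra ideal.  The component of
  degree \<open>d\<close> is the image of the span of the words of degree \<open>d\<close>.
\<close>

definition leavitt :: "'k itself \<Rightarrow> nat \<Rightarrow> (leavitt_gen fword \<Rightarrow>\<^sub>0 'k::field) set graded_ring"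
  where "leavitt _ n =
    ring.extend (free_algebra (leavitt_gens n) Quot leavitt_ideal n)
      (graded_ring.fields (\<lambda>d.
        {leavitt_ideal n +>\<^bsub>free_algebra (leavitt_gens n)\<^esub> p | p.
           p \<in> carrier (free_algebra (leavitt_gens n)) \<and> (\<forall>w \<in> Poly_Mapping.keys p. word_degree w = d)}))"

lemma leavitt_simps:
  fixes n :: nat
  defines "F \<equiv> free_algebra (leavitt_gens n)"
  shows "carrier (leavitt TYPE('k::field) n) = a_rcosets\<^bsub>F\<^esub> (leavitt_ideal n)"
    and "monoid.mult (leavitt TYPE('k) n) = rcoset_mult F (leavitt_ideal n)"
    and "monoid.one (leavitt TYPE('k) n) = leavitt_ideal n +>\<^bsub>F\<^esub> 1"
    and "ring.zero (leavitt TYPE('k) n) = leavitt_ideal n"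
    and "ring.add (leavitt TYPE('k) n) = set_add F"
    and "hcomp (leavitt TYPE('k) n) d = {leavitt_ideal n +>\<^bsub>F\<^esub> p | p.
           p \<in> carrier F \<and> (\<forall>w \<in> Poly_Mapping.keys p. word_degree w = d)}"
  by (simp_all add: F_def leavitt_def FactRing_def ring.defs graded_ring.defs)

lemma leavitt_relators_carrier:
  "leavitt_relators n \<subseteq> carrier (free_algebra (leavitt_gens n) :: (leavitt_gen fword \<Rightarrow>\<^sub>0 'k::field) ring)"
proof -
  interpret F: ring "free_algebra (leavitt_gens n) :: (leavitt_gen fword \<Rightarrow>\<^sub>0 'k) ring"
    by (rule ring_free_algebra)
  let ?C = "carrier (free_algebra (leavitt_gens n) :: (leavitt_gen fword \<Rightarrow>\<^sub>0 'k) ring)"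
  have gen: "gen g \<in> ?C" if "g \<in> leavitt_gens n" for g
    using that by (simp add: gen_def)
  have mult: "p * q \<in> ?C" if "p \<in> ?C" "q \<in> ?C" for p q
    using F.m_closed[OF that] by (simp only: free_algebra_simps(2))
  have add: "p + q \<in> ?C" if "p \<in> ?C" "q \<in> ?C" for p q
    using F.a_closed[OF that] by (simp only: free_algebra_simps(5))
  have neg: "- p \<in> ?C" if "p \<in> ?C" for p
    using that by simp
  have minus: "p - q \<in> ?C" if "p \<in> ?C" "q \<in> ?C" for p q
    using add[OF that(1) neg[OF that(2)]] by (simp only: add_uminus_conv_diff)
  have zero: "0 \<in> ?C" and one: "1 \<in> ?C"
    by simp_all
  have sum: "(\<Sum>i\<in>I. f i) \<in> ?C" if "\<And>i. i \<in> I \<Longrightarrow> f i \<in> ?C" for f and I :: "nat set"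
    using that
  proof (induction I rule: infinite_finite_induct)
    case (insert i I)
    then have "f i + sum f I \<in> ?C"
      by (intro add) blast+
    with insert.hyps show ?case
      by (simp only: sum.insert not_False_eq_True)
  qed (simp_all only: sum.infinite sum.empty zero not_False_eq_True)
  have X: "gen (XG i) \<in> ?C" and Y: "gen (YG i) \<in> ?C" if "i \<in> {1..n}" for i
    using that by (intro gen; simp add: leavitt_gens_def)+
  have "gen (XG i) * gen (YG j) - (if i = j then 1 else 0) \<in> ?C"
    if "i \<in> {1..n}" "j \<in> {1..n}" for i j
    using minus[OF mult[OF X[OF that(1)] Y[OF that(2)]] one]
      minus[OF mult[OF X[OF that(1)] Y[OF that(2)]] zero] by (cases "i = j") (simp_all only: if_True if_False refl)
  moreover have "(\<Sum>i = 1..n. gen (YG i) * gen (XG i)) - 1 \<in> ?C"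
    by (rule minus[OF sum one], rule mult[OF Y X])
  ultimately show ?thesis
    unfolding leavitt_relators_def by blast
qed

lemma ideal_leavitt_ideal:
  "ideal (leavitt_ideal n) (free_algebra (leavitt_gens n) :: (leavitt_gen fword \<Rightarrow>\<^sub>0 'k::field) ring)"
  unfolding leavitt_ideal_def
  by (rule ring.genideal_ideal[OF ring_free_algebra leavitt_relators_carrier])

lemma ring_leavitt: "ring (leavitt TYPE('k::field) n)"
proof -
  let ?Q = "free_algebra (leavitt_gens n) Quot (leavitt_ideal n :: (leavitt_gen fword \<Rightarrow>\<^sub>0 'k) set)"
  let ?L = "leavitt TYPE('k) n"
  interpret Q: ring ?Q
    by (rule ideal.quotient_is_ring[OF ideal_leavitt_ideal])
  have eqs: "carrier ?L = carrier ?Q" "monoid.mult ?L = monoid.mult ?Q"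
    "monoid.one ?L = monoid.one ?Q" "ring.zero ?L = ring.zero ?Q" "ring.add ?L = ring.add ?Q"
    by (simp_all add: leavitt_def FactRing_def ring.defs graded_ring.defs)
  show ?thesis
  proof (rule ringI)
    show "abelian_group ?L"
      by (rule abelian_groupI; unfold eqs)
        (erule (2) Q.a_assoc | erule (1) Q.a_closed | erule (1) Q.a_comm
          | erule Q.l_zero | rule Q.zero_closed | (rule bexI, erule Q.l_neg, erule Q.a_inv_closed))+
    show "monoid ?L"
      by (rule monoidI; unfold eqs)
        (erule (2) Q.m_assoc | erule (1) Q.m_closed | erule Q.l_one | erule Q.r_one
          | rule Q.one_closed)+
  qed (unfold eqs, (erule (2) Q.l_distr | erule (2) Q.r_distr)+)
qed


section \<open>Graded matrix rings\<close>

text \<open>Indices are shifted by one: rows, columns and shifts are numbered \<open>0, \<dots>, m - 1\<close>.\<close>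

definition graded_mat ::
    "nat \<Rightarrow> ('a, 'c) graded_ring_scheme \<Rightarrow> (nat \<Rightarrow> int) \<Rightarrow> 'a mat graded_ring"
    (\<open>\<bbbM>\<close>)
  where "\<bbbM> m A \<delta> =
    \<lparr> carrier = {M \<in> carrier_mat m m. \<forall>i<m. \<forall>j<m. M $$ (i, j) \<in> carrier A},
      monoid.mult = (\<lambda>M N. mat m m (\<lambda>(i, j). \<Oplus>\<^bsub>A\<^esub>l \<in> {..<m}. M $$ (i, l) \<otimes>\<^bsub>A\<^esub> N $$ (l, j))),
      monoid.one = mat m m (\<lambda>(i, j). if i = j then \<one>\<^bsub>A\<^esub> else \<zero>\<^bsub>A\<^esub>),
      ring.zero = mat m m (\<lambda>(i, j). \<zero>\<^bsub>A\<^esub>),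
      ring.add = (\<lambda>M N. mat m m (\<lambda>(i, j). M $$ (i, j) \<oplus>\<^bsub>A\<^esub> N $$ (i, j))),
      hcomp = (\<lambda>d. {M \<in> carrier_mat m m. \<forall>i<m. \<forall>j<m. M $$ (i, j) \<in> hcomp A (d + \<delta> j - \<delta> i)}) \<rparr>"

end

theory Submission
  imports Defs "HOL-Library.Function_Algebras" "Jordan_Normal_Form.Determinant"
begin

text \<open>
  Let \<open>L\<^sub>n\<close> be the Leavitt algebra.  For a word \<open>w\<close> of length \<open>r\<close> in \<open>1, \<dots>, n\<close> let \<open>x\<^sub>w\<close> be the product
  of the \<open>x\<^sub>i\<close> along \<open>w\<close> and \<open>y\<^sub>w\<close> the product of the \<open>y\<^sub>i\<close> in the opposite order.  Then
  \<open>x\<^sub>w y\<^sub>v = \<delta>\<^sub>w\<^sub>v\<close> for words of the same length and \<open>\<Sum> y\<^sub>w x\<^sub>w = 1\<close>.  The classification replaces graded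
  K-theory by two elementary uses of these relations.

  \<^bold>\<open>Expansion.\<close>  An index \<open>i\<close> of shift \<open>\<lambda>\<^sub>i\<close> may be replaced by the \<open>n\<^sup>r\<close> indices \<open>(i, w)\<close> of shift \<open>\<lambda>\<^sub>i + r\<close>:
  the entry \<open>a\<close> becomes the block of all \<open>x\<^sub>w a y\<^sub>v\<close>, which is a conjugation by mutually inverse
  rectangular matrices.  With \<open>r = N - \<lambda>\<^sub>i\<close> all shifts become equal and then irrelevant, so
  the matrix ring is graded isomorphic to the unshifted ring of \<open>m\<times>m\<close> matrices with
  \<open>m = \<Sum> n\<^bsup>N - \<lambda>\<^sub>i\<^esup> = n\<^sup>N \<Sum> n\<^bsup>- \<lambda>\<^sub>i\<^esup>\<close> (\<open>gr_equiv_leavitt_standard\<close>).  If the two sums differ by a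
  power of \<open>n\<close>, suitable values of \<open>N\<close> on both sides lead to the same \<open>m\<close>.

  \<^bold>\<open>Rank.\<close>  For \<open>a\<close> of degree zero and all long enough words of equal length, \<open>x\<^sub>w a y\<^sub>v\<close> is a scalar
  (\<open>homogeneous_corner_scalar\<close>).  Expansion therefore carries any finite set of degree zero \<open>m\<times>m\<close>
  matrices into \<open>(m n\<^sup>r)\<times>(m n\<^sup>r)\<close> matrices over the field \<open>K\<close>.  There, if \<open>v\<^sub>i u\<^sub>j = \<delta>\<^sub>i\<^sub>j D\<close> and
  \<open>\<Sum> u\<^sub>i v\<^sub>i = 1\<close> with \<open>q\<close> summands, the size is \<open>q\<close> times the rank of \<open>D\<close>.  The rank is the degree of
  \<open>det (1 + (t - 1) D)\<close>, which makes this a computation with determinants (\<open>idem_rank_partition\<close>).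

  Suppose now that the unshifted rings of sizes \<open>m\<close> over \<open>L\<^sub>n\<close> and \<open>m'\<close> over \<open>L\<^sub>n\<^sub>'\<close> are graded isomorphic.
  In the second ring the images of the \<open>x\<^sub>i, y\<^sub>i\<close> of the first, and its own \<open>x\<^sub>i, y\<^sub>i\<close>, both lead to
  such decompositions of \<open>1\<close>, with \<open>n\<close> and \<open>n'\<close> summands and the same \<open>D\<close>; hence \<open>n = n'\<close>
  (\<open>graded_iso_order_eq\<close>).  The images of the \<open>m\<times>m\<close> matrix units give \<open>m dvd m' n\<^sup>r\<close>
  (\<open>graded_iso_dvd\<close>), and since the inverse isomorphism is graded as well
  (\<open>graded_iso_Lops_sym\<close>), also \<open>m' dvd m n\<^sup>s\<close>.  As \<open>n\<close> is prime, \<open>m'\<close> is \<open>m\<close> times a power of \<open>n\<close>, which is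
  the asserted relation between the sums.

  The computations take place in a faithful representation of \<open>L\<^sub>n\<close> by additive operators
  (\<open>gr_equiv_leavitt_ops\<close>): the operators form a type of class \<open>ring_1\<close>, so that matrices over them
  can be multiplied and summed with the usual operations on matrices over a type.
\<close>

section \<open>Endomorphisms of abelian groups\<close>

typedef (overloaded) 'a endo = "{f :: 'a::ab_group_add \<Rightarrow> 'a. \<forall>x y. f (x + y) = f x + f y}"
  morphisms app Endo
  by (rule exI[of _ id]) simp

setup_lifting type_definition_endo

instantiation endo :: ("{ab_group_add, zero_neq_one}") ring_1
begin

lift_definition zero_endo :: "'a endo" is "\<lambda>x. 0" by simp
lift_definition one_endo :: "'a endo" is "\<lambda>x. x" by simp
lift_definition plus_endo :: "'a endo \<Rightarrow> 'a endo \<Rightarrow> 'a endo" is "\<lambda>f g x. f x + g x"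
  by (simp add: algebra_simps)
lift_definition minus_endo :: "'a endo \<Rightarrow> 'a endo \<Rightarrow> 'a endo" is "\<lambda>f g x. f x - g x"
  by (simp add: algebra_simps)
lift_definition uminus_endo :: "'a endo \<Rightarrow> 'a endo" is "\<lambda>f x. - f x"
  by (simp add: algebra_simps)
lift_definition times_endo :: "'a endo \<Rightarrow> 'a endo \<Rightarrow> 'a endo" is "\<lambda>f g x. f (g x)"
  by simp

instance
proof
  show "(0 :: 'a endo) \<noteq> 1"
    by transfer (metis zero_neq_one)
qed (transfer; simp add: fun_eq_iff algebra_simps)+

end

lemma app_simps [simp]:
  "app 0 v = 0" "app 1 v = v" "app (S + T) v = app S v + app T v"
  "app (S - T) v = app S v - app T v" "app (- T) v = - app T v" "app (S * T) v = app S (app T v)"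
  by (transfer; simp)+

lemma app_add [simp]: "app T (v + w) = app T v + app T w"
  by transfer simp

lemma app_zero [simp]: "app T 0 = 0"
  by (metis add_cancel_right_right app_add)

lemma endo_eqI: "(\<And>v. app S v = app T v) \<Longrightarrow> S = T"
  by transfer (simp add: fun_eq_iff)

lemma app_sum: "app (sum T A) v = (\<Sum>a\<in>A. app (T a) v)"
  by (induction A rule: infinite_finite_induct) simp_all

section \<open>Operators satisfying the Leavitt relations\<close>

lemma sum_apply: "sum f A x = (\<Sum>a\<in>A. f a x)"
  by (induction A rule: infinite_finite_induct) simp_all

text \<open>
  The operators act on all functions on \<open>\<int> \<times> \<nat>\<close>.  The second coordinate carries the self-similarity:
  \<open>\<nat>\<close> is the disjoint union of \<open>n\<close> copies of itself, the residue classes modulo \<open>n\<close>.  The first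
  coordinate is the degree; without it the representation would not see the grading, and for
  \<open>n = 1\<close> it would not be faithful.
\<close>
type_synonym 'k state = "int \<times> nat \<Rightarrow> 'k"

lift_definition scal :: "'k::field \<Rightarrow> 'k state endo" is "\<lambda>c f x. c * f x"
  by (simp add: fun_eq_iff algebra_simps)

text \<open>
  The image of \<open>x\<^sub>i\<close> restricts a function to the residue class of \<open>i - 1\<close> and reparametrises; the image
  \<open>spread n i\<close> of \<open>y\<^sub>i\<close> below is the extension by zero from that class.
\<close>
lift_definition shrink :: "nat \<Rightarrow> nat \<Rightarrow> 'k::field state endo"
  is "\<lambda>n i f (d, l). f (d + 1, n * l + (i - 1))"
  by (simp add: fun_eq_iff)

lift_definition spread :: "nat \<Rightarrow> nat \<Rightarrow> 'k::field state endo"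
  is "\<lambda>n i f (d, l). if l mod n = i - 1 then f (d - 1, l div n) else 0"
  by (simp add: fun_eq_iff)

lemma app_scal: "app (scal c) f = (\<lambda>x. c * f x)"
  by transfer simp

lemma app_shrink: "app (shrink n i) f (d, l) = f (d + 1, n * l + (i - 1))"
  by transfer simp

lemma app_spread:
  "app (spread n i) f (d, l) = (if l mod n = i - 1 then f (d - 1, l div n) else 0)"
  by transfer simp

lemma scal_simps [simp]:
  "scal 0 = 0" "scal 1 = 1"
  "scal (c + d) = scal c + scal d" "scal (c * d) = scal c * scal d" "scal (- c) = - scal c"
  by (auto intro!: endo_eqI simp: app_scal fun_eq_iff algebra_simps)

lemma inj_scal: "inj (scal :: 'k::field \<Rightarrow> _)"
proof (rule injI)
  fix c d :: 'k
  assume "scal c = scal d"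
  then have "app (scal c) (\<lambda>_. 1) (0, 0) = app (scal d) (\<lambda>_. 1) (0, 0)"
    by simp
  then show "c = d"
    by (simp add: app_scal)
qed

lemma shrink_spread:
  assumes "i \<in> {1..n}" "j \<in> {1..n}"
  shows "shrink n i * spread n j = (if i = j then 1 else 0 :: 'k::field state endo)"
proof (rule endo_eqI, rule ext, clarify)
  fix f :: "'k state" and d l
  obtain a b where ab: "i = Suc a" "a < n" "j = Suc b" "b < n"
    using assms by (cases i; cases j) auto
  then show "app (shrink n i * spread n j) f (d, l) = app (if i = j then 1 else 0) f (d, l)"
    by (auto simp: app_shrink app_spread)
qed

lemma sum_spread_shrink:
  assumes "n > 0"
  shows "(\<Sum>i = 1..n. spread n i * shrink n i) = (1 :: 'k::field state endo)"
proof (rule endo_eqI, rule ext, clarify)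
  fix f :: "'k state" and d l
  have "(\<Sum>i = 1..n. app (spread n i * shrink n i) f) (d, l) =
      (\<Sum>i = 1..n. app (spread n i * shrink n i) f (d, l))"
    by (simp add: sum_apply)
  also have "\<dots> = (\<Sum>i = 1..n. if i = l mod n + 1 then f (d, l) else 0)"
  proof (rule sum.cong)
    fix i
    assume "i \<in> {1..n}"
    then have "l mod n = i - 1 \<longleftrightarrow> i = l mod n + 1"
      by auto
    then show "app (spread n i * shrink n i) f (d, l) = (if i = l mod n + 1 then f (d, l) else 0)"
      by (simp add: app_spread app_shrink)
  qed simp
  also have "\<dots> = f (d, l)"
    using assms by (simp add: Suc_leI)
  finally show "app (\<Sum>i = 1..n. spread n i * shrink n i) f (d, l) = app 1 f (d, l)"
    by (simp add: app_sum)
qed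

lemma scal_commute_shrink: "scal c * shrink n i = shrink n i * scal c"
  by (rule endo_eqI) (auto simp: app_scal app_shrink)

lemma scal_commute_spread: "scal c * spread n i = spread n i * scal c"
  by (rule endo_eqI) (auto simp: app_scal app_spread)

section \<open>The representation of the free algebra\<close>

fun gen_op :: "nat \<Rightarrow> leavitt_gen \<Rightarrow> 'k::field state endo"
  where
    "gen_op n (XG i) = shrink n i"
  | "gen_op n (YG i) = spread n i"

definition word_op :: "nat \<Rightarrow> leavitt_gen fword \<Rightarrow> 'k::field state endo"
  where "word_op n w = prod_list (map (gen_op n) (letters w))"

definition rep :: "nat \<Rightarrow> (leavitt_gen fword \<Rightarrow>\<^sub>0 'k::field) \<Rightarrow> 'k state endo"
  where "rep n p = (\<Sum>w\<in>Poly_Mapping.keys p. scal (Poly_Mapping.lookup p w) * word_op n w)"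

lemma word_op_simps [simp]:
  "word_op n 0 = 1" "word_op n (v + w) = word_op n v * word_op n w"
  "word_op n (FWord [g]) = gen_op n g"
  by (simp_all add: word_op_def)

lemma scal_commute_word_op: "scal c * word_op n w = word_op n w * scal c"
proof -
  have gen: "scal c * gen_op n g = gen_op n g * scal c" for g
    by (cases g) (simp_all add: scal_commute_shrink scal_commute_spread)
  have "scal c * prod_list (map (gen_op n) gs) = prod_list (map (gen_op n) gs) * scal c" for gs
  proof (induction gs)
    case (Cons g gs)
    then show ?case
      by (simp flip: mult.assoc add: gen) (simp add: mult.assoc)
  qed simp
  then show ?thesis
    by (simp add: word_op_def)
qed

lemma rep_superset:
  assumes "finite W" "Poly_Mapping.keys p \<subseteq> W"
  shows "rep n p = (\<Sum>w\<in>W. scal (Poly_Mapping.lookup p w) * word_op n w)"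
  unfolding rep_def
  by (rule sum.mono_neutral_left[OF assms]) (simp add: not_in_keys_iff_lookup_eq_zero)

lemma rep_add [simp]: "rep n (p + q) = rep n p + rep n q"
proof -
  let ?W = "Poly_Mapping.keys p \<union> Poly_Mapping.keys q"
  have "finite ?W"
    by simp
  then show ?thesis
    using Poly_Mapping.keys_add[of p q]
    by (simp add: rep_superset[of ?W] lookup_add distrib_right sum.distrib)
qed

lemma rep_single [simp]: "rep n (Poly_Mapping.single w c) = scal c * word_op n w"
  by (cases "c = 0") (simp_all add: rep_def)

lemma rep_zero [simp]: "rep n 0 = 0" and rep_one [simp]: "rep n 1 = 1"
  using rep_single[of n 0 1] by (simp_all add: rep_def del: rep_single)

lemma rep_uminus [simp]: "rep n (- p) = - rep n p"
  using rep_add[of n p "- p"] by (simp add: eq_neg_iff_add_eq_0 add.commute del: rep_add)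

lemma rep_minus [simp]: "rep n (p - q) = rep n p - rep n q"
  using rep_add[of n p "- q"] by (simp del: rep_add)

lemma rep_sum: "rep n (sum f A) = (\<Sum>a\<in>A. rep n (f a))"
  by (induction A rule: infinite_finite_induct) simp_all

text \<open>
  Every element of a monoid algebra is a sum of monomials, so additive statements may be checked
  on monomials.
\<close>
lemma poly_mapping_sum_single:
  "p = (\<Sum>w\<in>Poly_Mapping.keys p. Poly_Mapping.single w (Poly_Mapping.lookup p w))"
  for p :: "'a \<Rightarrow>\<^sub>0 'b::comm_monoid_add"
  by (rule poly_mapping_eqI)
    (auto simp: lookup_sum lookup_single when_def not_in_keys_iff_lookup_eq_zero)

lemma poly_mapping_induct_single [case_names single add]:
  fixes p :: "'a \<Rightarrow>\<^sub>0 'b::comm_monoid_add"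
  assumes single: "\<And>w c. P (Poly_Mapping.single w c)"
    and add: "\<And>p q. P p \<Longrightarrow> P q \<Longrightarrow> P (p + q)"
  shows "P p"
proof -
  have "P (\<Sum>w\<in>W. Poly_Mapping.single w (Poly_Mapping.lookup p w))" if "finite W" for W
    using that by induction (use single[of undefined 0] in \<open>auto intro: single add\<close>)
  from this[of "Poly_Mapping.keys p"] show ?thesis
    by (simp flip: poly_mapping_sum_single)
qed

lemma rep_mult [simp]: "rep n (p * q) = rep n p * rep n q"
proof (induction p rule: poly_mapping_induct_single)
  case (single w c)
  show ?case
  proof (induction q rule: poly_mapping_induct_single)
    case (single v d)
    have "scal c * scal d * (word_op n w * word_op n v) =
        scal c * (scal d * word_op n w) * word_op n v"
      by (simp add: mult.assoc)
    then show ?case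
      by (simp add: mult_single scal_commute_word_op[of d n w] mult.assoc)
  qed (simp add: distrib_left)
qed (simp add: distrib_right)

section \<open>Degrees of operators\<close>

text \<open>
  An operator has degree \<open>d\<close> if the part of \<open>T f\<close> in degree \<open>e\<close> depends only on the part of \<open>f\<close> in
  degree \<open>e - d\<close>.
\<close>
definition has_degree :: "int \<Rightarrow> 'k::field state endo \<Rightarrow> bool"
  where "has_degree d T \<longleftrightarrow> (\<forall>f g e. (\<forall>l. f (e - d, l) = g (e - d, l)) \<longrightarrow>
    (\<forall>l. app T f (e, l) = app T g (e, l)))"

lemma has_degree_add: "has_degree d S \<Longrightarrow> has_degree d T \<Longrightarrow> has_degree d (S + T)"
  unfolding has_degree_def by simp metis

lemma has_degree_sum:
  "(\<And>a. a \<in> A \<Longrightarrow> has_degree d (f a)) \<Longrightarrow> has_degree d (sum f A)"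
proof (induction A rule: infinite_finite_induct)
  case (insert a A)
  then show ?case
    by (auto intro: has_degree_add)
qed (simp_all add: has_degree_def)

lemma has_degree_mult: "has_degree a S \<Longrightarrow> has_degree b T \<Longrightarrow> has_degree (a + b) (S * T)"
  unfolding has_degree_def by (simp add: diff_diff_eq[symmetric])

lemma has_degree_scal: "has_degree 0 (scal c)"
  and has_degree_one: "has_degree 0 1"
  and has_degree_gen_op: "has_degree (gen_degree g) (gen_op n g)"
  by (cases g; simp add: has_degree_def app_scal app_shrink app_spread)+

lemma has_degree_word_op: "has_degree (word_degree w) (word_op n w)"
proof -
  have "has_degree (\<Sum>g\<leftarrow>gs. gen_degree g) (prod_list (map (gen_op n) gs))" for gs
    by (induction gs) (auto intro: has_degree_mult has_degree_one has_degree_gen_op)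
  then show ?thesis
    by (simp add: word_op_def word_degree_def)
qed

lemma has_degree_rep:
  fixes p :: "leavitt_gen fword \<Rightarrow>\<^sub>0 'k::field"
  assumes "\<forall>w\<in>Poly_Mapping.keys p. word_degree w = d"
  shows "has_degree d (rep n p)"
  unfolding rep_def
proof (rule has_degree_sum)
  fix w
  assume "w \<in> Poly_Mapping.keys p"
  with has_degree_mult[OF has_degree_scal[of "Poly_Mapping.lookup p w"] has_degree_word_op[of w n]]
  show "has_degree d (scal (Poly_Mapping.lookup p w) * word_op n w)"
    using assms by simp
qed

definition slice :: "int \<Rightarrow> 'k::field state \<Rightarrow> 'k state"
  where "slice a f = (\<lambda>(e, l). if e = a then f (e, l) else 0)"

lemma slice_add: "slice a (f + g) = slice a f + slice a g"
  by (auto simp: slice_def)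

text \<open>
  The block of an operator that maps degree \<open>e - d\<close> to degree \<open>e\<close>.  It is defined for
  every additive operator, so that homogeneous components are unique without any knowledge of
  the relations of the algebra.
\<close>
lift_definition degree_part :: "int \<Rightarrow> 'k::field state endo \<Rightarrow> 'k state endo"
  is "\<lambda>d T f (e, l). T (slice (e - d) f) (e, l)"
  by (auto simp: slice_add fun_eq_iff)

lemma app_degree_part: "app (degree_part d T) f (e, l) = app T (slice (e - d) f) (e, l)"
  by transfer simp

lemma degree_part_add: "degree_part d (S + T) = degree_part d S + degree_part d T"
  by (rule endo_eqI) (auto simp: app_degree_part)

lemma degree_part_zero [simp]: "degree_part d 0 = 0"
  by (rule endo_eqI) (auto simp: app_degree_part)

lemma degree_part_sum: "degree_part d (sum f A) = (\<Sum>a\<in>A. degree_part d (f a))"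
  by (induction A rule: infinite_finite_induct) (simp_all add: degree_part_add)

lemma degree_part_homogeneous:
  assumes "has_degree d T"
  shows "degree_part d' T = (if d' = d then T else 0)"
proof (rule endo_eqI, rule ext, clarify)
  fix f :: "'a state" and e l
  have "app T (slice (e - d') f) (e, l) = app T (if d' = d then f else 0) (e, l)"
    using assms[unfolded has_degree_def, rule_format, of "slice (e - d') f" e "if d' = d then f else 0" l]
    by (auto simp: slice_def)
  then show "app (degree_part d' T) f (e, l) = app (if d' = d then T else 0) f (e, l)"
    by (simp add: app_degree_part)
qed

section \<open>Arithmetic modulo the Leavitt relations\<close>

type_synonym 'k leavitt_poly = "leavitt_gen fword \<Rightarrow>\<^sub>0 'k"

text \<open>
  The free algebra on all \<open>x\<^sub>i, y\<^sub>i\<close> is a type; the generators with index in \<open>1, \<dots>, n\<close>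
  generate a subring of it.
\<close>
definition leavitt_polys :: "nat \<Rightarrow> 'k::field leavitt_poly set"
  where "leavitt_polys n = carrier (free_algebra (leavitt_gens n))"

lemma single_leavitt_polys:
  "set (letters w) \<subseteq> leavitt_gens n \<Longrightarrow> Poly_Mapping.single w c \<in> leavitt_polys n"
  by (simp add: leavitt_polys_def)

lemma leavitt_polys_closed [intro]:
  shows "0 \<in> leavitt_polys n" "1 \<in> leavitt_polys n" "Poly_Mapping.single 0 c \<in> leavitt_polys n"
    and "p \<in> leavitt_polys n \<Longrightarrow> - p \<in> leavitt_polys n"
    and "p \<in> leavitt_polys n \<Longrightarrow> q \<in> leavitt_polys n \<Longrightarrow> p + q \<in> leavitt_polys n"
    and "p \<in> leavitt_polys n \<Longrightarrow> q \<in> leavitt_polys n \<Longrightarrow> p * q \<in> leavitt_polys n"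
proof -
  interpret ring "free_algebra (leavitt_gens n) :: 'k::field leavitt_poly ring"
    by (rule ring_free_algebra)
  show "p \<in> leavitt_polys n \<Longrightarrow> q \<in> leavitt_polys n \<Longrightarrow> p + q \<in> leavitt_polys n"
    and "p \<in> leavitt_polys n \<Longrightarrow> q \<in> leavitt_polys n \<Longrightarrow> p * q \<in> leavitt_polys n"
    using a_closed[of p q] m_closed[of p q] unfolding leavitt_polys_def
    by (simp_all only: free_algebra_simps(2,5))
qed (auto simp add: leavitt_polys_def)

lemma leavitt_polys_sum [intro]:
  "(\<And>a. a \<in> A \<Longrightarrow> f a \<in> leavitt_polys n) \<Longrightarrow> sum f A \<in> leavitt_polys n"
  by (induction A rule: infinite_finite_induct) (auto)

lemma gen_leavitt_polys [intro]:
  "i \<in> {1..n} \<Longrightarrow> gen (XG i) \<in> leavitt_polys n" "i \<in> {1..n} \<Longrightarrow> gen (YG i) \<in> leavitt_polys n"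
  by (auto simp: gen_def leavitt_gens_def intro!: single_leavitt_polys)

lemma leavitt_ideal_closed:
  fixes p q :: "'k::field leavitt_poly"
  shows "p \<in> leavitt_ideal n \<Longrightarrow> p \<in> leavitt_polys n"
    and "(0 :: 'k leavitt_poly) \<in> leavitt_ideal n"
    and "p \<in> leavitt_ideal n \<Longrightarrow> - p \<in> leavitt_ideal n"
    and "p \<in> leavitt_ideal n \<Longrightarrow> q \<in> leavitt_ideal n \<Longrightarrow> p + q \<in> leavitt_ideal n"
    and "p \<in> leavitt_ideal n \<Longrightarrow> q \<in> leavitt_polys n \<Longrightarrow> p * q \<in> leavitt_ideal n"
    and "p \<in> leavitt_ideal n \<Longrightarrow> q \<in> leavitt_polys n \<Longrightarrow> q * p \<in> leavitt_ideal n"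
proof -
  interpret ideal "leavitt_ideal n" "free_algebra (leavitt_gens n) :: 'k leavitt_poly ring"
    by (rule ideal_leavitt_ideal)
  show "p \<in> leavitt_ideal n \<Longrightarrow> p \<in> leavitt_polys n"
    using a_subset unfolding leavitt_polys_def by blast
  show "(0 :: 'k leavitt_poly) \<in> leavitt_ideal n"
    using additive_subgroup.zero_closed[OF additive_subgroup_axioms] by simp
  show "p \<in> leavitt_ideal n \<Longrightarrow> q \<in> leavitt_ideal n \<Longrightarrow> p + q \<in> leavitt_ideal n"
    using additive_subgroup.a_closed[OF additive_subgroup_axioms, of p q] by simp
  show mult: "p \<in> leavitt_ideal n \<Longrightarrow> q \<in> leavitt_polys n \<Longrightarrow> p * q \<in> leavitt_ideal n"
    "p \<in> leavitt_ideal n \<Longrightarrow> q \<in> leavitt_polys n \<Longrightarrow> q * p \<in> leavitt_ideal n"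
    for p q :: "'k leavitt_poly"
    using I_r_closed[of p q] I_l_closed[of p q] unfolding leavitt_polys_def
    by (simp_all only: free_algebra_simps(2))
  show "p \<in> leavitt_ideal n \<Longrightarrow> - p \<in> leavitt_ideal n"
    using mult(1)[of p "- 1"] by auto
qed

abbreviation leavitt_eq where "leavitt_eq n p q \<equiv> p - q \<in> leavitt_ideal n"

lemma leavitt_eq_refl: "leavitt_eq n p p"
  by (simp add: leavitt_ideal_closed)

lemma leavitt_eq_trans [trans]: "leavitt_eq n p q \<Longrightarrow> leavitt_eq n q r \<Longrightarrow> leavitt_eq n p r"
  using leavitt_ideal_closed(4)[of "p - q" n "q - r"] by simp

lemma leavitt_eq_sym: "leavitt_eq n p q \<Longrightarrow> leavitt_eq n q p"
  using leavitt_ideal_closed(3)[of "p - q" n] by simp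

lemma leavitt_eq_mult_left: "leavitt_eq n p q \<Longrightarrow> r \<in> leavitt_polys n \<Longrightarrow> leavitt_eq n (r * p) (r * q)"
  using leavitt_ideal_closed(6)[of "p - q" n r] by (simp add: algebra_simps)

lemma leavitt_eq_mult_right: "leavitt_eq n p q \<Longrightarrow> r \<in> leavitt_polys n \<Longrightarrow> leavitt_eq n (p * r) (q * r)"
  using leavitt_ideal_closed(5)[of "p - q" n r] by (simp add: algebra_simps)

lemma leavitt_ideal_sum: "(\<And>a. a \<in> A \<Longrightarrow> f a \<in> leavitt_ideal n) \<Longrightarrow> sum f A \<in> leavitt_ideal n"
  by (induction A rule: infinite_finite_induct) (auto intro: leavitt_ideal_closed)

lemma leavitt_eq_sum:
  "(\<And>a. a \<in> A \<Longrightarrow> leavitt_eq n (f a) (g a)) \<Longrightarrow> leavitt_eq n (sum f A) (sum g A)"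
  using leavitt_ideal_sum[of A "\<lambda>a. f a - g a" n] by (simp add: sum_subtractf)

lemma leavitt_relators_ideal: "p \<in> leavitt_relators n \<Longrightarrow> p \<in> leavitt_ideal n"
  using ring.genideal_self[OF ring_free_algebra leavitt_relators_carrier]
  unfolding leavitt_ideal_def by blast

lemma leavitt_eq_xy:
  "i \<in> {1..n} \<Longrightarrow> j \<in> {1..n} \<Longrightarrow>
    leavitt_eq n (gen (XG i) * gen (YG j)) (if i = j then 1 else 0)"
  by (rule leavitt_relators_ideal) (auto simp: leavitt_relators_def)

lemma leavitt_eq_sum_yx: "leavitt_eq n (\<Sum>i = 1..n. gen (YG i) * gen (XG i)) 1"
  by (rule leavitt_relators_ideal) (auto simp: leavitt_relators_def)

lemma rep_gen [simp]: "rep n (gen g) = gen_op n g"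
  by (simp add: gen_def)

text \<open>
  The polynomials that act as zero form an ideal, and it contains the relators.
\<close>
lemma rep_leavitt_ideal:
  fixes p :: "'k::field leavitt_poly"
  assumes "n > 0" "p \<in> leavitt_ideal n"
  shows "rep n p = 0"
proof -
  let ?F = "free_algebra (leavitt_gens n) :: 'k leavitt_poly ring"
  let ?J = "{p \<in> leavitt_polys n. rep n p = (0 :: 'k state endo)}"
  interpret ring ?F
    by (rule ring_free_algebra)
  have "ideal ?J ?F"
  proof (rule idealI)
    show "subgroup ?J (add_monoid ?F)"
    proof (rule add.subgroupI)
      fix p
      assume p: "p \<in> ?J"
      then have "\<ominus>\<^bsub>?F\<^esub> p = - p"
        by (intro minus_equality) (auto simp: leavitt_polys_def)
      with p show "\<ominus>\<^bsub>?F\<^esub> p \<in> ?J"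
        by auto
    qed (auto simp: leavitt_polys_def[symmetric] simp del: free_algebra_simps(1))
  qed (auto simp: leavitt_polys_def[symmetric] ring_axioms simp del: free_algebra_simps(1))
  moreover have "leavitt_relators n \<subseteq> ?J"
  proof
    fix q :: "'k leavitt_poly"
    assume q: "q \<in> leavitt_relators n"
    then have "rep n q = 0"
      using sum_spread_shrink[OF assms(1)]
      by (auto simp: leavitt_relators_def rep_sum shrink_spread simp del: One_nat_def)
    then show "q \<in> ?J"
      using leavitt_relators_carrier q unfolding leavitt_polys_def by blast
  qed
  ultimately show ?thesis
    using genideal_minimal[of ?J "leavitt_relators n"] assms(2) unfolding leavitt_ideal_def by blast
qed

lemma rep_leavitt_eq: "n > 0 \<Longrightarrow> leavitt_eq n p q \<Longrightarrow> rep n p = rep n q"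
  using rep_leavitt_ideal[of n "p - q"] by simp

text \<open>
  The letters of \<open>yw w\<close> come in the opposite order, so that \<open>xw w * yw w\<close> collapses from
  the middle.
\<close>
fun xw :: "nat list \<Rightarrow> 'k::field leavitt_poly"
  where "xw [] = 1" | "xw (i # w) = gen (XG i) * xw w"

fun yw :: "nat list \<Rightarrow> 'k::field leavitt_poly"
  where "yw [] = 1" | "yw (i # w) = yw w * gen (YG i)"

definition words :: "nat \<Rightarrow> nat \<Rightarrow> nat list set"
  where "words n r = {w. set w \<subseteq> {1..n} \<and> length w = r}"

lemma finite_words [simp]: "finite (words n r)" and card_words: "card (words n r) = n ^ r"
  using finite_lists_length_eq[of "{1..n}" r] card_lists_length_eq[of "{1..n}" r]
  by (simp_all add: words_def)

lemma words_0: "words n 0 = {[]}"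
  by (auto simp: words_def)

lemma words_Suc: "words n (Suc r) = (\<lambda>(i, w). i # w) ` ({1..n} \<times> words n r)"
  by (auto simp: words_def length_Suc_conv image_iff)

lemma xw_yw_leavitt_polys [intro]:
  assumes "w \<in> words n r"
  shows "xw w \<in> leavitt_polys n" "yw w \<in> leavitt_polys n"
proof -
  have w: "set w \<subseteq> {1..n}"
    using assms by (simp add: words_def)
  show "xw w \<in> leavitt_polys n"
    using w by (induction w) (auto intro!: leavitt_polys_closed gen_leavitt_polys)
  show "yw w \<in> leavitt_polys n"
    using w by (induction w) (auto intro!: leavitt_polys_closed gen_leavitt_polys)
qed

lemma leavitt_eq_xw_yw:
  assumes "w \<in> words n r" "v \<in> words n r"
  shows "leavitt_eq n (xw w * yw v :: 'k::field leavitt_poly) (if w = v then 1 else 0)"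
  using assms
proof (induction r arbitrary: w v)
  case 0
  then show ?case
    by (simp add: words_0 leavitt_ideal_closed)
next
  case (Suc r)
  then obtain i w' j v' where wv: "w = i # w'" "v = j # v'" "i \<in> {1..n}" "j \<in> {1..n}"
    "w' \<in> words n r" "v' \<in> words n r"
    by (auto simp: words_Suc)
  have "leavitt_eq n (gen (XG i) * (xw w' * yw v') * gen (YG j) :: 'k leavitt_poly)
      (gen (XG i) * (if w' = v' then 1 else 0) * gen (YG j))"
    by (intro leavitt_eq_mult_left leavitt_eq_mult_right gen_leavitt_polys wv Suc.IH[OF wv(5,6)])
  also have "leavitt_eq n (gen (XG i) * (if w' = v' then 1 else 0) * gen (YG j))
      (if w = v then 1 else 0)"
    using leavitt_eq_xy[OF wv(3,4)] wv by (auto simp: leavitt_ideal_closed)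
  finally show ?case
    by (simp add: wv mult.assoc)
qed

lemma leavitt_eq_sum_yw_xw:
  "leavitt_eq n (\<Sum>w\<in>words n r. yw w * xw w :: 'k::field leavitt_poly) 1"
proof (induction r)
  case 0
  then show ?case
    by (simp add: words_0 leavitt_ideal_closed)
next
  case (Suc r)
  have "(\<Sum>w\<in>words n (Suc r). yw w * xw w :: 'k leavitt_poly) =
      (\<Sum>i = 1..n. \<Sum>w\<in>words n r. yw (i # w) * xw (i # w))"
    unfolding words_Suc by (subst sum.reindex) (auto simp: inj_on_def sum.cartesian_product intro!: sum.cong)
  also have "\<dots> = (\<Sum>w\<in>words n r. \<Sum>i = 1..n. yw (i # w) * xw (i # w))"
    by (rule sum.swap)
  also have "\<dots> = (\<Sum>w\<in>words n r. yw w * (\<Sum>i = 1..n. gen (YG i) * gen (XG i)) * xw w)"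
    by (simp add: sum_distrib_left sum_distrib_right mult.assoc)
  finally have "(\<Sum>w\<in>words n (Suc r). yw w * xw w :: 'k leavitt_poly) =
      (\<Sum>w\<in>words n r. yw w * (\<Sum>i = 1..n. gen (YG i) * gen (XG i)) * xw w)" .
  moreover have "leavitt_eq n
      (\<Sum>w\<in>words n r. yw w * (\<Sum>i = 1..n. gen (YG i) * gen (XG i)) * xw w :: 'k leavitt_poly)
      (\<Sum>w\<in>words n r. yw w * 1 * xw w)"
    by (intro leavitt_eq_sum leavitt_eq_mult_left leavitt_eq_mult_right leavitt_eq_sum_yx) auto
  ultimately have "leavitt_eq n (\<Sum>w\<in>words n (Suc r). yw w * xw w :: 'k leavitt_poly)
      (\<Sum>w\<in>words n r. yw w * xw w)"
    by (simp only: mult_1_right)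
  then show ?case
    using Suc.IH by (rule leavitt_eq_trans)
qed

lemma xw_append: "xw (v @ w) = xw v * xw w"
  by (induction v) (simp_all add: mult.assoc)

lemma single_FWord_Cons:
  "Poly_Mapping.single (FWord (g # gs)) c = gen g * Poly_Mapping.single (FWord gs) c"
  by (simp add: gen_def mult_single plus_fword_def)

section \<open>Corners of homogeneous elements\<close>

text \<open>
  Reading the letters of a monomial from left to right, \<open>x\<^sub>i\<close> lengthens the word \<open>w\<close> by \<open>i\<close>
  and \<open>y\<^sub>j\<close> either cancels its last letter or kills the product.  As \<open>w\<close> is at least as
  long as the monomial, it is never exhausted.  The length that remains is dictated by the degree.
\<close>
lemma xw_times_word:
  assumes "set gs \<subseteq> leavitt_gens n" "w \<in> words n r" "length gs \<le> r"
  shows "Poly_Mapping.single (FWord gs) 1 \<in> leavitt_polys n \<and>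
    (leavitt_eq n (xw w * Poly_Mapping.single (FWord gs) 1 :: 'k::field leavitt_poly) 0 \<or>
     (\<exists>r' w'. w' \<in> words n r' \<and> int r' = int r - word_degree (FWord gs) \<and>
       leavitt_eq n (xw w * Poly_Mapping.single (FWord gs) 1 :: 'k leavitt_poly) (xw w')))"
proof
  show "Poly_Mapping.single (FWord gs) 1 \<in> leavitt_polys n"
    using assms(1) by (simp add: single_leavitt_polys)
  show "leavitt_eq n (xw w * Poly_Mapping.single (FWord gs) 1 :: 'k leavitt_poly) 0 \<or>
     (\<exists>r' w'. w' \<in> words n r' \<and> int r' = int r - word_degree (FWord gs) \<and>
       leavitt_eq n (xw w * Poly_Mapping.single (FWord gs) 1 :: 'k leavitt_poly) (xw w'))"
    using assms
  proof (induction gs arbitrary: w r)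
    case Nil
    then show ?case
      by (intro disjI2 exI[of _ r] exI[of _ w])
        (simp add: word_degree_def leavitt_ideal_closed flip: zero_fword_def)
  next
    case (Cons g gs)
    let ?m = "Poly_Mapping.single (FWord gs) 1 :: 'k leavitt_poly"
    have m: "?m \<in> leavitt_polys n"
      using Cons.prems(1) by (simp add: single_leavitt_polys)
    have step: "xw w * Poly_Mapping.single (FWord (g # gs)) 1 = xw w * gen g * ?m"
      by (simp add: single_FWord_Cons mult.assoc)
    show ?case
    proof (cases g)
      case (XG i)
      have "w @ [i] \<in> words n (Suc r)"
        using Cons.prems XG by (auto simp: words_def leavitt_gens_def)
      moreover have "xw w * gen g * ?m = xw (w @ [i]) * ?m"
        by (simp add: xw_append XG)
      ultimately show ?thesis
        using Cons.IH[of "w @ [i]" "Suc r"] Cons.prems unfolding step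
        by (simp add: XG word_degree_def algebra_simps)
    next
      case (YG j)
      obtain w' i where w: "w = w' @ [i]"
        using Cons.prems(2,3) by (cases w rule: rev_cases) (auto simp: words_def)
      obtain r' where r: "r = Suc r'" and w': "w' \<in> words n r'" "i \<in> {1..n}" "j \<in> {1..n}"
        using Cons.prems YG by (auto simp: w words_def leavitt_gens_def)
      have "leavitt_eq n (xw w' * (gen (XG i) * gen (YG j)) * ?m)
          (xw w' * (if i = j then 1 else 0) * ?m)"
        using w' m by (intro leavitt_eq_mult_left leavitt_eq_mult_right leavitt_eq_xy) auto
      then have eq: "leavitt_eq n (xw w * gen g * ?m) (if i = j then xw w' * ?m else 0)"
        by (cases "i = j") (simp_all add: w YG xw_append mult.assoc)
      show ?thesis
      proof (cases "i = j")
        case True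
        have "leavitt_eq n (xw w' * ?m) 0 \<or>
          (\<exists>r'' w''. w'' \<in> words n r'' \<and> int r'' = int r' - word_degree (FWord gs) \<and>
            leavitt_eq n (xw w' * ?m) (xw w''))"
          using Cons.IH[OF _ w'(1)] Cons.prems r by auto
        moreover have "int (Suc r') - word_degree (FWord (g # gs)) = int r' - word_degree (FWord gs)"
          by (simp add: YG word_degree_def)
        ultimately show ?thesis
          unfolding step r using leavitt_eq_trans[OF eq[unfolded if_P[OF True]]] by metis
      next
        case False
        then show ?thesis
          using eq unfolding step by simp
      qed
    qed
  qed
qed

lemma const_central: "Poly_Mapping.single 0 c * q = q * Poly_Mapping.single 0 c"
  for q :: "'k::field leavitt_poly"
  by (induction q rule: poly_mapping_induct_single) (simp_all add: mult_single distrib_left distrib_right mult.commute)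

definition leavitt_scalar :: "nat \<Rightarrow> 'k::field leavitt_poly \<Rightarrow> bool"
  where "leavitt_scalar n p \<longleftrightarrow> (\<exists>c. leavitt_eq n p (Poly_Mapping.single 0 c))"

lemma leavitt_scalar_sum:
  "(\<And>a. a \<in> A \<Longrightarrow> leavitt_scalar n (f a)) \<Longrightarrow> leavitt_scalar n (sum f A)"
proof (induction A rule: infinite_finite_induct)
  case (insert a A)
  then obtain c d where "leavitt_eq n (f a) (Poly_Mapping.single 0 c)"
    "leavitt_eq n (sum f A) (Poly_Mapping.single 0 d)"
    unfolding leavitt_scalar_def by blast
  then have "leavitt_eq n (f a + sum f A) (Poly_Mapping.single 0 (c + d))"
    using leavitt_ideal_closed(4)[of "f a - Poly_Mapping.single 0 c" n "sum f A - Poly_Mapping.single 0 d"]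
    by (simp add: single_add algebra_simps)
  with insert show ?case
    unfolding leavitt_scalar_def by auto
qed (auto simp: leavitt_scalar_def leavitt_ideal_closed intro: exI[of _ 0])

text \<open>
  By \<open>xw_times_word\<close> each monomial \<open>u\<close> of \<open>p\<close> satisfies \<open>x\<^sub>w u = 0\<close> or \<open>x\<^sub>w u = x\<^sub>w\<^sub>'\<close> for a word \<open>w'\<close>
  of length \<open>r - d = s\<close>, and then \<open>x\<^sub>w\<^sub>' y\<^sub>v\<close> is \<open>0\<close> or \<open>1\<close>.
\<close>
lemma homogeneous_corner_scalar:
  assumes p: "p \<in> leavitt_polys n" "\<forall>u\<in>Poly_Mapping.keys p. word_degree u = d"
    and len: "\<forall>u\<in>Poly_Mapping.keys p. length (letters u) \<le> r"
    and s: "int s = int r - d"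
    and wv: "w \<in> words n r" "v \<in> words n s"
  shows "leavitt_scalar n (xw w * p * yw v :: 'k::field leavitt_poly)"
proof -
  have "leavitt_scalar n (xw w * Poly_Mapping.single u c * yw v :: 'k leavitt_poly)"
    if u: "u \<in> Poly_Mapping.keys p" for u c
  proof -
    let ?m = "Poly_Mapping.single u 1 :: 'k leavitt_poly"
    have c: "xw w * Poly_Mapping.single u c * yw v = xw w * ?m * yw v * Poly_Mapping.single 0 c"
      using mult_single[of u 1 0 c] by (simp add: mult.assoc flip: const_central[of c "yw v"]) (simp flip: mult.assoc)
    have "leavitt_scalar n (xw w * ?m * yw v)"
    proof -
      have "leavitt_eq n (xw w * ?m) 0 \<or> (\<exists>r' w'. w' \<in> words n r' \<and>
          int r' = int r - word_degree u \<and> leavitt_eq n (xw w * ?m) (xw w'))"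
        using xw_times_word[of "letters u" n w r, where 'k = 'k] p(1) len u wv
        by (auto simp: leavitt_polys_def)
      then show ?thesis
      proof
        assume "leavitt_eq n (xw w * ?m) 0"
        then have "leavitt_eq n (xw w * ?m * yw v) (0 * yw v)"
          using wv by (intro leavitt_eq_mult_right) auto
        then show ?thesis
          unfolding leavitt_scalar_def by (intro exI[of _ 0]) simp
      next
        assume "\<exists>r' w'. w' \<in> words n r' \<and> int r' = int r - word_degree u \<and>
          leavitt_eq n (xw w * ?m) (xw w')"
        moreover have "int s = int r - word_degree u"
          using s p(2) u by simp
        ultimately obtain w' where w': "w' \<in> words n s" "leavitt_eq n (xw w * ?m) (xw w')"
          by (metis of_nat_eq_iff)
        have "leavitt_eq n (xw w * ?m * yw v) (xw w' * yw v)"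
          using wv w' by (intro leavitt_eq_mult_right) auto
        also have "leavitt_eq n (xw w' * yw v) (if w' = v then 1 else 0)"
          using wv w' by (intro leavitt_eq_xw_yw)
        finally show ?thesis
          unfolding leavitt_scalar_def by (intro exI[of _ "if w' = v then 1 else 0"]) (auto split: if_splits)
      qed
    qed
    then obtain c' where "leavitt_eq n (xw w * ?m * yw v) (Poly_Mapping.single 0 c')"
      unfolding leavitt_scalar_def by blast
    then have "leavitt_eq n (xw w * ?m * yw v * Poly_Mapping.single 0 c)
        (Poly_Mapping.single 0 c' * Poly_Mapping.single 0 c)"
      by (intro leavitt_eq_mult_right) auto
    then show ?thesis
      unfolding leavitt_scalar_def c by (auto simp: mult_single)
  qed
  then have "leavitt_scalar n (\<Sum>u\<in>Poly_Mapping.keys p.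
      xw w * Poly_Mapping.single u (Poly_Mapping.lookup p u) * yw v)"
    by (rule leavitt_scalar_sum)
  moreover have "(\<Sum>u\<in>Poly_Mapping.keys p.
      xw w * Poly_Mapping.single u (Poly_Mapping.lookup p u) * yw v) = xw w * p * yw v"
    by (subst (2) poly_mapping_sum_single[of p]) (simp add: sum_distrib_left sum_distrib_right)
  ultimately show ?thesis
    by simp
qed

text \<open>
  Since \<open>\<Sum> y\<^sub>w x\<^sub>w = 1\<close>, the element \<open>p\<close> is congruent to \<open>\<Sum> y\<^sub>w (x\<^sub>w p y\<^sub>v) x\<^sub>v\<close>.  The inner factors are
  congruent to scalars by \<open>homogeneous_corner_scalar\<close>, and a scalar that acts as zero is zero.
\<close>
lemma homogeneous_kernel_leavitt_ideal:
  assumes n: "n > 0" and p: "p \<in> leavitt_polys n" "\<forall>u\<in>Poly_Mapping.keys p. word_degree u = d"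
    and rep: "rep n p = 0"
  shows "(p :: 'k::field leavitt_poly) \<in> leavitt_ideal n"
proof -
  \<comment> \<open>The sum bounds the length of every monomial, and the first summand makes \<open>r - d\<close> nonnegative.\<close>
  define r where "r = nat \<bar>d\<bar> + (\<Sum>u\<in>Poly_Mapping.keys p. length (letters u))"
  define s where "s = nat (int r - d)"
  have len: "\<forall>u\<in>Poly_Mapping.keys p. length (letters u) \<le> r"
    unfolding r_def by (auto intro!: trans_le_add2 member_le_sum)
  have s: "int s = int r - d"
    unfolding s_def r_def by (simp add: add_increasing2 sum_nonneg)
  have corner: "xw w * p * yw v \<in> leavitt_ideal n" if wv: "w \<in> words n r" "v \<in> words n s" for w v
  proof -
    obtain c where c: "leavitt_eq n (xw w * p * yw v) (Poly_Mapping.single 0 c)"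
      using homogeneous_corner_scalar[OF p len s wv] unfolding leavitt_scalar_def by blast
    have "scal c = scal 0"
      using rep_leavitt_eq[OF n c] rep by simp
    then have "c = 0"
      using inj_scal by (metis injD)
    with c show ?thesis
      by simp
  qed
  let ?e = "\<lambda>r. \<Sum>w\<in>words n r. yw w * xw w :: 'k leavitt_poly"
  have "leavitt_eq n (1 * p * 1) (?e r * p * 1)"
    by (intro leavitt_eq_mult_right leavitt_eq_sym[OF leavitt_eq_sum_yw_xw] p) auto
  also have "leavitt_eq n (?e r * p * 1) (?e r * p * ?e s)"
    by (intro leavitt_eq_mult_left leavitt_eq_sym[OF leavitt_eq_sum_yw_xw]) (auto intro: p)
  finally have "leavitt_eq n p (?e r * p * ?e s)"
    by simp
  moreover have "?e r * p * ?e s =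
      (\<Sum>w\<in>words n r. \<Sum>v\<in>words n s. yw w * (xw w * p * yw v) * xw v)"
    by (subst sum.swap) (simp add: sum_distrib_left sum_distrib_right mult.assoc)
  moreover have "(\<Sum>w\<in>words n r. \<Sum>v\<in>words n s. yw w * (xw w * p * yw v) * xw v) \<in> leavitt_ideal n"
    by (intro leavitt_ideal_sum leavitt_ideal_closed(5,6) corner) auto
  ultimately show ?thesis
    using leavitt_eq_trans[of p "?e r * p * ?e s" n 0] by simp
qed

definition homogeneous_part :: "int \<Rightarrow> 'k::field leavitt_poly \<Rightarrow> 'k leavitt_poly"
  where "homogeneous_part d p = (\<Sum>w | w \<in> Poly_Mapping.keys p \<and> word_degree w = d.
    Poly_Mapping.single w (Poly_Mapping.lookup p w))"

lemma sum_homogeneous_part: "p = (\<Sum>d\<in>word_degree ` Poly_Mapping.keys p. homogeneous_part d p)"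
  unfolding homogeneous_part_def
  by (subst sum.group) (auto simp flip: poly_mapping_sum_single)

lemma keys_homogeneous_part: "Poly_Mapping.keys (homogeneous_part d p) \<subseteq> {w \<in> Poly_Mapping.keys p. word_degree w = d}"
  by (auto simp: homogeneous_part_def in_keys_iff lookup_sum lookup_single when_def split: if_splits)

lemma homogeneous_part_leavitt_polys: "p \<in> leavitt_polys n \<Longrightarrow> homogeneous_part d p \<in> leavitt_polys n"
  using keys_homogeneous_part[of d p] by (auto simp: leavitt_polys_def)

lemma degree_part_rep:
  assumes "\<forall>w\<in>Poly_Mapping.keys p. word_degree w = d"
  shows "degree_part d' (rep n p) = (if d' = d then rep n p else 0)"
  by (intro degree_part_homogeneous has_degree_rep assms)

lemma degree_part_rep_eq: "degree_part d (rep n p) = rep n (homogeneous_part d p)"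
proof -
  let ?D = "word_degree ` Poly_Mapping.keys p"
  have "degree_part d (rep n p) = degree_part d (rep n (\<Sum>e\<in>?D. homogeneous_part e p))"
    by (simp flip: sum_homogeneous_part)
  also have "\<dots> = (\<Sum>e\<in>?D. degree_part d (rep n (homogeneous_part e p)))"
    by (simp add: rep_sum degree_part_sum)
  also have "\<dots> = (\<Sum>e\<in>?D. if e = d then rep n (homogeneous_part e p) else 0)"
  proof (rule sum.cong[OF refl])
    fix e
    have "\<forall>w\<in>Poly_Mapping.keys (homogeneous_part e p). word_degree w = e"
      using keys_homogeneous_part[of e p] by auto
    then show "degree_part d (rep n (homogeneous_part e p)) = (if e = d then rep n (homogeneous_part e p) else 0)"
      by (subst degree_part_rep) auto
  qed
  also have "\<dots> = rep n (homogeneous_part d p)"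
  proof (cases "d \<in> ?D")
    case False
    then have "homogeneous_part d p = 0"
      unfolding homogeneous_part_def by (intro sum.neutral) auto
    with False show ?thesis
      by simp
  qed simp
  finally show ?thesis .
qed

text \<open>
  The representation of the Leavitt algebra is faithful: the homogeneous parts of a polynomial
  that acts as zero act as zero, because their operators are the \<open>degree_part\<close>s of zero.
\<close>
lemma rep_kernel_leavitt_ideal:
  assumes "n > 0" "p \<in> leavitt_polys n" "rep n p = 0"
  shows "(p :: 'k::field leavitt_poly) \<in> leavitt_ideal n"
proof -
  have "homogeneous_part d p \<in> leavitt_ideal n" for d
  proof (rule homogeneous_kernel_leavitt_ideal[OF assms(1)])
    show "rep n (homogeneous_part d p) = 0"
      using assms(3) degree_part_rep_eq[of d n p] by simp
    show "\<forall>w\<in>Poly_Mapping.keys (homogeneous_part d p). word_degree w = d"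
      using keys_homogeneous_part[of d p] by auto
  qed (rule homogeneous_part_leavitt_polys[OF assms(2)])
  then have "(\<Sum>d\<in>word_degree ` Poly_Mapping.keys p. homogeneous_part d p) \<in> leavitt_ideal n"
    by (rule leavitt_ideal_sum)
  then show ?thesis
    by (simp flip: sum_homogeneous_part)
qed

section \<open>The rank of an idempotent matrix\<close>

text \<open>
  Sylvester's identity: both sides are the determinant of the block matrix with blocks
  \<open>1, A, B, 1\<close>, multiplied on the right or on the left by a unipotent block matrix.
\<close>
lemma det_one_minus_mult_commute:
  fixes A B :: "'a::idom mat"
  assumes A: "A \<in> carrier_mat N N" and B: "B \<in> carrier_mat N N"
  shows "det (1\<^sub>m N - A * B) = det (1\<^sub>m N - B * A)"
proof -
  let ?M = "four_block_mat (1\<^sub>m N) A B (1\<^sub>m N)"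
  \<comment> \<open>The unipotent factor: \<open>?M * ?L\<close> and \<open>?L * ?M\<close> are both block triangular.\<close>
  let ?L = "four_block_mat (1\<^sub>m N) (0\<^sub>m N N) (- B) (1\<^sub>m N)"
  have c: "?M \<in> carrier_mat (N + N) (N + N)" "?L \<in> carrier_mat (N + N) (N + N)"
    using A B by auto
  have "?M * ?L = four_block_mat (1\<^sub>m N - A * B) A (0\<^sub>m N N) (1\<^sub>m N)"
    using A B by (subst mult_four_block_mat[of _ N N _ N _ N _ _ N _ N])
      (auto simp: minus_add_uminus_mat[of _ N N] intro!: cong_four_block_mat)
  moreover have "?L * ?M = four_block_mat (1\<^sub>m N) A (0\<^sub>m N N) (1\<^sub>m N - B * A)"
    using A B by (subst mult_four_block_mat[of _ N N _ N _ N _ _ N _ N])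
      (auto simp: minus_add_uminus_mat[of _ N N] intro!: cong_four_block_mat)
  moreover have "det (?M * ?L) = det (?L * ?M)"
    using det_mult[OF c] det_mult[OF c(2,1)] by (simp add: mult.commute)
  moreover have "det (four_block_mat (1\<^sub>m N - A * B) A (0\<^sub>m N N) (1\<^sub>m N)) = det (1\<^sub>m N - A * B)"
    using A B by (subst det_four_block_mat_lower_left_zero[of _ N _ N]) auto
  moreover have "det (four_block_mat (1\<^sub>m N) A (0\<^sub>m N N) (1\<^sub>m N - B * A)) = det (1\<^sub>m N - B * A)"
    using A B by (subst det_four_block_mat_lower_left_zero[of _ N _ N]) auto
  ultimately show ?thesis
    by simp
qed

text \<open>
  This is the degree in \<open>t\<close> of \<open>det (1 + (t - 1) D)\<close>.  If \<open>D\<close> is idempotent, then it is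
  diagonalisable with eigenvalues \<open>0\<close> and \<open>1\<close>, so the determinant is \<open>t\<close> to the power of the rank
  of \<open>D\<close>, and the degree is the rank, in every characteristic.
\<close>
definition idem_rank :: "'k::field mat \<Rightarrow> nat"
  where "idem_rank D =
    degree (det (1\<^sub>m (dim_row D) - [:1, -1:] \<cdot>\<^sub>m map_mat (\<lambda>c. [:c:]) D))"

interpretation const_poly: inj_comm_ring_hom "\<lambda>c :: 'k::field. [:c:]"
  by unfold_locales (auto simp: one_pCons)

text \<open>
  The matrices \<open>E\<^sub>i = u\<^sub>i v\<^sub>i\<close> satisfy \<open>E\<^sub>i E\<^sub>j = 0\<close> for \<open>i \<noteq> j\<close>, so the product of all \<open>1 + (t - 1) E\<^sub>i\<close> is
  \<open>1 + (t - 1) \<Sum> E\<^sub>i\<close>, which is \<open>t\<close> times the identity.  By Sylvester's identity each factor has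
  the same determinant as \<open>1 + (t - 1) D\<close>.  Hence \<open>t\<^sup>N\<close> is the \<open>q\<close>-th power of that determinant, and the claim follows by comparing degrees.
\<close>
lemma idem_rank_partition:
  fixes u v :: "nat \<Rightarrow> 'k::field mat"
  assumes u: "\<And>i. i < q \<Longrightarrow> u i \<in> carrier_mat N N" and v: "\<And>i. i < q \<Longrightarrow> v i \<in> carrier_mat N N"
    and D: "D \<in> carrier_mat N N"
    and vu: "\<And>i j. i < q \<Longrightarrow> j < q \<Longrightarrow> v i * u j = (if i = j then D else 0\<^sub>m N N)"
    and sum: "\<And>a b. a < N \<Longrightarrow> b < N \<Longrightarrow> (\<Sum>i<q. (u i * v i) $$ (a, b)) = (if a = b then 1 else 0)"
  shows "q * idem_rank D = N"
proof -
  let ?h = "map_mat (\<lambda>c :: 'k. [:c:])"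
  define t :: "'k poly" where "t = [:0, 1:]"
  define U where "U i = ?h (u i)" for i
  define V where "V i = (1 - t) \<cdot>\<^sub>m ?h (v i)" for i
  have UV: "U i \<in> carrier_mat N N" "V i \<in> carrier_mat N N" if "i < q" for i
    using u[OF that] v[OF that] by (auto simp: U_def V_def)
  have VU: "V i * U j = (if i = j then (1 - t) \<cdot>\<^sub>m ?h D else 0\<^sub>m N N)" if "i < q" "j < q" for i j
  proof -
    have "V i * U j = (1 - t) \<cdot>\<^sub>m ?h (v i * u j)"
      using u[OF that(2)] v[OF that(1)] unfolding U_def V_def
      by (simp add: mult_smult_assoc_mat[of _ N N _ N] const_poly.mat_hom_mult[of _ N N _ N])
    then show ?thesis
      using vu[OF that] by auto
  qed
  have diff: "1\<^sub>m N - A - (X - 0\<^sub>m N N) = 1\<^sub>m N - (A + X)"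
    if "A \<in> carrier_mat N N" "X \<in> carrier_mat N N" for A X :: "'k poly mat"
    using that by (intro eq_matI) auto
  \<comment> \<open>The partial sums \<open>S r\<close> of the \<open>(1 - t) E\<^sub>i\<close>; the factor \<open>1 - t\<close> is absorbed into \<open>V\<close>.\<close>
  define S where "S r = mat N N (\<lambda>(a, b). \<Sum>i<r. (U i * V i) $$ (a, b))" for r
  have S: "S r \<in> carrier_mat N N" for r
    by (simp add: S_def)
  have S_0: "S 0 = 0\<^sub>m N N"
    by (intro eq_matI) (auto simp: S_def)
  have S_Suc: "S (Suc r) = S r + U r * V r" if "r < q" for r
    using UV[OF that] by (intro eq_matI) (auto simp: S_def)
  have SU: "S r * U i = 0\<^sub>m N N" if "r \<le> i" "i < q" for r i
    using that
  proof (induction r)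
    case 0
    then show ?case
      using UV(1) left_mult_zero_mat by (metis S_0)
  next
    case (Suc r)
    then have r: "r < q" "U r * V r \<in> carrier_mat N N"
      using UV[of r] by auto
    from Suc have "U r * V r * U i = U r * (V r * U i)"
      using UV by (intro assoc_mult_mat[of _ N N _ N _ N]) auto
    also have "\<dots> = 0\<^sub>m N N"
      using VU[of r i] UV[of r] Suc.prems by simp
    finally have UVU: "U r * V r * U i = 0\<^sub>m N N" .
    have "S (Suc r) * U i = S r * U i + U r * V r * U i"
      unfolding S_Suc[OF r(1)] by (rule add_mult_distrib_mat[OF S r(2) UV(1)]) (use Suc in simp)
    then show ?case
      using Suc UVU by simp
  qed
  have det: "det (1\<^sub>m N - S r) = det (1\<^sub>m N - (1 - t) \<cdot>\<^sub>m ?h D) ^ r" if "r \<le> q" for r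
    using that
  proof (induction r)
    case 0
    have "1\<^sub>m N - S 0 = 1\<^sub>m N"
      unfolding S_0 by (intro eq_matI) auto
    then show ?case
      by simp
  next
    case (Suc r)
    then have r: "r < q"
      by simp
    have "S r * (U r * V r) = S r * U r * V r"
      using UV[OF r] S by (intro assoc_mult_mat[symmetric, of _ N N _ N _ N]) auto
    also have "\<dots> = 0\<^sub>m N N"
      using SU[of r r] r left_mult_zero_mat[OF UV(2)[OF r]] by simp
    finally have zero: "S r * (U r * V r) = 0\<^sub>m N N" .
    have UV': "U r * V r \<in> carrier_mat N N"
      using UV[OF r] by simp
    have "(1\<^sub>m N - S r) * (1\<^sub>m N - U r * V r) = (1\<^sub>m N - S r) * 1\<^sub>m N - (1\<^sub>m N - S r) * (U r * V r)"
      by (rule mult_minus_distrib_mat[OF minus_carrier_mat[OF S] one_carrier_mat UV'])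
    also have "(1\<^sub>m N - S r) * (U r * V r) = 1\<^sub>m N * (U r * V r) - S r * (U r * V r)"
      by (rule minus_mult_distrib_mat[OF _ S UV']) simp
    also have "(1\<^sub>m N - S r) * 1\<^sub>m N - (1\<^sub>m N * (U r * V r) - S r * (U r * V r)) = 1\<^sub>m N - S (Suc r)"
      unfolding zero S_Suc[OF r] left_mult_one_mat[OF UV'] right_mult_one_mat[OF minus_carrier_mat[OF S]]
      by (rule diff[OF S UV'])
    finally have "(1\<^sub>m N - S r) * (1\<^sub>m N - U r * V r) = 1\<^sub>m N - S (Suc r)" .
    then have "det (1\<^sub>m N - S (Suc r)) = det (1\<^sub>m N - S r) * det (1\<^sub>m N - U r * V r)"
      using UV[OF r] S[of r] by (metis det_mult minus_carrier_mat mult_carrier_mat)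
    also have "det (1\<^sub>m N - U r * V r) = det (1\<^sub>m N - V r * U r)"
      by (intro det_one_minus_mult_commute UV r)
    also have "\<dots> = det (1\<^sub>m N - (1 - t) \<cdot>\<^sub>m ?h D)"
      using VU[OF r r] by simp
    finally show ?case
      using Suc by simp
  qed
  have "1\<^sub>m N - S q = t \<cdot>\<^sub>m 1\<^sub>m N"
  proof (rule eq_matI)
    fix a b
    assume ab: "a < dim_row (t \<cdot>\<^sub>m 1\<^sub>m N)" "b < dim_col (t \<cdot>\<^sub>m 1\<^sub>m N)"
    have "(\<Sum>i<q. (U i * V i) $$ (a, b)) = (\<Sum>i<q. (1 - t) * [:(u i * v i) $$ (a, b):])"
    proof (rule sum.cong[OF refl])
      fix i
      assume "i \<in> {..<q}"
      then have i: "i < q"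
        by simp
      have "U i * V i = (1 - t) \<cdot>\<^sub>m ?h (u i * v i)"
        using mult_smult_distrib[of "?h (u i)" N N "?h (v i)" N "1 - t"] u[OF i] v[OF i]
          const_poly.mat_hom_mult[OF u[OF i] v[OF i]] unfolding U_def V_def by simp
      then show "(U i * V i) $$ (a, b) = (1 - t) * [:(u i * v i) $$ (a, b):]"
        using ab u[OF i] v[OF i] by simp
    qed
    also have "\<dots> = (1 - t) * [:\<Sum>i<q. (u i * v i) $$ (a, b):]"
      by (simp only: sum_distrib_left[symmetric] const_poly.hom_sum[symmetric])
    finally show "(1\<^sub>m N - S q) $$ (a, b) = (t \<cdot>\<^sub>m 1\<^sub>m N) $$ (a, b)"
      using ab sum[of a b] by (auto simp: S_def one_pCons[symmetric])
  qed (auto simp: S_def)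
  then have "t ^ N = det (1\<^sub>m N - (1 - t) \<cdot>\<^sub>m ?h D) ^ q"
    using det[of q] by simp
  moreover have "1 - t = [:1, -1:]"
    by (simp add: t_def poly_eq_iff coeff_pCons split: nat.splits)
  ultimately have t: "t ^ N = det (1\<^sub>m N - [:1, -1:] \<cdot>\<^sub>m ?h D) ^ q"
    by metis
  have "degree (t ^ N) = N"
    unfolding t_def by (rule degree_linear_power[of 0, simplified])
  moreover have "t ^ N \<noteq> 0"
    by (simp add: t_def)
  moreover have "idem_rank D = degree (det (1\<^sub>m N - [:1, -1:] \<cdot>\<^sub>m ?h D))"
    using D by (auto simp: idem_rank_def)
  ultimately show ?thesis
    unfolding t by (metis degree_power_eq degree_1 mult_0 power_0 power_eq_0_iff neq0_conv)
qed

section \<open>Graded isomorphisms with graded inverse\<close>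

text \<open>
  The relation \<open>\<cong>\<^sub>g\<^sub>r\<close> asks only the isomorphism itself to preserve degrees.  The isomorphisms that are
  constructed below have an evident inverse, and asking for both makes the relation symmetric.
\<close>
definition gr_inverse where
  "gr_inverse A B f g \<longleftrightarrow> f \<in> Ring.ring_hom A B \<and> g \<in> Ring.ring_hom B A \<and>
    (\<forall>a \<in> carrier A. g (f a) = a) \<and> (\<forall>b \<in> carrier B. f (g b) = b) \<and>
    (\<forall>d. \<forall>a \<in> hcomp A d. f a \<in> hcomp B d) \<and> (\<forall>d. \<forall>b \<in> hcomp B d. g b \<in> hcomp A d)"

definition gr_equiv :: "('a, 'c) graded_ring_scheme \<Rightarrow> ('b, 'd) graded_ring_scheme \<Rightarrow> bool"
  where "gr_equiv A B \<longleftrightarrow> (\<exists>f g. gr_inverse A B f g)"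

lemma gr_equivI:
  assumes "f \<in> Ring.ring_hom A B" "g \<in> Ring.ring_hom B A"
    "\<And>a. a \<in> carrier A \<Longrightarrow> g (f a) = a" "\<And>b. b \<in> carrier B \<Longrightarrow> f (g b) = b"
    "\<And>d a. a \<in> hcomp A d \<Longrightarrow> f a \<in> hcomp B d" "\<And>d b. b \<in> hcomp B d \<Longrightarrow> g b \<in> hcomp A d"
  shows "gr_equiv A B"
  using assms unfolding gr_equiv_def gr_inverse_def by blast

lemma gr_inverseD:
  assumes "gr_inverse A B f g"
  shows "f \<in> Ring.ring_hom A B" "g \<in> Ring.ring_hom B A"
    "\<And>a. a \<in> carrier A \<Longrightarrow> g (f a) = a" "\<And>b. b \<in> carrier B \<Longrightarrow> f (g b) = b"
    "\<And>d a. a \<in> hcomp A d \<Longrightarrow> f a \<in> hcomp B d" "\<And>d b. b \<in> hcomp B d \<Longrightarrow> g b \<in> hcomp A d"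
  using assms unfolding gr_inverse_def by blast+

lemma gr_equiv_sym: "gr_equiv A B \<Longrightarrow> gr_equiv B A"
  unfolding gr_equiv_def gr_inverse_def by blast

lemma gr_equiv_trans:
  assumes "gr_equiv A B" "gr_equiv B C"
  shows "gr_equiv A C"
proof -
  obtain f g f' g' where "gr_inverse A B f g" "gr_inverse B C f' g'"
    using assms unfolding gr_equiv_def by blast
  note f = gr_inverseD[OF this(1)] and f' = gr_inverseD[OF this(2)]
  show ?thesis
    by (rule gr_equivI[OF ring_hom_trans[OF f(1) f'(1)] ring_hom_trans[OF f'(2) f(2)]])
      (simp_all add: f f' ring_hom_closed[OF f(1)] ring_hom_closed[OF f'(2)])
qed

lemma gr_equiv_imp_graded_iso:
  assumes "gr_equiv A B"
  shows "A \<cong>\<^sub>g\<^sub>r B"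
proof -
  obtain f g where "gr_inverse A B f g"
    using assms unfolding gr_equiv_def by blast
  note f = gr_inverseD[OF this]
  have "bij_betw f (carrier A) (carrier B)"
    by (rule bij_betw_byWitness[where f' = g])
      (use f ring_hom_closed[OF f(1)] ring_hom_closed[OF f(2)] in auto)
  with f show ?thesis
    unfolding graded_iso_def ring_iso_def by blast
qed

lemma gr_equiv_graded_iso_trans:
  assumes "gr_equiv A A'" "A' \<cong>\<^sub>g\<^sub>r B'" "gr_equiv B' B"
  shows "A \<cong>\<^sub>g\<^sub>r B"
proof -
  obtain f where f: "f \<in> ring_iso A A'" "\<And>d. f ` hcomp A d \<subseteq> hcomp A' d"
    using gr_equiv_imp_graded_iso[OF assms(1)] unfolding graded_iso_def by blast
  obtain h where h: "h \<in> ring_iso A' B'" "\<And>d. h ` hcomp A' d \<subseteq> hcomp B' d"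
    using assms(2) unfolding graded_iso_def by blast
  obtain g where g: "g \<in> ring_iso B' B" "\<And>d. g ` hcomp B' d \<subseteq> hcomp B d"
    using gr_equiv_imp_graded_iso[OF assms(3)] unfolding graded_iso_def by blast
  have "g \<circ> (h \<circ> f) \<in> ring_iso A B"
    by (rule ring_iso_set_trans[OF ring_iso_set_trans[OF f(1) h(1)] g(1)])
  moreover have "(g \<circ> (h \<circ> f)) ` hcomp A d \<subseteq> hcomp B d" for d
    using f(2)[of d] h(2)[of d] g(2)[of d] by (force simp: image_subset_iff)
  ultimately show ?thesis
    unfolding graded_iso_def by blast
qed

lemma graded_mat_simps:
  "carrier (\<bbbM> m A \<delta>) = {M \<in> carrier_mat m m. \<forall>i<m. \<forall>j<m. M $$ (i, j) \<in> carrier A}"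
  "hcomp (\<bbbM> m A \<delta>) d =
    {M \<in> carrier_mat m m. \<forall>i<m. \<forall>j<m. M $$ (i, j) \<in> hcomp A (d + \<delta> j - \<delta> i)}"
  "M \<otimes>\<^bsub>\<bbbM> m A \<delta>\<^esub> N = mat m m (\<lambda>(i, j). \<Oplus>\<^bsub>A\<^esub>l \<in> {..<m}. M $$ (i, l) \<otimes>\<^bsub>A\<^esub> N $$ (l, j))"
  "M \<oplus>\<^bsub>\<bbbM> m A \<delta>\<^esub> N = mat m m (\<lambda>(i, j). M $$ (i, j) \<oplus>\<^bsub>A\<^esub> N $$ (i, j))"
  "\<one>\<^bsub>\<bbbM> m A \<delta>\<^esub> = mat m m (\<lambda>(i, j). if i = j then \<one>\<^bsub>A\<^esub> else \<zero>\<^bsub>A\<^esub>)"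
  by (simp_all add: graded_mat_def)

lemma map_mat_ring_hom:
  assumes "ring A" "ring B" and f: "f \<in> Ring.ring_hom A B"
  shows "map_mat f \<in> Ring.ring_hom (\<bbbM> m A \<delta>) (\<bbbM> m B \<delta>)"
proof -
  interpret ring_hom_ring A B f
    using assms by (intro ring_hom_ringI2)
  have hom_finsum: "f (finsum A g I) = finsum B (f \<circ> g) I" if "g \<in> I \<rightarrow> carrier A" for g and I :: "nat set"
    using that by (induction I rule: infinite_finite_induct) (auto simp: Pi_def)
  show ?thesis
  proof (rule ring_hom_memI)
    fix M N
    assume M: "M \<in> carrier (\<bbbM> m A \<delta>)" and N: "N \<in> carrier (\<bbbM> m A \<delta>)"
    show "map_mat f (M \<oplus>\<^bsub>\<bbbM> m A \<delta>\<^esub> N) = map_mat f M \<oplus>\<^bsub>\<bbbM> m B \<delta>\<^esub> map_mat f N"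
      using M N by (intro eq_matI) (auto simp: graded_mat_simps)
    show "map_mat f (M \<otimes>\<^bsub>\<bbbM> m A \<delta>\<^esub> N) = map_mat f M \<otimes>\<^bsub>\<bbbM> m B \<delta>\<^esub> map_mat f N"
    proof (rule eq_matI)
      fix i j
      assume "i < dim_row (map_mat f M \<otimes>\<^bsub>\<bbbM> m B \<delta>\<^esub> map_mat f N)"
        "j < dim_col (map_mat f M \<otimes>\<^bsub>\<bbbM> m B \<delta>\<^esub> map_mat f N)"
      then have ij: "i < m" "j < m"
        by (simp_all add: graded_mat_simps)
      have "f (\<Oplus>\<^bsub>A\<^esub>l \<in> {..<m}. M $$ (i, l) \<otimes>\<^bsub>A\<^esub> N $$ (l, j)) =
          (\<Oplus>\<^bsub>B\<^esub>l \<in> {..<m}. (f \<circ> (\<lambda>l. M $$ (i, l) \<otimes>\<^bsub>A\<^esub> N $$ (l, j))) l)"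
        using M N ij by (subst hom_finsum) (auto simp: graded_mat_simps comp_def)
      also have "\<dots> = (\<Oplus>\<^bsub>B\<^esub>l \<in> {..<m}. map_mat f M $$ (i, l) \<otimes>\<^bsub>B\<^esub> map_mat f N $$ (l, j))"
        using M N ij by (intro S.add.finprod_cong') (auto simp: graded_mat_simps)
      finally show "map_mat f (M \<otimes>\<^bsub>\<bbbM> m A \<delta>\<^esub> N) $$ (i, j) =
          (map_mat f M \<otimes>\<^bsub>\<bbbM> m B \<delta>\<^esub> map_mat f N) $$ (i, j)"
        using ij by (simp add: graded_mat_simps)
    qed (simp_all add: graded_mat_simps)
  next
    show "map_mat f \<one>\<^bsub>\<bbbM> m A \<delta>\<^esub> = \<one>\<^bsub>\<bbbM> m B \<delta>\<^esub>"
      by (intro eq_matI) (auto simp: graded_mat_simps)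
  qed (auto simp: graded_mat_simps)
qed

lemma gr_equiv_graded_mat:
  assumes "ring A" "ring B" "gr_equiv A B"
  shows "gr_equiv (\<bbbM> m A \<delta>) (\<bbbM> m B \<delta>)"
proof -
  obtain f g where "gr_inverse A B f g"
    using assms(3) unfolding gr_equiv_def by blast
  note f = gr_inverseD[OF this]
  show ?thesis
  proof (rule gr_equivI)
    show "map_mat f \<in> Ring.ring_hom (\<bbbM> m A \<delta>) (\<bbbM> m B \<delta>)" "map_mat g \<in> Ring.ring_hom (\<bbbM> m B \<delta>) (\<bbbM> m A \<delta>)"
      using assms(1,2) f(1,2) by (auto intro: map_mat_ring_hom)
    show "map_mat g (map_mat f M) = M" if "M \<in> carrier (\<bbbM> m A \<delta>)" for M
      using that f(3) by (intro eq_matI) (auto simp: graded_mat_simps)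
    show "map_mat f (map_mat g M) = M" if "M \<in> carrier (\<bbbM> m B \<delta>)" for M
      using that f(4) by (intro eq_matI) (auto simp: graded_mat_simps)
  qed (auto simp: graded_mat_simps f)
qed

section \<open>The Leavitt algebra as a ring of operators\<close>

definition leavitt_ops :: "'k itself \<Rightarrow> nat \<Rightarrow> 'k::field state endo graded_ring"
  where "leavitt_ops _ n =
    \<lparr> carrier = rep n ` leavitt_polys n,
      monoid.mult = (*), monoid.one = 1, ring.zero = 0, ring.add = (+),
      hcomp = (\<lambda>d. rep n ` {p \<in> leavitt_polys n. \<forall>w\<in>Poly_Mapping.keys p. word_degree w = d}) \<rparr>"

lemma leavitt_ops_simps [simp]:
  "carrier (leavitt_ops TYPE('k::field) n) = rep n ` leavitt_polys n"
  "monoid.mult (leavitt_ops TYPE('k) n) = (*)" "monoid.one (leavitt_ops TYPE('k) n) = 1"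
  "ring.zero (leavitt_ops TYPE('k) n) = 0" "ring.add (leavitt_ops TYPE('k) n) = (+)"
  "hcomp (leavitt_ops TYPE('k) n) d =
    rep n ` {p \<in> leavitt_polys n. \<forall>w\<in>Poly_Mapping.keys p. word_degree w = d}"
  by (simp_all add: leavitt_ops_def)

lemma rep_image_closed:
  fixes s t :: "'k::field state endo"
  shows "s \<in> rep n ` leavitt_polys n \<Longrightarrow> t \<in> rep n ` leavitt_polys n \<Longrightarrow> s + t \<in> rep n ` leavitt_polys n"
    and "s \<in> rep n ` leavitt_polys n \<Longrightarrow> t \<in> rep n ` leavitt_polys n \<Longrightarrow> s * t \<in> rep n ` leavitt_polys n"
    and "s \<in> rep n ` leavitt_polys n \<Longrightarrow> - s \<in> rep n ` leavitt_polys n"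
    and "(0 :: 'k state endo) \<in> rep n ` leavitt_polys n" and "(1 :: 'k state endo) \<in> rep n ` leavitt_polys n"
proof -
  show "(0 :: 'k state endo) \<in> rep n ` leavitt_polys n" "(1 :: 'k state endo) \<in> rep n ` leavitt_polys n"
    by (metis leavitt_polys_closed(1) rep_zero imageI, metis leavitt_polys_closed(2) rep_one imageI)
qed (auto simp flip: rep_add rep_mult rep_uminus)

lemma ring_leavitt_ops: "ring (leavitt_ops TYPE('k::field) n)"
proof (rule ringI)
  show "abelian_group (leavitt_ops TYPE('k) n)"
  proof (rule abelian_groupI)
    fix s
    assume "s \<in> carrier (leavitt_ops TYPE('k) n)"
    then show "\<exists>t \<in> carrier (leavitt_ops TYPE('k) n).
        t \<oplus>\<^bsub>leavitt_ops TYPE('k) n\<^esub> s = \<zero>\<^bsub>leavitt_ops TYPE('k) n\<^esub>"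
      by (intro bexI[of _ "- s"]) (simp_all add: rep_image_closed)
  qed (simp_all add: rep_image_closed algebra_simps)
  show "monoid (leavitt_ops TYPE('k) n)"
    by (rule monoidI) (simp_all add: rep_image_closed algebra_simps)
qed (simp_all add: algebra_simps)

abbreviation leavitt_class :: "nat \<Rightarrow> 'k::field leavitt_poly \<Rightarrow> 'k leavitt_poly set"
  where "leavitt_class n p \<equiv> leavitt_ideal n +>\<^bsub>free_algebra (leavitt_gens n)\<^esub> p"

lemma leavitt_class_eq: "leavitt_class n p = {q. leavitt_eq n q p}"
proof -
  have "q \<in> leavitt_class n p \<longleftrightarrow> (\<exists>h\<in>leavitt_ideal n. q = h + p)" for q
    by (auto simp: a_r_coset_def r_coset_def)
  moreover have "(\<exists>h\<in>leavitt_ideal n. q = h + p) \<longleftrightarrow> leavitt_eq n q p" for q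
    by (metis add_diff_cancel_right' diff_add_cancel)
  ultimately show ?thesis
    by blast
qed

lemma leavitt_class_cong: "leavitt_eq n p q \<Longrightarrow> leavitt_class n p = leavitt_class n q"
  unfolding leavitt_class_eq by (blast intro: leavitt_eq_trans leavitt_eq_sym)

lemma leavitt_carrier: "carrier (leavitt TYPE('k::field) n) = leavitt_class n ` leavitt_polys n"
  unfolding leavitt_simps A_RCOSETS_def' leavitt_polys_def by blast

lemma leavitt_class_ops:
  assumes "p \<in> leavitt_polys n" "q \<in> leavitt_polys n"
  shows "leavitt_class n p \<oplus>\<^bsub>leavitt TYPE('k::field) n\<^esub> leavitt_class n q = leavitt_class n (p + q)"
    and "leavitt_class n p \<otimes>\<^bsub>leavitt TYPE('k) n\<^esub> leavitt_class n q = leavitt_class n (p * q)"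
proof -
  interpret ideal "leavitt_ideal n" "free_algebra (leavitt_gens n) :: 'k leavitt_poly ring"
    by (rule ideal_leavitt_ideal)
  show "leavitt_class n p \<oplus>\<^bsub>leavitt TYPE('k) n\<^esub> leavitt_class n q = leavitt_class n (p + q)"
    using a_rcos_sum[of p q] assms unfolding leavitt_simps leavitt_polys_def by simp
  show "leavitt_class n p \<otimes>\<^bsub>leavitt TYPE('k) n\<^esub> leavitt_class n q = leavitt_class n (p * q)"
    using rcoset_mult_add[of p q] assms unfolding leavitt_simps leavitt_polys_def by simp
qed

definition class_op :: "nat \<Rightarrow> 'k::field leavitt_poly set \<Rightarrow> 'k state endo"
  where "class_op n c = rep n (SOME p. p \<in> c)"

definition op_class :: "nat \<Rightarrow> 'k::field state endo \<Rightarrow> 'k leavitt_poly set"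
  where "op_class n s = leavitt_class n (SOME p. p \<in> leavitt_polys n \<and> rep n p = s)"

lemma class_op_class:
  assumes "n > 0"
  shows "class_op n (leavitt_class n p) = rep n p"
proof -
  have "(SOME q. q \<in> leavitt_class n p) \<in> leavitt_class n p"
    by (rule someI[of _ p]) (simp only: leavitt_class_eq leavitt_eq_refl mem_Collect_eq)
  then show ?thesis
    unfolding class_op_def using rep_leavitt_eq[OF assms] by (simp add: leavitt_class_eq)
qed

lemma op_class_rep:
  assumes "n > 0" "p \<in> leavitt_polys n"
  shows "op_class n (rep n p) = leavitt_class n p"
proof -
  define q where "q = (SOME q. q \<in> leavitt_polys n \<and> rep n q = rep n p)"
  have q: "q \<in> leavitt_polys n \<and> rep n q = rep n p"
    unfolding q_def by (rule someI[of _ p]) (simp add: assms)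
  have "q + - p \<in> leavitt_polys n"
    using q assms leavitt_polys_closed(4,5) by blast
  then have "q + - p \<in> leavitt_ideal n"
    by (rule rep_kernel_leavitt_ideal[OF assms(1)]) (simp add: q)
  then show ?thesis
    unfolding op_class_def q_def[symmetric] by (intro leavitt_class_cong) simp
qed

text \<open>
  The representation is constant on residue classes (\<open>rep_leavitt_eq\<close>) and separates them
  (\<open>rep_kernel_leavitt_ideal\<close>).
\<close>
lemma gr_equiv_leavitt_ops:
  assumes "n > 0"
  shows "gr_equiv (leavitt TYPE('k::field) n) (leavitt_ops TYPE('k) n)"
proof (rule gr_equivI)
  have one: "\<one>\<^bsub>leavitt TYPE('k) n\<^esub> = leavitt_class n 1"
    by (simp add: leavitt_simps)
  show "class_op n \<in> Ring.ring_hom (leavitt TYPE('k) n) (leavitt_ops TYPE('k) n)"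
    by (rule ring_hom_memI) (auto simp: leavitt_carrier class_op_class assms leavitt_class_ops one)
  show "op_class n \<in> Ring.ring_hom (leavitt_ops TYPE('k) n) (leavitt TYPE('k) n)"
  proof (rule ring_hom_memI)
    show "op_class n \<one>\<^bsub>leavitt_ops TYPE('k) n\<^esub> = \<one>\<^bsub>leavitt TYPE('k) n\<^esub>"
      using op_class_rep[OF assms leavitt_polys_closed(2)] by (simp only: rep_one leavitt_ops_simps one)
  next
    fix s t
    assume "s \<in> carrier (leavitt_ops TYPE('k) n)" "t \<in> carrier (leavitt_ops TYPE('k) n)"
    then obtain p q where pq: "s = rep n p" "t = rep n q" "p \<in> leavitt_polys n" "q \<in> leavitt_polys n"
      by auto
    then show "op_class n s \<in> carrier (leavitt TYPE('k) n)"
      by (auto simp: leavitt_carrier op_class_rep assms)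
    have "op_class n (rep n (p * q)) = op_class n s \<otimes>\<^bsub>leavitt TYPE('k) n\<^esub> op_class n t"
      "op_class n (rep n (p + q)) = op_class n s \<oplus>\<^bsub>leavitt TYPE('k) n\<^esub> op_class n t"
      unfolding pq by (simp_all only: op_class_rep assms pq leavitt_polys_closed leavitt_class_ops)
    then show "op_class n (s \<otimes>\<^bsub>leavitt_ops TYPE('k) n\<^esub> t) =
        op_class n s \<otimes>\<^bsub>leavitt TYPE('k) n\<^esub> op_class n t"
      "op_class n (s \<oplus>\<^bsub>leavitt_ops TYPE('k) n\<^esub> t) =
        op_class n s \<oplus>\<^bsub>leavitt TYPE('k) n\<^esub> op_class n t"
      using pq by simp_all
  qed
next
  fix d c
  assume "c \<in> hcomp (leavitt TYPE('k) n) d"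
  then show "class_op n c \<in> hcomp (leavitt_ops TYPE('k) n) d"
    unfolding leavitt_simps(6) by (auto simp: class_op_class assms leavitt_polys_def)
next
  fix d s
  assume "s \<in> hcomp (leavitt_ops TYPE('k) n) d"
  then obtain p where "s = rep n p" "p \<in> leavitt_polys n" "\<forall>w\<in>Poly_Mapping.keys p. word_degree w = d"
    by auto
  then show "op_class n s \<in> hcomp (leavitt TYPE('k) n) d"
    unfolding leavitt_simps(6) by (auto simp: op_class_rep assms leavitt_polys_def)
qed (auto simp: leavitt_carrier class_op_class op_class_rep assms)

section \<open>Matrices of operators\<close>

text \<open>
  The coefficient field is read off from the expected type.
\<close>
abbreviation (input) Lops :: "nat \<Rightarrow> 'k::field state endo graded_ring"
  where "Lops n \<equiv> leavitt_ops TYPE('k) n"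

lemma hcomp_Lops_closed:
  fixes s t :: "'k::field state endo"
  shows "(0 :: 'k state endo) \<in> hcomp (Lops n) d" and "(1 :: 'k state endo) \<in> hcomp (Lops n) 0"
    and "s \<in> hcomp (Lops n) d \<Longrightarrow> t \<in> hcomp (Lops n) d \<Longrightarrow> s + t \<in> hcomp (Lops n) d"
    and "s \<in> hcomp (Lops n) a \<Longrightarrow> t \<in> hcomp (Lops n) b \<Longrightarrow> s * t \<in> hcomp (Lops n) (a + b)"
    and "s \<in> hcomp (Lops n) d \<Longrightarrow> s \<in> carrier (Lops n)"
proof -
  let ?H = "\<lambda>d. {p \<in> leavitt_polys n. \<forall>w\<in>Poly_Mapping.keys p. word_degree w = d}"
  have add: "p + q \<in> ?H d" if "p \<in> ?H d" "q \<in> ?H d" for p q :: "'k leavitt_poly" and d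
    using that Poly_Mapping.keys_add[of p q] leavitt_polys_closed(5)[of p n q] by blast
  have mult: "p * q \<in> ?H (a + b)" if "p \<in> ?H a" "q \<in> ?H b" for p q :: "'k leavitt_poly" and a b
  proof -
    have "word_degree w = a + b" if "w \<in> Poly_Mapping.keys (p * q)" for w
      using that Poly_Mapping.keys_mult[of p q] \<open>p \<in> ?H a\<close> \<open>q \<in> ?H b\<close>
      by (fastforce simp: word_degree_def)
    with that show ?thesis
      using leavitt_polys_closed(6)[of p n q] by blast
  qed
  have "rep n (0 :: 'k leavitt_poly) \<in> rep n ` ?H d" "rep n (1 :: 'k leavitt_poly) \<in> rep n ` ?H 0"
    by (intro imageI; simp add: word_degree_def leavitt_polys_closed)+
  then show "(0 :: 'k state endo) \<in> hcomp (Lops n) d" "(1 :: 'k state endo) \<in> hcomp (Lops n) 0"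
    by (simp_all only: leavitt_ops_simps rep_zero rep_one)
  show "s + t \<in> hcomp (Lops n) d" if st: "s \<in> hcomp (Lops n) d" "t \<in> hcomp (Lops n) d"
  proof -
    obtain p q where "s = rep n p" "t = rep n q" "p \<in> ?H d" "q \<in> ?H d"
      using st by auto
    then show ?thesis
      using imageI[OF add[of p d q], of "rep n"] unfolding leavitt_ops_simps rep_add by blast
  qed
  show "s * t \<in> hcomp (Lops n) (a + b)" if st: "s \<in> hcomp (Lops n) a" "t \<in> hcomp (Lops n) b"
  proof -
    obtain p q where "s = rep n p" "t = rep n q" "p \<in> ?H a" "q \<in> ?H b"
      using st by auto
    then show ?thesis
      using imageI[OF mult[of p a q b], of "rep n"] unfolding leavitt_ops_simps rep_mult by blast
  qed
qed auto

lemma gen_op_hcomp: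
  assumes "i \<in> {1..n}"
  shows "shrink n i \<in> hcomp (leavitt_ops TYPE('k::field) n) (-1)"
    and "spread n i \<in> hcomp (leavitt_ops TYPE('k) n) 1"
proof -
  have "rep n (gen (XG i) :: 'k leavitt_poly) \<in> hcomp (Lops n) (-1)"
    "rep n (gen (YG i) :: 'k leavitt_poly) \<in> hcomp (Lops n) 1"
    unfolding leavitt_ops_simps
    by (intro imageI; use gen_leavitt_polys[OF assms] in \<open>simp add: gen_def word_degree_def\<close>)+
  then show "shrink n i \<in> hcomp (leavitt_ops TYPE('k::field) n) (-1)"
    "spread n i \<in> hcomp (leavitt_ops TYPE('k) n) 1"
    by (simp_all only: rep_gen gen_op.simps)
qed

definition xop :: "nat \<Rightarrow> nat list \<Rightarrow> 'k::field state endo"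
  where "xop n w = rep n (xw w)"

definition yop :: "nat \<Rightarrow> nat list \<Rightarrow> 'k::field state endo"
  where "yop n w = rep n (yw w)"

lemma xop_yop_hcomp:
  assumes "w \<in> words n r"
  shows "xop n w \<in> hcomp (leavitt_ops TYPE('k::field) n) (- int r) \<and>
    yop n w \<in> hcomp (leavitt_ops TYPE('k) n) (int r)"
  using assms
proof (induction r arbitrary: w)
  case 0
  then have "xop n w = (1 :: 'k state endo)" "yop n w = (1 :: 'k state endo)"
    by (simp_all add: xop_def yop_def words_0)
  then show ?case
    using hcomp_Lops_closed(2)[of n, where 'k = 'k] by (simp only: of_nat_0 minus_zero)
next
  case (Suc r)
  then obtain i v where w: "w = i # v" "i \<in> {1..n}" "v \<in> words n r"
    by (auto simp: words_Suc)
  have "xop n w = shrink n i * (xop n v :: 'k state endo)"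
    "yop n w = (yop n v * spread n i :: 'k state endo)"
    by (simp_all add: xop_def yop_def w)
  moreover have "shrink n i * xop n v \<in> hcomp (leavitt_ops TYPE('k) n) (-1 + - int r)"
    "yop n v * spread n i \<in> hcomp (leavitt_ops TYPE('k) n) (int r + 1)"
    using hcomp_Lops_closed(4)[OF gen_op_hcomp(1)[OF w(2)], of "xop n v :: 'k state endo"]
      hcomp_Lops_closed(4)[OF _ gen_op_hcomp(2)[OF w(2)], of "yop n v :: 'k state endo"]
      Suc.IH[OF w(3)] by blast+
  ultimately show ?case
    by (simp only: of_nat_Suc minus_add_distrib add.commute)
qed

lemma xop_yop:
  assumes "n > 0" "w \<in> words n r" "v \<in> words n r"
  shows "xop n w * yop n v = (if w = v then 1 else 0 :: 'k::field state endo)"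
  using rep_leavitt_eq[OF assms(1) leavitt_eq_xw_yw[OF assms(2,3)]]
  by (auto simp: xop_def yop_def)

lemma sum_yop_xop:
  assumes "n > 0"
  shows "(\<Sum>w\<in>words n r. yop n w * xop n w) = (1 :: 'k::field state endo)"
  using rep_leavitt_eq[OF assms leavitt_eq_sum_yw_xw] by (simp add: xop_def yop_def rep_sum)

text \<open>
  Matrices with a prescribed set for each entry, to treat carriers and homogeneous components
  of rectangular matrices at once.
\<close>
definition mats :: "nat \<Rightarrow> nat \<Rightarrow> (nat \<Rightarrow> nat \<Rightarrow> 'a set) \<Rightarrow> 'a mat set"
  where "mats a b X = {M \<in> carrier_mat a b. \<forall>i<a. \<forall>j<b. M $$ (i, j) \<in> X i j}"

lemma graded_mat_mats:
  "carrier (\<bbbM> m A \<delta>) = mats m m (\<lambda>i j. carrier A)"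
  "hcomp (\<bbbM> m A \<delta>) d = mats m m (\<lambda>i j. hcomp A (d + \<delta> j - \<delta> i))"
  by (simp_all add: mats_def graded_mat_simps)

lemma mats_carrier [dest]: "M \<in> mats a b X \<Longrightarrow> M \<in> carrier_mat a b"
  by (simp add: mats_def)

lemma sum_closed:
  "0 \<in> H \<Longrightarrow> (\<And>s t. s \<in> H \<Longrightarrow> t \<in> H \<Longrightarrow> s + t \<in> H) \<Longrightarrow> (\<And>a. a \<in> A \<Longrightarrow> f a \<in> H) \<Longrightarrow> sum f A \<in> H"
  by (induction A rule: infinite_finite_induct) auto

lemma index_mult_mat_sum:
  "A \<in> carrier_mat a b \<Longrightarrow> B \<in> carrier_mat b c \<Longrightarrow> i < a \<Longrightarrow> j < c \<Longrightarrow>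
    (A * B) $$ (i, j) = (\<Sum>l<b. A $$ (i, l) * B $$ (l, j))"
  by (auto simp: scalar_prod_def lessThan_atLeast0 intro!: sum.cong)

lemma mats_mult:
  assumes "A \<in> mats a b X" "B \<in> mats b c Y"
    and "\<And>i j. 0 \<in> Z i j" "\<And>i j s t. s \<in> Z i j \<Longrightarrow> t \<in> Z i j \<Longrightarrow> s + t \<in> Z i j"
    and "\<And>i l j s t. s \<in> X i l \<Longrightarrow> t \<in> Y l j \<Longrightarrow> s * t \<in> Z i j"
  shows "A * B \<in> mats a c Z"
proof -
  have "(A * B) $$ (i, j) \<in> Z i j" if "i < a" "j < c" for i j
    unfolding index_mult_mat_sum[OF mats_carrier[OF assms(1)] mats_carrier[OF assms(2)] that]
  proof (rule sum_closed)
    fix l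
    assume "l \<in> {..<b}"
    then have "A $$ (i, l) \<in> X i l" "B $$ (l, j) \<in> Y l j"
      using assms(1,2) that by (auto simp: mats_def)
    then show "A $$ (i, l) * B $$ (l, j) \<in> Z i j"
      by (rule assms(5))
  qed (use assms in auto)
  moreover have "A * B \<in> carrier_mat a c"
    by (rule mult_carrier_mat[OF mats_carrier[OF assms(1)] mats_carrier[OF assms(2)]])
  ultimately show ?thesis
    by (simp add: mats_def)
qed

lemma mats_mult_carrier:
  "A \<in> mats a b (\<lambda>i j. carrier (Lops n)) \<Longrightarrow> B \<in> mats b c (\<lambda>i j. carrier (Lops n)) \<Longrightarrow>
    A * B \<in> mats a c (\<lambda>i j. carrier (Lops n))"
  by (erule (1) mats_mult) (simp_all only: leavitt_ops_simps rep_image_closed)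

lemma mats_mult_hcomp:
  assumes  "A \<in> mats a b (\<lambda>i j. hcomp (leavitt_ops TYPE('k::field) n) (d + \<beta> j - \<alpha> i))"
    "B \<in> mats b c (\<lambda>i j. hcomp (Lops n) (e + \<gamma> j - \<beta> i))"
  shows "A * B \<in> mats a c (\<lambda>i j. hcomp (Lops n) (d + e + \<gamma> j - \<alpha> i))"
proof (rule mats_mult[OF assms])
  fix i l j and s t :: "'k state endo"
  assume "s \<in> hcomp (Lops n) (d + \<beta> l - \<alpha> i)" "t \<in> hcomp (Lops n) (e + \<gamma> j - \<beta> l)"
  moreover have "d + \<beta> l - \<alpha> i + (e + \<gamma> j - \<beta> l) = d + e + \<gamma> j - \<alpha> i"
    by simp
  ultimately show "s * t \<in> hcomp (Lops n) (d + e + \<gamma> j - \<alpha> i)"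
    by (metis hcomp_Lops_closed(4))
qed (simp_all only: hcomp_Lops_closed)

lemma finsum_Lops:
  assumes "\<And>a. a \<in> A \<Longrightarrow> f a \<in> carrier (Lops n)"
  shows "finsum (Lops n) f A = sum f A"
proof -
  interpret ring "Lops n"
    by (rule ring_leavitt_ops)
  show ?thesis
    using assms
  proof (induction A rule: infinite_finite_induct)
    case (insert a A)
    then have "finsum (Lops n) f (insert a A) = f a + finsum (Lops n) f A"
      by (subst finsum_insert) auto
    with insert show ?case
      by simp
  qed simp_all
qed

lemma graded_mat_Lops_simps:
  assumes "M \<in> carrier (\<bbbM> m (Lops n) \<delta>)" "N \<in> carrier (\<bbbM> m (Lops n) \<delta>)"
  shows "M \<otimes>\<^bsub>\<bbbM> m (Lops n) \<delta>\<^esub> N = M * N" and "M \<oplus>\<^bsub>\<bbbM> m (Lops n) \<delta>\<^esub> N = M + N"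
proof -
  have MN: "M \<in> carrier_mat m m" "N \<in> carrier_mat m m"
    using assms by (auto simp: graded_mat_simps)
  show "M \<oplus>\<^bsub>\<bbbM> m (Lops n) \<delta>\<^esub> N = M + N"
    using MN by (intro eq_matI) (auto simp: graded_mat_simps)
  show "M \<otimes>\<^bsub>\<bbbM> m (Lops n) \<delta>\<^esub> N = M * N"
  proof (rule eq_matI)
    fix i j
    assume "i < dim_row (M * N)" "j < dim_col (M * N)"
    then have ij: "i < m" "j < m"
      using MN by auto
    have "(\<Oplus>\<^bsub>Lops n\<^esub>l \<in> {..<m}. M $$ (i, l) \<otimes>\<^bsub>Lops n\<^esub> N $$ (l, j)) = (\<Sum>l<m. M $$ (i, l) * N $$ (l, j))"
    proof (subst finsum_Lops)
      fix l
      assume "l \<in> {..<m}"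
      then have "M $$ (i, l) \<in> rep n ` leavitt_polys n" "N $$ (l, j) \<in> rep n ` leavitt_polys n"
        using assms ij by (auto simp only: graded_mat_simps leavitt_ops_simps)
      then show "M $$ (i, l) \<otimes>\<^bsub>Lops n\<^esub> N $$ (l, j) \<in> carrier (Lops n)"
        unfolding leavitt_ops_simps by (rule rep_image_closed(2))
    qed simp
    then show "(M \<otimes>\<^bsub>\<bbbM> m (Lops n) \<delta>\<^esub> N) $$ (i, j) = (M * N) $$ (i, j)"
      using ij by (simp only: index_mult_mat_sum[OF MN ij] graded_mat_simps index_mat case_prod_conv)
  qed (use MN in \<open>auto simp: graded_mat_simps\<close>)
qed

lemma graded_mat_Lops_one: "\<one>\<^bsub>\<bbbM> m (Lops n) \<delta>\<^esub> = 1\<^sub>m m"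
  by (intro eq_matI) (auto simp: graded_mat_simps)

lemma mats_hcomp_carrier:
  "M \<in> mats a b (\<lambda>i j. hcomp (Lops n) (X i j)) \<Longrightarrow> M \<in> mats a b (\<lambda>i j. carrier (Lops n))"
  using hcomp_Lops_closed(5) by (fastforce simp only: mats_def)

section \<open>Expansion to equal shifts\<close>

lemma mult_conjugates:
  assumes P: "P \<in> carrier_mat b a" and Q: "Q \<in> carrier_mat a b"
    and M: "M \<in> carrier_mat a a" and N: "N \<in> carrier_mat a a"
    and QP: "Q * P = (1\<^sub>m a :: 'r::semiring_1 mat)"
  shows "P * M * Q * (P * N * Q) = P * (M * N) * Q"
proof -
  have "P * M * Q * (P * N * Q) = P * M * (Q * (P * N * Q))"
    using P Q M N by (intro assoc_mult_mat[of _ b a _ b _ b]) auto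
  also have "Q * (P * N * Q) = Q * (P * N) * Q"
    using P Q N by (intro assoc_mult_mat[symmetric, of _ a b _ a _ b]) auto
  also have "Q * (P * N) = N"
    using assoc_mult_mat[OF Q P N] N by (simp add: QP)
  also have "P * M * (N * Q) = P * M * N * Q"
    using P Q M N by (intro assoc_mult_mat[symmetric, of _ b a _ a _ b]) auto
  also have "P * M * N = P * (M * N)"
    using P M N by (intro assoc_mult_mat[of _ b a _ a _ a]) auto
  finally show ?thesis .
qed

lemma conjugation_ring_hom:
  assumes P: "P \<in> mats b a (\<lambda>i j. hcomp (leavitt_ops TYPE('k::field) n) (0 + \<alpha> j - \<beta> i))"
    and Q: "Q \<in> mats a b (\<lambda>i j. hcomp (leavitt_ops TYPE('k) n) (0 + \<beta> j - \<alpha> i))"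
    and QP: "Q * P = 1\<^sub>m a" and PQ: "P * Q = 1\<^sub>m b"
  shows "(\<lambda>M. P * M * Q) \<in> Ring.ring_hom (\<bbbM> a (leavitt_ops TYPE('k) n) \<alpha>) (\<bbbM> b (leavitt_ops TYPE('k) n) \<beta>)"
    and "M \<in> hcomp (\<bbbM> a (leavitt_ops TYPE('k) n) \<alpha>) d \<Longrightarrow> P * M * Q \<in> hcomp (\<bbbM> b (leavitt_ops TYPE('k) n) \<beta>) d"
    and "M \<in> carrier (\<bbbM> a (leavitt_ops TYPE('k) n) \<alpha>) \<Longrightarrow> Q * (P * M * Q) * P = M"
proof -
  note Pc = mats_carrier[OF P] and Qc = mats_carrier[OF Q]
  have closed: "P * M * Q \<in> carrier (\<bbbM> b (leavitt_ops TYPE('k) n) \<beta>)"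
    if "M \<in> carrier (\<bbbM> a (leavitt_ops TYPE('k) n) \<alpha>)" for M
    using mats_mult_carrier[OF mats_mult_carrier[OF mats_hcomp_carrier[OF P]] mats_hcomp_carrier[OF Q]] that
    unfolding graded_mat_mats by blast
  have Mc: "M \<in> carrier_mat a a" if "M \<in> carrier (\<bbbM> a (leavitt_ops TYPE('k) n) \<alpha>)" for M
    using that by (simp add: graded_mat_simps)
  have cancel: "Q * (P * N) = N" if "N \<in> carrier_mat a a" for N
    using assoc_mult_mat[OF Qc Pc that] that by (simp add: QP)
  show "(\<lambda>M. P * M * Q) \<in> Ring.ring_hom (\<bbbM> a (leavitt_ops TYPE('k) n) \<alpha>) (\<bbbM> b (leavitt_ops TYPE('k) n) \<beta>)"
  proof (rule ring_hom_memI)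
    fix M N
    assume M: "M \<in> carrier (\<bbbM> a (leavitt_ops TYPE('k) n) \<alpha>)"
      and N: "N \<in> carrier (\<bbbM> a (leavitt_ops TYPE('k) n) \<alpha>)"
    show "P * (M \<oplus>\<^bsub>\<bbbM> a (leavitt_ops TYPE('k) n) \<alpha>\<^esub> N) * Q =
        P * M * Q \<oplus>\<^bsub>\<bbbM> b (leavitt_ops TYPE('k) n) \<beta>\<^esub> P * N * Q"
      unfolding graded_mat_Lops_simps(2)[OF M N] graded_mat_Lops_simps(2)[OF closed[OF M] closed[OF N]]
      using mult_add_distrib_mat[OF Pc Mc[OF M] Mc[OF N]]
        add_mult_distrib_mat[OF mult_carrier_mat[OF Pc Mc[OF M]] mult_carrier_mat[OF Pc Mc[OF N]] Qc]
      by simp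
    have "P * M * Q * (P * N * Q) = P * (M * N) * Q"
      by (rule mult_conjugates[OF Pc Qc Mc[OF M] Mc[OF N] QP])
    then show "P * (M \<otimes>\<^bsub>\<bbbM> a (leavitt_ops TYPE('k) n) \<alpha>\<^esub> N) * Q =
        P * M * Q \<otimes>\<^bsub>\<bbbM> b (leavitt_ops TYPE('k) n) \<beta>\<^esub> (P * N * Q)"
      unfolding graded_mat_Lops_simps(1)[OF M N] graded_mat_Lops_simps(1)[OF closed[OF M] closed[OF N]] by simp
  next
    show "P * \<one>\<^bsub>\<bbbM> a (leavitt_ops TYPE('k) n) \<alpha>\<^esub> * Q = \<one>\<^bsub>\<bbbM> b (leavitt_ops TYPE('k) n) \<beta>\<^esub>"
      unfolding graded_mat_Lops_one using PQ Pc by simp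
  qed (rule closed)
  show "P * M * Q \<in> hcomp (\<bbbM> b (leavitt_ops TYPE('k) n) \<beta>) d"
    if "M \<in> hcomp (\<bbbM> a (leavitt_ops TYPE('k) n) \<alpha>) d"
    using mats_mult_hcomp[OF mats_mult_hcomp[OF P] Q, of M d] that unfolding graded_mat_mats by simp
  show "Q * (P * M * Q) * P = M" if "M \<in> carrier (\<bbbM> a (leavitt_ops TYPE('k) n) \<alpha>)"
  proof -
    have "Q * (P * M * Q) = Q * (P * M) * Q"
      using Pc Qc Mc[OF that] by (intro assoc_mult_mat[symmetric, of _ a b _ a _ b]) auto
    also have "\<dots> * P = M * (Q * P)"
      unfolding cancel[OF Mc[OF that]] by (rule assoc_mult_mat[OF Mc[OF that] Qc Pc])
    finally show ?thesis
      using Mc[OF that] by (simp add: QP)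
  qed
qed

text \<open>
  The shifts enter only through the degrees of the entries of \<open>P\<close> and \<open>Q\<close>: two matrix rings over the
  same graded ring are graded isomorphic as soon as a rectangular matrix with entries in the
  appropriate degrees is invertible.
\<close>
lemma gr_equiv_conjugation:
  assumes P: "P \<in> mats b a (\<lambda>i j. hcomp (leavitt_ops TYPE('k::field) n) (0 + \<alpha> j - \<beta> i))"
    and Q: "Q \<in> mats a b (\<lambda>i j. hcomp (leavitt_ops TYPE('k) n) (0 + \<beta> j - \<alpha> i))"
    and QP: "Q * P = 1\<^sub>m a" and PQ: "P * Q = 1\<^sub>m b"
  shows "gr_equiv (\<bbbM> a (leavitt_ops TYPE('k) n) \<alpha>) (\<bbbM> b (leavitt_ops TYPE('k) n) \<beta>)"
  by (rule gr_equivI[OF conjugation_ring_hom(1)[OF P Q QP PQ] conjugation_ring_hom(1)[OF Q P PQ QP]])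
    (auto intro: conjugation_ring_hom(2)[OF P Q QP PQ] conjugation_ring_hom(2)[OF Q P PQ QP]
      simp only: conjugation_ring_hom(3)[OF P Q QP PQ] conjugation_ring_hom(3)[OF Q P PQ QP])

text \<open>
  An enumeration of the pairs \<open>(i, w)\<close> where \<open>w\<close> is a word of length \<open>r i\<close>; these are the rows that
  replace row \<open>i\<close>.
\<close>
definition expansion_index :: "nat \<Rightarrow> nat \<Rightarrow> (nat \<Rightarrow> nat) \<Rightarrow> nat \<Rightarrow> nat \<times> nat list"
  where "expansion_index n k r = (SOME e. bij_betw e {..<\<Sum>i<k. n ^ r i} (SIGMA i:{..<k}. words n (r i)))"

lemma expansion_index: "bij_betw (expansion_index n k r) {..<\<Sum>i<k. n ^ r i} (SIGMA i:{..<k}. words n (r i))"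
proof -
  have "card (SIGMA i:{..<k}. words n (r i)) = (\<Sum>i<k. n ^ r i)"
    by (simp add: card_words)
  moreover have "finite (SIGMA i:{..<k}. words n (r i))"
    by simp
  ultimately have "\<exists>e. bij_betw e {..<\<Sum>i<k. n ^ r i} (SIGMA i:{..<k}. words n (r i))"
    using ex_bij_betw_nat_finite[of "SIGMA i:{..<k}. words n (r i)"] by (simp add: lessThan_atLeast0)
  then show ?thesis
    unfolding expansion_index_def by (rule someI_ex)
qed

text \<open>
  The row \<open>(i, w)\<close> of \<open>expansion_x\<close> has the single entry \<open>x\<^sub>w\<close> in column \<open>i\<close>, and the column
  \<open>(i, w)\<close> of \<open>expansion_y\<close> has the single entry \<open>y\<^sub>w\<close> in row \<open>i\<close>.
\<close>
definition expansion_x :: "nat \<Rightarrow> nat \<Rightarrow> (nat \<Rightarrow> nat) \<Rightarrow> 'k::field state endo mat"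
  where "expansion_x n k r = mat (\<Sum>i<k. n ^ r i) k
    (\<lambda>(a, j). if fst (expansion_index n k r a) = j then xop n (snd (expansion_index n k r a)) else 0)"

definition expansion_y :: "nat \<Rightarrow> nat \<Rightarrow> (nat \<Rightarrow> nat) \<Rightarrow> 'k::field state endo mat"
  where "expansion_y n k r = mat k (\<Sum>i<k. n ^ r i)
    (\<lambda>(i, a). if fst (expansion_index n k r a) = i then yop n (snd (expansion_index n k r a)) else 0)"

lemma expansion_carrier [simp]:
  "expansion_x n k r \<in> carrier_mat (\<Sum>i<k. n ^ r i) k" "expansion_y n k r \<in> carrier_mat k (\<Sum>i<k. n ^ r i)"
  by (simp_all add: expansion_x_def expansion_y_def)

lemma expansion_index_mem:
  assumes "a < (\<Sum>i<k. n ^ r i)" "expansion_index n k r a = (i, w)"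
  shows "i < k" "w \<in> words n (r i)"
  using bij_betwE[OF expansion_index[of n k r]] assms by force+

lemma expansion_x_y:
  assumes "n > 0"
  shows "expansion_x n k r * expansion_y n k r = (1\<^sub>m (\<Sum>i<k. n ^ r i) :: 'k::field state endo mat)"
proof (rule eq_matI)
  fix a b
  assume "a < dim_row (1\<^sub>m (\<Sum>i<k. n ^ r i) :: 'k state endo mat)"
    "b < dim_col (1\<^sub>m (\<Sum>i<k. n ^ r i) :: 'k state endo mat)"
  then have ab: "a < (\<Sum>i<k. n ^ r i)" "b < (\<Sum>i<k. n ^ r i)"
    by simp_all
  obtain i w j v where e: "expansion_index n k r a = (i, w)" "expansion_index n k r b = (j, v)"
    by (metis surj_pair)
  note mem = expansion_index_mem[OF ab(1) e(1)] expansion_index_mem[OF ab(2) e(2)]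
  have "(expansion_x n k r * expansion_y n k r) $$ (a, b) =
      (\<Sum>l<k. expansion_x n k r $$ (a, l) * expansion_y n k r $$ (l, b) :: 'k state endo)"
    by (rule index_mult_mat_sum[OF expansion_carrier ab])
  also have "\<dots> = (\<Sum>l<k. if l = i then if i = j then xop n w * yop n v else 0 else 0)"
    using ab e by (intro sum.cong) (auto simp: expansion_x_def expansion_y_def)
  also have "\<dots> = (if i = j then xop n w * yop n v else 0)"
    using mem by simp
  also have "\<dots> = (if (i, w) = (j, v) then 1 else 0)"
    using xop_yop[OF assms, of w "r i" v] mem by auto
  also have "(i, w) = (j, v) \<longleftrightarrow> a = b"
    using bij_betw_imp_inj_on[OF expansion_index[of n k r]] ab e by (metis inj_on_eq_iff lessThan_iff)
  finally show "(expansion_x n k r * expansion_y n k r) $$ (a, b) = (1\<^sub>m (\<Sum>i<k. n ^ r i) :: 'k state endo mat) $$ (a, b)"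
    using ab by simp
qed (simp_all add: expansion_x_def expansion_y_def)

lemma expansion_y_x:
  assumes "n > 0"
  shows "expansion_y n k r * expansion_x n k r = (1\<^sub>m k :: 'k::field state endo mat)"
proof (rule eq_matI)
  fix i j
  assume "i < dim_row (1\<^sub>m k :: 'k state endo mat)" "j < dim_col (1\<^sub>m k :: 'k state endo mat)"
  then have ij: "i < k" "j < k"
    by simp_all
  let ?g = "\<lambda>(l, w). if l = i then if i = j then yop n w * xop n w else 0 else 0 :: 'k state endo"
  have "(expansion_y n k r * expansion_x n k r) $$ (i, j) =
      (\<Sum>a<(\<Sum>i<k. n ^ r i). expansion_y n k r $$ (i, a) * expansion_x n k r $$ (a, j) :: 'k state endo)"
    by (rule index_mult_mat_sum[OF expansion_carrier(2,1) ij])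
  also have "\<dots> = (\<Sum>a<(\<Sum>i<k. n ^ r i). ?g (expansion_index n k r a))"
    using ij by (intro sum.cong) (auto simp: expansion_x_def expansion_y_def split: prod.splits)
  also have "\<dots> = (\<Sum>x\<in>(SIGMA i:{..<k}. words n (r i)). ?g x)"
    by (rule sum.reindex_bij_betw[OF expansion_index])
  also have "\<dots> = (\<Sum>l<k. \<Sum>w\<in>words n (r l). ?g (l, w))"
    by (subst sum.Sigma) (auto intro!: sum.cong)
  also have "\<dots> = (\<Sum>l<k. if l = i then if i = j then 1 else 0 else 0)"
    using sum_yop_xop[OF assms, where 'k = 'k] by (intro sum.cong) auto
  also have "\<dots> = (if i = j then 1 else 0)"
    using ij by simp
  finally show "(expansion_y n k r * expansion_x n k r) $$ (i, j) = (1\<^sub>m k :: 'k state endo mat) $$ (i, j)"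
    using ij by simp
qed (simp_all add: expansion_x_def expansion_y_def)

lemma expansion_hcomp:
  assumes "\<And>i. i < k \<Longrightarrow> lam i + int (r i) = N"
  shows "expansion_x n k r \<in> mats (\<Sum>i<k. n ^ r i) k (\<lambda>i j. hcomp (leavitt_ops TYPE('k::field) n) (0 + lam j - N))"
    and "expansion_y n k r \<in> mats k (\<Sum>i<k. n ^ r i) (\<lambda>i j. hcomp (leavitt_ops TYPE('k) n) (0 + N - lam i))"
proof -
  let ?e = "expansion_index n k r"
  have "expansion_x n k r $$ (a, j) \<in> hcomp (leavitt_ops TYPE('k) n) (0 + lam j - N) \<and>
    expansion_y n k r $$ (j, a) \<in> hcomp (leavitt_ops TYPE('k) n) (0 + N - lam j)"
    if "a < (\<Sum>i<k. n ^ r i)" "j < k" for a j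
  proof (cases "fst (?e a) = j")
    case True
    then obtain w where e: "?e a = (j, w)"
      by (metis prod.collapse)
    have "0 + lam j - N = - int (r j)" "0 + N - lam j = int (r j)"
      using assms[OF that(2)] by simp_all
    moreover have "expansion_x n k r $$ (a, j) = (xop n w :: 'k state endo)" "expansion_y n k r $$ (j, a) = (yop n w :: 'k state endo)"
      using e that by (simp_all add: expansion_x_def expansion_y_def)
    ultimately show ?thesis
      using xop_yop_hcomp[OF expansion_index_mem(2)[OF that(1) e]] by (simp only:)
  next
    case False
    then have "expansion_x n k r $$ (a, j) = (0 :: 'k state endo)" "expansion_y n k r $$ (j, a) = (0 :: 'k state endo)"
      using that by (simp_all add: expansion_x_def expansion_y_def)
    then show ?thesis
      by (simp only: hcomp_Lops_closed)
  qed
  then show "expansion_x n k r \<in> mats (\<Sum>i<k. n ^ r i) k (\<lambda>i j. hcomp (leavitt_ops TYPE('k) n) (0 + lam j - N))"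
    "expansion_y n k r \<in> mats k (\<Sum>i<k. n ^ r i) (\<lambda>i j. hcomp (leavitt_ops TYPE('k) n) (0 + N - lam i))"
    unfolding mats_def using expansion_carrier by blast+
qed

text \<open>
  After the expansion all shifts are equal to \<open>N\<close>, and the grading depends only on their
  differences.
\<close>
lemma gr_equiv_expansion:
  assumes "n > 0" "\<And>i. i < k \<Longrightarrow> lam i + int (r i) = N"
  shows "gr_equiv (\<bbbM> k (leavitt_ops TYPE('k::field) n) lam)
    (\<bbbM> (\<Sum>i<k. n ^ r i) (leavitt_ops TYPE('k) n) (\<lambda>_. 0))"
proof -
  have "gr_equiv (\<bbbM> k (leavitt_ops TYPE('k) n) lam)
    (\<bbbM> (\<Sum>i<k. n ^ r i) (leavitt_ops TYPE('k) n) (\<lambda>_. N))"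
    by (rule gr_equiv_conjugation[OF expansion_hcomp[OF assms(2)] expansion_y_x[OF assms(1)] expansion_x_y[OF assms(1)]])
  then show ?thesis
    by (simp add: graded_mat_def)
qed

section \<open>Ranks of degree zero idempotents\<close>

lemma ring_graded_mat_Lops: "ring (\<bbbM> m (leavitt_ops TYPE('k::field) n) \<delta>)" (is "ring ?A")
proof -
  let ?X = "\<lambda>i j :: nat. carrier (leavitt_ops TYPE('k) n)"
  have Mc: "M \<in> carrier_mat m m" if "M \<in> carrier ?A" for M
    using that by (simp add: graded_mat_simps)
  have add: "M + N \<in> carrier ?A" if "M \<in> carrier ?A" "N \<in> carrier ?A" for M N
    using that by (auto simp only: graded_mat_simps leavitt_ops_simps index_add_mat carrier_matD mem_Collect_eq
        add_carrier_mat intro!: rep_image_closed)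
  have mult: "M * N \<in> carrier ?A" if "M \<in> carrier ?A" "N \<in> carrier ?A" for M N
    using mats_mult_carrier that unfolding graded_mat_mats by blast
  have zero: "\<zero>\<^bsub>?A\<^esub> = 0\<^sub>m m m"
    by (intro eq_matI) (simp_all add: graded_mat_def)
  have zero_closed: "0\<^sub>m m m \<in> carrier ?A" and one_closed: "1\<^sub>m m \<in> carrier ?A"
    by (simp_all add: graded_mat_simps rep_image_closed)
  note simps = graded_mat_Lops_simps graded_mat_Lops_one zero
  show ?thesis
  proof (rule ringI)
    show "abelian_group ?A"
    proof (rule abelian_groupI)
      fix M
      assume M: "M \<in> carrier ?A"
      have neg: "- M \<in> carrier ?A"
      proof -
        have "(- M) $$ (i, j) \<in> rep n ` leavitt_polys n" if "i < m" "j < m" for i j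
          using rep_image_closed(3)[of "M $$ (i, j)" n] Mc[OF M] M that by (simp add: graded_mat_simps)
        then show ?thesis
          using Mc[OF M] by (simp add: graded_mat_simps)
      qed
      then show "\<exists>N\<in>carrier ?A. N \<oplus>\<^bsub>?A\<^esub> M = \<zero>\<^bsub>?A\<^esub>"
        using uminus_l_inv_mat[OF Mc[OF M]] by (intro bexI[OF _ neg]) (simp add: simps M)
      show "\<zero>\<^bsub>?A\<^esub> \<oplus>\<^bsub>?A\<^esub> M = M"
        using Mc[OF M] by (simp add: simps M zero_closed)
    next
      fix M N L
      assume M: "M \<in> carrier ?A" and N: "N \<in> carrier ?A" 
      show "M \<oplus>\<^bsub>?A\<^esub> N \<in> carrier ?A"
        by (simp only: simps M N add)
      show "M \<oplus>\<^bsub>?A\<^esub> N = N \<oplus>\<^bsub>?A\<^esub> M"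
        by (simp only: simps M N comm_add_mat[OF Mc[OF M] Mc[OF N]])
      assume L: "L \<in> carrier ?A"
      show "M \<oplus>\<^bsub>?A\<^esub> N \<oplus>\<^bsub>?A\<^esub> L = M \<oplus>\<^bsub>?A\<^esub> (N \<oplus>\<^bsub>?A\<^esub> L)"
        by (simp only: simps M N L add assoc_add_mat[OF Mc[OF M] Mc[OF N] Mc[OF L]])
    qed (simp add: zero zero_closed)
    show "monoid ?A"
    proof (rule monoidI)
      fix M N L
      assume M: "M \<in> carrier ?A"
      show "\<one>\<^bsub>?A\<^esub> \<otimes>\<^bsub>?A\<^esub> M = M" "M \<otimes>\<^bsub>?A\<^esub> \<one>\<^bsub>?A\<^esub> = M"
        using Mc[OF M] by (simp_all only: simps M one_closed left_mult_one_mat right_mult_one_mat)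
      assume N: "N \<in> carrier ?A" 
      show "M \<otimes>\<^bsub>?A\<^esub> N \<in> carrier ?A"
        by (simp only: simps M N mult)
      assume L: "L \<in> carrier ?A"
      show "M \<otimes>\<^bsub>?A\<^esub> N \<otimes>\<^bsub>?A\<^esub> L = M \<otimes>\<^bsub>?A\<^esub> (N \<otimes>\<^bsub>?A\<^esub> L)"
        by (simp only: simps M N L mult assoc_mult_mat[OF Mc[OF M] Mc[OF N] Mc[OF L]])
    qed (simp only: simps one_closed)
  next
    fix M N L
    assume M: "M \<in> carrier ?A" and N: "N \<in> carrier ?A" and L: "L \<in> carrier ?A"
    show "(M \<oplus>\<^bsub>?A\<^esub> N) \<otimes>\<^bsub>?A\<^esub> L = M \<otimes>\<^bsub>?A\<^esub> L \<oplus>\<^bsub>?A\<^esub> N \<otimes>\<^bsub>?A\<^esub> L"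
      by (simp only: simps M N L add mult add_mult_distrib_mat[OF Mc[OF M] Mc[OF N] Mc[OF L]])
    show "L \<otimes>\<^bsub>?A\<^esub> (M \<oplus>\<^bsub>?A\<^esub> N) = L \<otimes>\<^bsub>?A\<^esub> M \<oplus>\<^bsub>?A\<^esub> L \<otimes>\<^bsub>?A\<^esub> N"
      by (simp only: simps M N L add mult mult_add_distrib_mat[OF Mc[OF L] Mc[OF M] Mc[OF N]])
  qed
qed

lemma graded_mat_Lops_zero: "\<zero>\<^bsub>\<bbbM> m (leavitt_ops TYPE('k::field) n) \<delta>\<^esub> = 0\<^sub>m m m"
  by (intro eq_matI) (simp_all add: graded_mat_def)

lemma finsum_graded_mat_Lops:
  assumes "\<And>i. i \<in> I \<Longrightarrow> f i \<in> carrier (\<bbbM> m (leavitt_ops TYPE('k::field) n) \<delta>)"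
    and "finite I" "a < m" "b < m"
  shows "finsum (\<bbbM> m (leavitt_ops TYPE('k) n) \<delta>) f I $$ (a, b) = (\<Sum>i\<in>I. f i $$ (a, b))"
proof -
  let ?A = "\<bbbM> m (leavitt_ops TYPE('k) n) \<delta>"
  interpret ring ?A
    by (rule ring_graded_mat_Lops)
  show ?thesis
    using assms(2,1)
  proof (induction I)
    case empty
    then show ?case
      using assms(3,4) by (simp add: graded_mat_Lops_zero)
  next
    case (insert i I)
    have "finsum ?A f (insert i I) = f i \<oplus>\<^bsub>?A\<^esub> finsum ?A f I"
      by (rule finsum_insert) (use insert in auto)
    also have "\<dots> $$ (a, b) = f i $$ (a, b) + finsum ?A f I $$ (a, b)"
      using assms(3,4) by (simp add: graded_mat_simps)
    finally show ?case
      using insert by simp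
  qed
qed

text \<open>
  In a ring, the products \<open>u i \<otimes> v i\<close> are then orthogonal idempotents of degree zero with sum \<open>1\<close>, all equivalent
  to \<open>D\<close>.  Keeping the factors in place of the idempotents records the equivalence.
\<close>
definition partition_of_one ::
    "('a, 'c) graded_ring_scheme \<Rightarrow> nat \<Rightarrow> (nat \<Rightarrow> 'a) \<Rightarrow> (nat \<Rightarrow> 'a) \<Rightarrow> 'a \<Rightarrow> bool"
  where "partition_of_one A q u v D \<longleftrightarrow> (\<forall>i<q. u i \<in> hcomp A 0 \<and> v i \<in> hcomp A 0) \<and> D \<in> hcomp A 0 \<and>
    (\<forall>i<q. \<forall>j<q. v i \<otimes>\<^bsub>A\<^esub> u j = (if i = j then D else \<zero>\<^bsub>A\<^esub>)) \<and>
    (\<Oplus>\<^bsub>A\<^esub>i\<in>{..<q}. u i \<otimes>\<^bsub>A\<^esub> v i) = \<one>\<^bsub>A\<^esub>"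

interpretation scal: inj_semiring_hom "scal :: 'k::field \<Rightarrow> _"
  by unfold_locales (auto intro: injD[OF inj_scal])

lemma degree_zero_corner_scalar:
  assumes n: "n > 0" and s: "s \<in> hcomp (leavitt_ops TYPE('k::field) n) 0"
  shows "\<exists>R. \<forall>r\<ge>R. \<forall>w\<in>words n r. \<forall>v\<in>words n r. xop n w * s * yop n v \<in> range scal"
proof -
  obtain p where p: "s = rep n p" "p \<in> leavitt_polys n" "\<forall>u\<in>Poly_Mapping.keys p. word_degree u = 0"
    using s by auto
  define R where "R = (\<Sum>u\<in>Poly_Mapping.keys p. length (letters u))"
  have "xop n w * s * yop n v \<in> range scal" if r: "r \<ge> R" and wv: "w \<in> words n r" "v \<in> words n r" for r w v
  proof -
    have "\<forall>u\<in>Poly_Mapping.keys p. length (letters u) \<le> r"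
      using r unfolding R_def by (meson finite_keys le_trans member_le_sum zero_le)
    then obtain c where "leavitt_eq n (xw w * p * yw v) (Poly_Mapping.single 0 c)"
      using homogeneous_corner_scalar[OF p(2,3) _ _ wv] unfolding leavitt_scalar_def by auto
    from rep_leavitt_eq[OF n this] show ?thesis
      by (simp add: xop_def yop_def p(1))
  qed
  then show ?thesis
    by blast
qed

text \<open>
  The matrix with the blocks \<open>x\<^sub>w M\<^sub>i\<^sub>j y\<^sub>v\<close>, where \<open>w\<close> and \<open>v\<close> have length \<open>r\<close>.
\<close>
definition expand :: "nat \<Rightarrow> nat \<Rightarrow> nat \<Rightarrow> 'k::field state endo mat \<Rightarrow> 'k state endo mat"
  where "expand n m r M = expansion_x n m (\<lambda>_. r) * M * expansion_y n m (\<lambda>_. r)"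

definition base_mat :: "'k::field state endo mat \<Rightarrow> 'k mat"
  where "base_mat = map_mat (inv_into UNIV scal)"

definition scalar_mat :: "'k::field state endo mat \<Rightarrow> bool"
  where "scalar_mat M \<longleftrightarrow> (\<forall>a<dim_row M. \<forall>b<dim_col M. M $$ (a, b) \<in> range scal)"

lemma expand_carrier: "M \<in> carrier_mat m m \<Longrightarrow> expand n m r M \<in> carrier_mat (m * n ^ r) (m * n ^ r)"
  using mult_carrier_mat[OF mult_carrier_mat[OF expansion_carrier(1)] expansion_carrier(2), where r1 = "\<lambda>_. r" and r3 = "\<lambda>_. r"]
  unfolding expand_def by simp

lemma scal_base_mat: "scalar_mat M \<Longrightarrow> map_mat scal (base_mat M) = M"
  by (rule eq_matI) (auto simp: scalar_mat_def base_mat_def f_inv_into_f)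

lemma expand_index:
  assumes "M \<in> carrier_mat m m" "a < m * n ^ r" "b < m * n ^ r"
    "expansion_index n m (\<lambda>_. r) a = (i, w)" "expansion_index n m (\<lambda>_. r) b = (j, v)"
  shows "expand n m r M $$ (a, b) = xop n w * M $$ (i, j) * yop n v"
proof -
  let ?r = "\<lambda>_ :: nat. r"
  have ab: "a < (\<Sum>i<m. n ^ ?r i)" "b < (\<Sum>i<m. n ^ ?r i)"
    using assms by simp_all
  note mem = expansion_index_mem(1)[OF ab(1) assms(4)] expansion_index_mem(1)[OF ab(2) assms(5)]
  have XM: "(expansion_x n m ?r * M) $$ (a, l) = xop n w * M $$ (i, l)" if "l < m" for l
  proof -
    have "(expansion_x n m ?r * M) $$ (a, l) = (\<Sum>k<m. expansion_x n m ?r $$ (a, k) * M $$ (k, l))"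
      by (rule index_mult_mat_sum[OF expansion_carrier(1) assms(1) ab(1) that])
    also have "\<dots> = (\<Sum>k<m. if k = i then xop n w * M $$ (i, l) else 0)"
      using ab assms by (intro sum.cong) (auto simp: expansion_x_def)
    finally show ?thesis
      using mem by simp
  qed
  have "expand n m r M $$ (a, b) = (\<Sum>l<m. (expansion_x n m ?r * M) $$ (a, l) * expansion_y n m ?r $$ (l, b))"
    unfolding expand_def
    by (rule index_mult_mat_sum[OF mult_carrier_mat[OF expansion_carrier(1) assms(1)] expansion_carrier(2) ab])
  also have "\<dots> = (\<Sum>l<m. if l = j then xop n w * M $$ (i, j) * yop n v else 0)"
    using ab assms XM by (intro sum.cong) (auto simp: expansion_y_def)
  finally show ?thesis
    using mem by simp
qed

lemma expand_scalar:
  assumes n: "n > 0" and M: "M \<in> hcomp (\<bbbM> m (leavitt_ops TYPE('k::field) n) (\<lambda>_. 0)) 0"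
  shows "\<exists>R. \<forall>r\<ge>R. scalar_mat (expand n m r M)"
proof -
  have Mc: "M \<in> carrier_mat m m"
    using M by (simp add: graded_mat_simps)
  have "\<exists>R. \<forall>r\<ge>R. \<forall>w\<in>words n r. \<forall>v\<in>words n r. xop n w * M $$ (i, j) * yop n v \<in> range scal"
    if "i < m" "j < m" for i j
  proof (rule degree_zero_corner_scalar[OF n])
    show "M $$ (i, j) \<in> hcomp (leavitt_ops TYPE('k) n) 0"
      using M that unfolding graded_mat_simps by simp
  qed
  then obtain R where R: "xop n w * M $$ (i, j) * yop n v \<in> range scal"
    if "i < m" "j < m" "r \<ge> R i j" "w \<in> words n r" "v \<in> words n r" for i j r w v
    by metis
  have "scalar_mat (expand n m r M)" if r: "r \<ge> (\<Sum>i<m. \<Sum>j<m. R i j)" for r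
  proof -
    have "expand n m r M $$ (a, b) \<in> range scal" if ab: "a < m * n ^ r" "b < m * n ^ r" for a b
    proof -
      obtain i w j v where e: "expansion_index n m (\<lambda>_. r) a = (i, w)" "expansion_index n m (\<lambda>_. r) b = (j, v)"
        by (metis surj_pair)
      have mem: "i < m" "w \<in> words n r" "j < m" "v \<in> words n r"
        using expansion_index_mem[OF _ e(1)] expansion_index_mem[OF _ e(2)] ab by simp_all
      have "R i j \<le> (\<Sum>j<m. R i j)"
        by (rule member_le_sum) (use mem in auto)
      also have "\<dots> \<le> (\<Sum>i<m. \<Sum>j<m. R i j)"
        by (rule member_le_sum) (use mem in auto)
      finally show ?thesis
        unfolding expand_index[OF Mc ab e] using R[of i j r w v] mem r by auto
    qed
    then show ?thesis
      using expand_carrier[OF Mc, of n r] by (auto simp: scalar_mat_def)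
  qed
  then show ?thesis
    by blast
qed

lemma expand_mult:
  assumes "n > 0" "M \<in> carrier_mat m m" "N \<in> carrier_mat m m"
  shows "expand n m r M * expand n m r N = expand n m r (M * N)"
  unfolding expand_def by (rule mult_conjugates[OF expansion_carrier assms(2,3) expansion_y_x[OF assms(1)]])

definition op_rank :: "nat \<Rightarrow> nat \<Rightarrow> nat \<Rightarrow> 'k::field state endo mat \<Rightarrow> nat"
  where "op_rank n m r D = idem_rank (base_mat (expand n m r D))"

text \<open>
  For large \<open>r\<close> all matrices involved expand to matrices over the field, expansion preserves
  the relations, and \<open>idem_rank_partition\<close> applies.  The conclusion is claimed for all large \<open>r\<close>, so
  that it can be applied to two partitions with the same \<open>D\<close> simultaneously.
\<close>
lemma op_rank_partition:
  assumes n: "n > 0" and part: "partition_of_one (\<bbbM> m (leavitt_ops TYPE('k::field) n) (\<lambda>_. 0)) q u v D"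
  shows "\<exists>R. \<forall>r\<ge>R. q * op_rank n m r D = m * n ^ r"
proof -
  let ?A = "\<bbbM> m (leavitt_ops TYPE('k) n) (\<lambda>_. 0)"
  have uv: "u i \<in> hcomp ?A 0" "v i \<in> hcomp ?A 0" if "i < q" for i
    using part that unfolding partition_of_one_def by blast+
  have D: "D \<in> hcomp ?A 0"
    using part unfolding partition_of_one_def by blast
  have carrier: "M \<in> carrier ?A" if "M \<in> hcomp ?A 0" for M
    using that mats_hcomp_carrier[of M m m n "\<lambda>i j. 0"] unfolding graded_mat_mats by simp
  have carrier_mat: "M \<in> carrier_mat m m" if "M \<in> hcomp ?A 0" for M
    using that unfolding graded_mat_mats by blast
  have vu: "v i * u j = (if i = j then D else 0\<^sub>m m m)" if "i < q" "j < q" for i j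
  proof -
    have "v i * u j = v i \<otimes>\<^bsub>?A\<^esub> u j"
      by (rule graded_mat_Lops_simps(1)[symmetric]) (intro carrier uv that)+
    then show ?thesis
      using part that unfolding partition_of_one_def graded_mat_Lops_zero by simp
  qed
  have uv_carrier: "u i * v i \<in> carrier ?A" if "i < q" for i
    using mats_mult_carrier carrier[OF uv(1)[OF that]] carrier[OF uv(2)[OF that]]
    unfolding graded_mat_mats by blast
  have one: "(\<Sum>i<q. (u i * v i) $$ (a, b)) = (if a = b then 1 else 0)" if "a < m" "b < m" for a b
  proof -
    have "(\<Oplus>\<^bsub>?A\<^esub>i\<in>{..<q}. u i \<otimes>\<^bsub>?A\<^esub> v i) $$ (a, b) = (\<Sum>i<q. (u i \<otimes>\<^bsub>?A\<^esub> v i) $$ (a, b))"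
      by (rule finsum_graded_mat_Lops)
        (use that uv_carrier graded_mat_Lops_simps(1)[OF carrier[OF uv(1)] carrier[OF uv(2)]] in auto)
    also have "\<dots> = (\<Sum>i<q. (u i * v i) $$ (a, b))"
      using graded_mat_Lops_simps(1)[OF carrier[OF uv(1)] carrier[OF uv(2)]] by (intro sum.cong) auto
    also have "(\<Oplus>\<^bsub>?A\<^esub>i\<in>{..<q}. u i \<otimes>\<^bsub>?A\<^esub> v i) = 1\<^sub>m m"
      using part unfolding partition_of_one_def graded_mat_Lops_one by blast
    finally show ?thesis
      using that by simp
  qed
  obtain Ru where Ru: "\<And>i r. i < q \<Longrightarrow> r \<ge> Ru i \<Longrightarrow> scalar_mat (expand n m r (u i))"
    using expand_scalar[OF n uv(1)] by metis
  obtain Rv where Rv: "\<And>i r. i < q \<Longrightarrow> r \<ge> Rv i \<Longrightarrow> scalar_mat (expand n m r (v i))"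
    using expand_scalar[OF n uv(2)] by metis
  obtain RD where RD: "\<And>r. r \<ge> RD \<Longrightarrow> scalar_mat (expand n m r D)"
    using expand_scalar[OF n D] by metis
  have "q * op_rank n m r D = m * n ^ r" if r: "r \<ge> RD + (\<Sum>i<q. Ru i + Rv i)" for r
    unfolding op_rank_def
  proof (rule idem_rank_partition)
    let ?N = "m * n ^ r"
    let ?c = "expand n m r" and ?d = "\<lambda>M. base_mat (expand n m r M)"
    have scalar: "scalar_mat (?c (u i))" "scalar_mat (?c (v i))" if "i < q" for i
    proof -
      have "Ru i + Rv i \<le> (\<Sum>i<q. Ru i + Rv i)"
        by (rule member_le_sum) (use that in auto)
      then show "scalar_mat (?c (u i))" "scalar_mat (?c (v i))"
        using Ru[OF that, of r] Rv[OF that, of r] r by auto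
    qed
    have d_carrier: "?d M \<in> carrier_mat ?N ?N" if "M \<in> hcomp ?A 0" for M
      using expand_carrier[OF carrier_mat[OF that], of n r] by (simp add: base_mat_def)
    show "?d (u i) \<in> carrier_mat ?N ?N" "?d (v i) \<in> carrier_mat ?N ?N" if "i < q" for i
      using d_carrier uv that by blast+
    show "?d D \<in> carrier_mat ?N ?N"
      by (rule d_carrier[OF D])
    have prod: "map_mat scal (?d M * ?d M') = ?c (M * M')"
      if "M \<in> hcomp ?A 0" "M' \<in> hcomp ?A 0" "scalar_mat (?c M)" "scalar_mat (?c M')" for M M'
      unfolding scal.mat_hom_mult[OF d_carrier[OF that(1)] d_carrier[OF that(2)]]
        scal_base_mat[OF that(3)] scal_base_mat[OF that(4)]
      by (rule expand_mult[OF n carrier_mat[OF that(1)] carrier_mat[OF that(2)]])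
    show "?d (v i) * ?d (u j) = (if i = j then ?d D else 0\<^sub>m ?N ?N)" if "i < q" "j < q" for i j
    proof (rule scal.mat_hom_inj)
      have "map_mat scal (?d (v i) * ?d (u j)) = ?c (v i * u j)"
        by (intro prod uv scalar that)
      also have "\<dots> = map_mat scal (if i = j then ?d D else 0\<^sub>m ?N ?N)"
      proof (cases "i = j")
        case True
        then show ?thesis
          using vu[OF that] scal_base_mat[OF RD[of r]] r by simp
      next
        case False
        have "?c (0\<^sub>m m m) = 0\<^sub>m ?N ?N"
          unfolding expand_def right_mult_zero_mat[OF expansion_carrier(1)] left_mult_zero_mat[OF expansion_carrier(2)]
          by simp
        moreover have "map_mat scal (0\<^sub>m ?N ?N) = (0\<^sub>m ?N ?N :: 'k state endo mat)"
          by (intro eq_matI) auto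
        ultimately show ?thesis
          using vu[OF that] False by simp
      qed
      finally show "map_mat scal (?d (v i) * ?d (u j)) = map_mat scal (if i = j then ?d D else 0\<^sub>m ?N ?N)" .
    qed
    show "(\<Sum>i<q. (?d (u i) * ?d (v i)) $$ (a, b)) = (if a = b then 1 else 0)" if ab: "a < ?N" "b < ?N" for a b
    proof -
      obtain i w j v' where e: "expansion_index n m (\<lambda>_. r) a = (i, w)" "expansion_index n m (\<lambda>_. r) b = (j, v')"
        by (metis surj_pair)
      have ij: "i < m" "j < m"
        using expansion_index_mem(1)[OF _ e(1)] expansion_index_mem(1)[OF _ e(2)] ab by simp_all
      have "scal (\<Sum>l<q. (?d (u l) * ?d (v l)) $$ (a, b)) = (\<Sum>l<q. scal ((?d (u l) * ?d (v l)) $$ (a, b)))"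
        by (rule scal.hom_sum)
      also have "\<dots> = (\<Sum>l<q. xop n w * (u l * v l) $$ (i, j) * yop n v')"
      proof (rule sum.cong[OF refl])
        fix l
        assume "l \<in> {..<q}"
        then have l: "l < q"
          by simp
        have "scal ((?d (u l) * ?d (v l)) $$ (a, b)) = map_mat scal (?d (u l) * ?d (v l)) $$ (a, b)"
          using mult_carrier_mat[OF d_carrier[OF uv(1)[OF l]] d_carrier[OF uv(2)[OF l]]] ab
          by (subst index_map_mat(1)) (simp_all only: carrier_matD)
        also have "map_mat scal (?d (u l) * ?d (v l)) = ?c (u l * v l)"
          by (intro prod uv scalar l)
        also have "\<dots> $$ (a, b) = xop n w * (u l * v l) $$ (i, j) * yop n v'"
          by (rule expand_index[OF mult_carrier_mat[OF carrier_mat[OF uv(1)[OF l]] carrier_mat[OF uv(2)[OF l]]] ab e])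
        finally show "scal ((?d (u l) * ?d (v l)) $$ (a, b)) = xop n w * (u l * v l) $$ (i, j) * yop n v'" .
      qed
      also have "\<dots> = xop n w * (\<Sum>l<q. (u l * v l) $$ (i, j)) * yop n v'"
        by (simp add: sum_distrib_left sum_distrib_right)
      also have "\<dots> = xop n w * (1\<^sub>m m :: 'k state endo mat) $$ (i, j) * yop n v'"
        using one[OF ij] ij by simp
      also have "\<dots> = ?c (1\<^sub>m m) $$ (a, b)"
        by (rule expand_index[OF one_carrier_mat ab e, symmetric])
      also have "?c (1\<^sub>m m) = (1\<^sub>m ?N :: 'k state endo mat)"
        unfolding expand_def right_mult_one_mat[OF expansion_carrier(1)] by (simp add: expansion_x_y[OF n])
      also have "(1\<^sub>m ?N :: 'k state endo mat) $$ (a, b) = scal (if a = b then 1 else 0)"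
        using ab by simp
      finally show ?thesis
        by (rule injD[OF inj_scal])
    qed
  qed
  then show ?thesis
    by blast
qed

section \<open>Leavitt families and matrix units\<close>

lemma ring_hom_finsum:
  assumes "ring A" "ring B" "h \<in> Ring.ring_hom A B" "f \<in> I \<rightarrow> carrier A"
  shows "h (finsum A f I) = finsum B (\<lambda>i. h (f i)) I"
proof -
  interpret ring_hom_ring A B h
    using assms by (intro ring_hom_ringI2)
  show ?thesis
    using assms(4) by (induction I rule: infinite_finite_induct) (auto simp: Pi_def)
qed

text \<open>
  Elements that satisfy the defining relations of the Leavitt algebra in their natural degrees,
  numbered from \<open>0\<close>.
\<close>
definition leavitt_family ::
    "('a, 'c) graded_ring_scheme \<Rightarrow> nat \<Rightarrow> (nat \<Rightarrow> 'a) \<Rightarrow> (nat \<Rightarrow> 'a) \<Rightarrow> bool"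
  where "leavitt_family A n x y \<longleftrightarrow> (\<forall>i<n. x i \<in> hcomp A (-1) \<and> y i \<in> hcomp A 1) \<and>
    (\<forall>i<n. \<forall>j<n. x i \<otimes>\<^bsub>A\<^esub> y j = (if i = j then \<one>\<^bsub>A\<^esub> else \<zero>\<^bsub>A\<^esub>)) \<and>
    (\<Oplus>\<^bsub>A\<^esub>i\<in>{..<n}. y i \<otimes>\<^bsub>A\<^esub> x i) = \<one>\<^bsub>A\<^esub>"

locale graded_hom =
  fixes A :: "('a, 'c) graded_ring_scheme" and B :: "('b, 'd) graded_ring_scheme" and h
  assumes A: "ring A" and B: "ring B" and hom: "h \<in> Ring.ring_hom A B"
    and hcomp: "\<And>d a. a \<in> hcomp A d \<Longrightarrow> h a \<in> hcomp B d"
    and hcomp_carrier: "\<And>d. hcomp A d \<subseteq> carrier A"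
begin

sublocale ring_hom_ring A B h
  using A B hom by (rule ring_hom_ringI2)

lemma partition_of_one_hom:
  assumes part: "partition_of_one A q u v D"
  shows "partition_of_one B q (\<lambda>i. h (u i)) (\<lambda>i. h (v i)) (h D)"
proof -
  have uv: "u i \<in> carrier A" "v i \<in> carrier A" if "i < q" for i
    using part that hcomp_carrier unfolding partition_of_one_def by blast+
  have "h (v i) \<otimes>\<^bsub>B\<^esub> h (u j) = (if i = j then h D else \<zero>\<^bsub>B\<^esub>)" if "i < q" "j < q" for i j
    using part that hom_mult[OF uv(2)[OF that(1)] uv(1)[OF that(2)]]
    unfolding partition_of_one_def by (auto split: if_splits)
  moreover have "h (\<Oplus>\<^bsub>A\<^esub>i\<in>{..<q}. u i \<otimes>\<^bsub>A\<^esub> v i) = (\<Oplus>\<^bsub>B\<^esub>i\<in>{..<q}. h (u i \<otimes>\<^bsub>A\<^esub> v i))"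
    by (rule ring_hom_finsum[OF A B hom]) (use uv in auto)
  moreover have "\<dots> = (\<Oplus>\<^bsub>B\<^esub>i\<in>{..<q}. h (u i) \<otimes>\<^bsub>B\<^esub> h (v i))"
    using uv by (intro S.add.finprod_cong') auto
  ultimately show ?thesis
    using part hcomp unfolding partition_of_one_def by simp
qed

lemma leavitt_family_hom:
  assumes fam: "leavitt_family A q x y"
  shows "leavitt_family B q (\<lambda>i. h (x i)) (\<lambda>i. h (y i))"
proof -
  have xy: "x i \<in> carrier A" "y i \<in> carrier A" if "i < q" for i
    using fam that hcomp_carrier unfolding leavitt_family_def by blast+
  have "h (x i) \<otimes>\<^bsub>B\<^esub> h (y j) = (if i = j then \<one>\<^bsub>B\<^esub> else \<zero>\<^bsub>B\<^esub>)" if "i < q" "j < q" for i j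
    using fam that hom_mult[OF xy(1)[OF that(1)] xy(2)[OF that(2)]]
    unfolding leavitt_family_def by (auto split: if_splits)
  moreover have "h (\<Oplus>\<^bsub>A\<^esub>i\<in>{..<q}. y i \<otimes>\<^bsub>A\<^esub> x i) = (\<Oplus>\<^bsub>B\<^esub>i\<in>{..<q}. h (y i \<otimes>\<^bsub>A\<^esub> x i))"
    by (rule ring_hom_finsum[OF A B hom]) (use xy in auto)
  moreover have "\<dots> = (\<Oplus>\<^bsub>B\<^esub>i\<in>{..<q}. h (y i) \<otimes>\<^bsub>B\<^esub> h (x i))"
    using xy by (intro S.add.finprod_cong') auto
  ultimately show ?thesis
    using fam hcomp unfolding leavitt_family_def by simp
qed

end

text \<open>
  The elements \<open>y i \<otimes> x'\<close> and \<open>y' \<otimes> x i\<close> have degree zero, and they relate the idempotents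
  \<open>y i \<otimes> x i\<close>, which add up to \<open>1\<close>, to the idempotent \<open>y' \<otimes> x'\<close>.  The latter is independent
  of the family, so two families are compared through it.
\<close>
lemma partition_of_leavitt_families:
  assumes "ring A" and carrier: "\<And>d. hcomp A d \<subseteq> carrier A"
    and mult: "\<And>a b s t. s \<in> hcomp A a \<Longrightarrow> t \<in> hcomp A b \<Longrightarrow> s \<otimes>\<^bsub>A\<^esub> t \<in> hcomp A (a + b)"
    and xy: "leavitt_family A n x y" and x'y': "x' \<in> hcomp A (-1)" "y' \<in> hcomp A 1" "x' \<otimes>\<^bsub>A\<^esub> y' = \<one>\<^bsub>A\<^esub>"
  shows "partition_of_one A n (\<lambda>i. y i \<otimes>\<^bsub>A\<^esub> x') (\<lambda>i. y' \<otimes>\<^bsub>A\<^esub> x i) (y' \<otimes>\<^bsub>A\<^esub> x')"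
proof -
  interpret ring A
    by fact
  have deg: "x i \<in> hcomp A (-1)" "y i \<in> hcomp A 1" if "i < n" for i
    using xy that unfolding leavitt_family_def by blast+
  have c: "x i \<in> carrier A" "y i \<in> carrier A" if "i < n" for i
    using deg[OF that] carrier by blast+
  have c': "x' \<in> carrier A" "y' \<in> carrier A"
    using x'y' carrier by blast+
  have "y i \<otimes>\<^bsub>A\<^esub> x' \<in> hcomp A 0" "y' \<otimes>\<^bsub>A\<^esub> x i \<in> hcomp A 0" if "i < n" for i
    using mult[OF deg(2)[OF that] x'y'(1)] mult[OF x'y'(2) deg(1)[OF that]] by simp_all
  moreover have "y' \<otimes>\<^bsub>A\<^esub> x' \<in> hcomp A 0"
    using mult[OF x'y'(2,1)] by simp
  moreover have "y' \<otimes>\<^bsub>A\<^esub> x i \<otimes>\<^bsub>A\<^esub> (y j \<otimes>\<^bsub>A\<^esub> x') = (if i = j then y' \<otimes>\<^bsub>A\<^esub> x' else \<zero>\<^bsub>A\<^esub>)"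
    if "i < n" "j < n" for i j
  proof -
    have "y' \<otimes>\<^bsub>A\<^esub> x i \<otimes>\<^bsub>A\<^esub> (y j \<otimes>\<^bsub>A\<^esub> x') = y' \<otimes>\<^bsub>A\<^esub> (x i \<otimes>\<^bsub>A\<^esub> y j) \<otimes>\<^bsub>A\<^esub> x'"
      using c[OF that(1)] c[OF that(2)] c' by (simp add: m_assoc)
    also have "x i \<otimes>\<^bsub>A\<^esub> y j = (if i = j then \<one>\<^bsub>A\<^esub> else \<zero>\<^bsub>A\<^esub>)"
      using xy that unfolding leavitt_family_def by blast
    finally show ?thesis
      using c' by simp
  qed
  moreover have "(\<Oplus>\<^bsub>A\<^esub>i\<in>{..<n}. y i \<otimes>\<^bsub>A\<^esub> x' \<otimes>\<^bsub>A\<^esub> (y' \<otimes>\<^bsub>A\<^esub> x i)) = \<one>\<^bsub>A\<^esub>"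
  proof -
    have "y i \<otimes>\<^bsub>A\<^esub> x' \<otimes>\<^bsub>A\<^esub> (y' \<otimes>\<^bsub>A\<^esub> x i) = y i \<otimes>\<^bsub>A\<^esub> x i" if "i < n" for i
    proof -
      have "y i \<otimes>\<^bsub>A\<^esub> x' \<otimes>\<^bsub>A\<^esub> (y' \<otimes>\<^bsub>A\<^esub> x i) = y i \<otimes>\<^bsub>A\<^esub> (x' \<otimes>\<^bsub>A\<^esub> y') \<otimes>\<^bsub>A\<^esub> x i"
        using c[OF that] c' by (simp add: m_assoc)
      then show ?thesis
        using c[OF that] by (simp add: x'y')
    qed
    then have "(\<Oplus>\<^bsub>A\<^esub>i\<in>{..<n}. y i \<otimes>\<^bsub>A\<^esub> x' \<otimes>\<^bsub>A\<^esub> (y' \<otimes>\<^bsub>A\<^esub> x i)) = (\<Oplus>\<^bsub>A\<^esub>i\<in>{..<n}. y i \<otimes>\<^bsub>A\<^esub> x i)"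
      using c by (intro add.finprod_cong') auto
    then show ?thesis
      using xy unfolding leavitt_family_def by simp
  qed
  ultimately show ?thesis
    unfolding partition_of_one_def by blast
qed

lemma leavitt_family_Lops:
  assumes "n > 0"
  shows "leavitt_family (leavitt_ops TYPE('k::field) n) n (\<lambda>i. shrink n (Suc i)) (\<lambda>i. spread n (Suc i))"
proof -
  have "(\<Oplus>\<^bsub>leavitt_ops TYPE('k) n\<^esub>i\<in>{..<n}. spread n (Suc i) * shrink n (Suc i)) =
      (\<Sum>i<n. spread n (Suc i) * shrink n (Suc i) :: 'k state endo)"
  proof (rule finsum_Lops)
    fix i
    assume "i \<in> {..<n}"
    then have "Suc i \<in> {1..n}"
      by simp
    from hcomp_Lops_closed(4)[OF gen_op_hcomp(2)[OF this] gen_op_hcomp(1)[OF this]]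
    show "spread n (Suc i) * shrink n (Suc i) \<in> carrier (leavitt_ops TYPE('k) n)"
      by (rule hcomp_Lops_closed(5))
  qed
  also have "\<dots> = (\<Sum>i = 1..n. spread n i * shrink n i)"
    by (rule sum.reindex_bij_witness[of _ "\<lambda>i. i - 1" Suc]) auto
  finally show ?thesis
    using sum_spread_shrink[OF assms, where 'k = 'k] gen_op_hcomp[of _ n, where 'k = 'k] shrink_spread[where 'k = 'k]
    unfolding leavitt_family_def by (simp del: leavitt_ops_simps(6))
qed

definition diag_mat_op :: "nat \<Rightarrow> 'k::field state endo \<Rightarrow> 'k state endo mat"
  where "diag_mat_op m s = mat m m (\<lambda>(a, b). if a = b then s else 0)"

lemma hcomp_Lops_carrier: "hcomp (leavitt_ops TYPE('k::field) n) d \<subseteq> carrier (leavitt_ops TYPE('k) n)"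
  using hcomp_Lops_closed(5) by blast

lemma hcomp_graded_mat_Lops_carrier:
  "hcomp (\<bbbM> m (leavitt_ops TYPE('k::field) n) \<delta>) d \<subseteq> carrier (\<bbbM> m (leavitt_ops TYPE('k) n) \<delta>)"
  using hcomp_Lops_closed(5) unfolding graded_mat_simps by blast

lemma graded_hom_diag:
  "graded_hom (leavitt_ops TYPE('k::field) n) (\<bbbM> m (leavitt_ops TYPE('k) n) (\<lambda>_. 0)) (diag_mat_op m)"
proof (rule graded_hom.intro)
  let ?A = "\<bbbM> m (leavitt_ops TYPE('k) n) (\<lambda>_. 0)"
  have closed: "diag_mat_op m s \<in> carrier ?A" if "s \<in> carrier (leavitt_ops TYPE('k) n)" for s
    using that rep_image_closed(4)[where 'k = 'k] by (simp add: graded_mat_simps diag_mat_op_def)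
  show "diag_mat_op m \<in> Ring.ring_hom (leavitt_ops TYPE('k) n) ?A"
  proof (rule ring_hom_memI)
    fix s t
    assume s: "s \<in> carrier (leavitt_ops TYPE('k) n)" and t: "t \<in> carrier (leavitt_ops TYPE('k) n)"
    show "diag_mat_op m (s \<oplus>\<^bsub>leavitt_ops TYPE('k) n\<^esub> t) = diag_mat_op m s \<oplus>\<^bsub>?A\<^esub> diag_mat_op m t"
      by (intro eq_matI) (auto simp: graded_mat_simps diag_mat_op_def)
    have "diag_mat_op m s * diag_mat_op m t = diag_mat_op m (s * t)"
    proof (rule eq_matI)
      fix a b
      assume "a < dim_row (diag_mat_op m (s * t))" "b < dim_col (diag_mat_op m (s * t))"
      then have ab: "a < m" "b < m"
        by (simp_all add: diag_mat_op_def)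
      have "(diag_mat_op m s * diag_mat_op m t) $$ (a, b) =
          (\<Sum>l<m. diag_mat_op m s $$ (a, l) * diag_mat_op m t $$ (l, b))"
        by (rule index_mult_mat_sum[OF _ _ ab]) (simp_all add: diag_mat_op_def)
      also have "\<dots> = (\<Sum>l<m. if l = a then if a = b then s * t else 0 else 0)"
        using ab by (intro sum.cong) (auto simp: diag_mat_op_def)
      finally show "(diag_mat_op m s * diag_mat_op m t) $$ (a, b) = diag_mat_op m (s * t) $$ (a, b)"
        using ab by (simp add: diag_mat_op_def)
    qed (simp_all add: diag_mat_op_def)
    then show "diag_mat_op m (s \<otimes>\<^bsub>leavitt_ops TYPE('k) n\<^esub> t) = diag_mat_op m s \<otimes>\<^bsub>?A\<^esub> diag_mat_op m t"
      by (simp add: graded_mat_Lops_simps(1)[OF closed[OF s] closed[OF t]])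
    show "diag_mat_op m s \<in> carrier ?A"
      by (rule closed[OF s])
  qed (auto intro!: eq_matI simp: graded_mat_simps diag_mat_op_def)
  show "diag_mat_op m s \<in> hcomp ?A d" if "s \<in> hcomp (leavitt_ops TYPE('k) n) d" for s d
    using that hcomp_Lops_closed(1)[where 'k = 'k]
    by (simp add: graded_mat_simps diag_mat_op_def del: leavitt_ops_simps)
qed (rule ring_leavitt_ops ring_graded_mat_Lops hcomp_Lops_carrier)+

definition matrix_unit :: "nat \<Rightarrow> nat \<Rightarrow> nat \<Rightarrow> 'k::field state endo mat"
  where "matrix_unit m i j = mat m m (\<lambda>(a, b). if a = i \<and> b = j then 1 else 0)"

lemma matrix_unit_mult:
  assumes "i < m" "j < m" "k < m" "l < m"
  shows "matrix_unit m i j * matrix_unit m k l = (if j = k then matrix_unit m i l else 0\<^sub>m m m)"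
proof (rule eq_matI)
  fix a b
  assume "a < dim_row (if j = k then matrix_unit m i l else 0\<^sub>m m m)" "b < dim_col (if j = k then matrix_unit m i l else 0\<^sub>m m m)"
  then have ab: "a < m" "b < m"
    by (auto simp: matrix_unit_def split: if_splits)
  have "(matrix_unit m i j * matrix_unit m k l) $$ (a, b) = (\<Sum>c<m. matrix_unit m i j $$ (a, c) * matrix_unit m k l $$ (c, b))"
    by (rule index_mult_mat_sum[OF _ _ ab]) (simp_all add: matrix_unit_def)
  also have "\<dots> = (\<Sum>c<m. if c = j then if a = i \<and> j = k \<and> b = l then 1 else 0 else 0)"
    using ab by (intro sum.cong) (auto simp: matrix_unit_def)
  finally show "(matrix_unit m i j * matrix_unit m k l) $$ (a, b) = (if j = k then matrix_unit m i l else 0\<^sub>m m m) $$ (a, b)"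
    using ab assms by (auto simp: matrix_unit_def)
qed (auto simp: matrix_unit_def)

lemma partition_of_matrix_units:
  assumes "m > 0"
  shows "partition_of_one (\<bbbM> m (leavitt_ops TYPE('k::field) n) (\<lambda>_. 0)) m
    (\<lambda>i. matrix_unit m i 0) (\<lambda>i. matrix_unit m 0 i) (matrix_unit m 0 0)"
proof -
  let ?A = "\<bbbM> m (leavitt_ops TYPE('k) n) (\<lambda>_. 0)"
  have deg: "matrix_unit m i j \<in> hcomp ?A 0" for i j
    using hcomp_Lops_closed(1,2)[where 'k = 'k]
    by (simp add: graded_mat_simps matrix_unit_def del: leavitt_ops_simps)
  then have c: "matrix_unit m i j \<in> carrier ?A" for i j
    using hcomp_graded_mat_Lops_carrier by blast
  have "(\<Oplus>\<^bsub>?A\<^esub>i\<in>{..<m}. matrix_unit m i 0 \<otimes>\<^bsub>?A\<^esub> matrix_unit m 0 i) = \<one>\<^bsub>?A\<^esub>"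
  proof -
    interpret ring ?A
      by (rule ring_graded_mat_Lops)
    have "(\<Oplus>\<^bsub>?A\<^esub>i\<in>{..<m}. matrix_unit m i 0 \<otimes>\<^bsub>?A\<^esub> matrix_unit m 0 i) = (\<Oplus>\<^bsub>?A\<^esub>i\<in>{..<m}. matrix_unit m i i)"
      using assms c by (intro add.finprod_cong') (auto simp: graded_mat_Lops_simps(1)[OF c c] matrix_unit_mult)
    also have "\<dots> = 1\<^sub>m m"
    proof (rule eq_matI)
      fix a b
      assume "a < dim_row (1\<^sub>m m :: 'k state endo mat)" "b < dim_col (1\<^sub>m m :: 'k state endo mat)"
      then have ab: "a < m" "b < m"
        by simp_all
      have "(\<Oplus>\<^bsub>?A\<^esub>i\<in>{..<m}. matrix_unit m i i) $$ (a, b) = (\<Sum>i<m. matrix_unit m i i $$ (a, b))"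
        by (rule finsum_graded_mat_Lops) (use c ab in auto)
      also have "\<dots> = (\<Sum>i<m. if i = a then if a = b then 1 else 0 else 0)"
        using ab by (intro sum.cong) (auto simp: matrix_unit_def)
      finally show "(\<Oplus>\<^bsub>?A\<^esub>i\<in>{..<m}. matrix_unit m i i) $$ (a, b) = 1\<^sub>m m $$ (a, b)"
        using ab by simp
    qed (use finsum_closed[of "\<lambda>i. matrix_unit m i i" "{..<m}"] c in \<open>auto simp: graded_mat_simps\<close>)
    finally show ?thesis
      by (simp add: graded_mat_Lops_one)
  qed
  then show ?thesis
    using assms deg unfolding partition_of_one_def
    by (auto simp: graded_mat_Lops_simps(1)[OF c c] matrix_unit_mult graded_mat_Lops_zero)
qed

section \<open>The inverse of a graded isomorphism\<close>

definition mat_degree_part :: "int \<Rightarrow> 'k::field state endo mat \<Rightarrow> 'k state endo mat"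
  where "mat_degree_part d = map_mat (degree_part d)"

lemma degree_part_Lops:
  "s \<in> carrier (leavitt_ops TYPE('k::field) n) \<Longrightarrow> degree_part d s \<in> hcomp (leavitt_ops TYPE('k) n) d"
  using homogeneous_part_leavitt_polys[of _ n d] keys_homogeneous_part[of d] by (fastforce simp: degree_part_rep_eq)

lemma degree_part_hcomp:
  "s \<in> hcomp (leavitt_ops TYPE('k::field) n) e \<Longrightarrow> degree_part d s = (if d = e then s else 0)"
  using degree_part_rep[of _ e d n] by auto

lemma sum_degree_part:
  assumes "s \<in> carrier (leavitt_ops TYPE('k::field) n)"
  shows "\<exists>D. finite D \<and> (\<forall>E. finite E \<longrightarrow> D \<subseteq> E \<longrightarrow> (\<Sum>d\<in>E. degree_part d s) = s)"
proof -
  obtain p where p: "s = rep n p"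
    using assms by auto
  have "(\<Sum>d\<in>E. degree_part d s) = s" if "finite E" "word_degree ` Poly_Mapping.keys p \<subseteq> E" for E
  proof -
    have "homogeneous_part d p = 0" if "d \<notin> word_degree ` Poly_Mapping.keys p" for d
      unfolding homogeneous_part_def using that by (intro sum.neutral) auto
    then have "(\<Sum>d\<in>E. homogeneous_part d p) = (\<Sum>d\<in>word_degree ` Poly_Mapping.keys p. homogeneous_part d p)"
      using that by (intro sum.mono_neutral_right) auto
    then have "(\<Sum>d\<in>E. homogeneous_part d p) = p"
      by (simp flip: sum_homogeneous_part)
    then show ?thesis
      by (simp add: p degree_part_rep_eq flip: rep_sum)
  qed
  then show ?thesis
    by (intro exI[of _ "word_degree ` Poly_Mapping.keys p"]) simp
qed

lemma mat_degree_part_closed: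
  "M \<in> carrier (\<bbbM> m (leavitt_ops TYPE('k::field) n) (\<lambda>_. 0)) \<Longrightarrow>
    mat_degree_part d M \<in> hcomp (\<bbbM> m (leavitt_ops TYPE('k) n) (\<lambda>_. 0)) d"
  using degree_part_Lops[of _ n d, where 'k = 'k]
  by (auto simp: graded_mat_simps mat_degree_part_def simp del: leavitt_ops_simps)

lemma mat_degree_part_hcomp:
  assumes "M \<in> hcomp (\<bbbM> m (leavitt_ops TYPE('k::field) n) (\<lambda>_. 0)) e"
  shows "mat_degree_part d M = (if d = e then M else 0\<^sub>m m m)"
  using assms degree_part_hcomp[of _ n e d, where 'k = 'k]
  by (intro eq_matI) (auto simp: graded_mat_simps mat_degree_part_def simp del: leavitt_ops_simps)

text \<open>
  A matrix of operators is the sum of its finitely many homogeneous parts.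
\<close>
lemma graded_mat_Lops_induct [consumes 1, case_names hcomp add]:
  assumes M: "M \<in> carrier (\<bbbM> m (leavitt_ops TYPE('k::field) n) (\<lambda>_. 0))"
    and hcomp: "\<And>d N. N \<in> hcomp (\<bbbM> m (leavitt_ops TYPE('k) n) (\<lambda>_. 0)) d \<Longrightarrow> P N"
    and add: "\<And>N L. N \<in> carrier (\<bbbM> m (leavitt_ops TYPE('k) n) (\<lambda>_. 0)) \<Longrightarrow>
      L \<in> carrier (\<bbbM> m (leavitt_ops TYPE('k) n) (\<lambda>_. 0)) \<Longrightarrow> P N \<Longrightarrow> P L \<Longrightarrow>
      P (N \<oplus>\<^bsub>\<bbbM> m (leavitt_ops TYPE('k) n) (\<lambda>_. 0)\<^esub> L)"
  shows "P M"
proof -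
  let ?A = "\<bbbM> m (leavitt_ops TYPE('k) n) (\<lambda>_. 0)"
  interpret ring ?A
    by (rule ring_graded_mat_Lops)
  have M_entry: "M $$ (i, j) \<in> carrier (leavitt_ops TYPE('k) n)" if "i < m" "j < m" for i j
    using M that unfolding graded_mat_simps by blast
  obtain D where D: "\<And>i j. i < m \<Longrightarrow> j < m \<Longrightarrow> finite (D i j)"
    "\<And>i j E. i < m \<Longrightarrow> j < m \<Longrightarrow> finite E \<Longrightarrow> D i j \<subseteq> E \<Longrightarrow> (\<Sum>d\<in>E. degree_part d (M $$ (i, j))) = M $$ (i, j)"
    using sum_degree_part[OF M_entry] by metis
  define E where "E = (\<Union>i<m. \<Union>j<m. D i j)"
  have E: "finite E" "\<And>i j. i < m \<Longrightarrow> j < m \<Longrightarrow> D i j \<subseteq> E"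
    using D(1) unfolding E_def by auto
  have hc: "mat_degree_part d M \<in> carrier ?A" for d
    using mat_degree_part_closed[OF M] hcomp_graded_mat_Lops_carrier by blast
  have "P (\<Oplus>\<^bsub>?A\<^esub>d\<in>F. mat_degree_part d M)" if "finite F" for F
    using that
  proof (induction F)
    case empty
    have "\<zero>\<^bsub>?A\<^esub> \<in> hcomp ?A 0"
      using hcomp_Lops_closed(1)[where 'k = 'k]
      by (simp add: graded_mat_Lops_zero graded_mat_simps del: leavitt_ops_simps)
    then show ?case
      using hcomp by simp
  next
    case (insert d F)
    have "(\<Oplus>\<^bsub>?A\<^esub>d\<in>insert d F. mat_degree_part d M) =
        mat_degree_part d M \<oplus>\<^bsub>?A\<^esub> (\<Oplus>\<^bsub>?A\<^esub>d\<in>F. mat_degree_part d M)"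
      using insert hc by (intro finsum_insert) auto
    then show ?case
      using insert hc hcomp[OF mat_degree_part_closed[OF M]] by (auto intro!: add)
  qed
  from this[OF E(1)] have "P (\<Oplus>\<^bsub>?A\<^esub>d\<in>E. mat_degree_part d M)" .
  moreover have "(\<Oplus>\<^bsub>?A\<^esub>d\<in>E. mat_degree_part d M) = M"
  proof (rule eq_matI)
    have Mc: "M \<in> carrier_mat m m"
      using M by (simp add: graded_mat_simps)
    fix i j
    assume "i < dim_row M" "j < dim_col M"
    then have ij: "i < m" "j < m"
      using Mc by auto
    have "(\<Oplus>\<^bsub>?A\<^esub>d\<in>E. mat_degree_part d M) $$ (i, j) = (\<Sum>d\<in>E. mat_degree_part d M $$ (i, j))"
      by (rule finsum_graded_mat_Lops[OF hc E(1) ij])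
    also have "\<dots> = M $$ (i, j)"
      using D(2)[OF ij E(1) E(2)[OF ij]] Mc ij by (simp add: mat_degree_part_def)
    finally show "(\<Oplus>\<^bsub>?A\<^esub>d\<in>E. mat_degree_part d M) $$ (i, j) = M $$ (i, j)" .
  qed (use finsum_closed[of "\<lambda>d. mat_degree_part d M" E] hc M in \<open>auto simp: graded_mat_simps\<close>)
  ultimately show ?thesis
    by simp
qed

text \<open>
  A graded homomorphism commutes with taking homogeneous parts.  If \<open>h M\<close> has degree \<open>d\<close>, then
  \<open>h\<close> maps \<open>M\<close> and its part of degree \<open>d\<close> to the same element, so these are equal.
\<close>
lemma graded_iso_Lops_sym:
  assumes "\<bbbM> m (leavitt_ops TYPE('k::field) n) (\<lambda>_. 0) \<cong>\<^sub>g\<^sub>r \<bbbM> m' (leavitt_ops TYPE('k) n') (\<lambda>_. 0)"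
  shows "\<bbbM> m' (leavitt_ops TYPE('k) n') (\<lambda>_. 0) \<cong>\<^sub>g\<^sub>r \<bbbM> m (leavitt_ops TYPE('k) n) (\<lambda>_. 0)"
proof -
  let ?A = "\<bbbM> m (leavitt_ops TYPE('k) n) (\<lambda>_. 0)" and ?B = "\<bbbM> m' (leavitt_ops TYPE('k) n') (\<lambda>_. 0)"
  obtain h where h: "h \<in> ring_iso ?A ?B" "\<And>d. h ` hcomp ?A d \<subseteq> hcomp ?B d"
    using assms unfolding graded_iso_def by blast
  have hom: "h \<in> Ring.ring_hom ?A ?B" and bij: "bij_betw h (carrier ?A) (carrier ?B)"
    using h(1) unfolding ring_iso_def by auto
  interpret ring_hom_ring ?A ?B h
    by (intro ring_hom_ringI2 ring_graded_mat_Lops hom)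
  have part_add: "mat_degree_part d (N \<oplus>\<^bsub>\<bbbM> l (leavitt_ops TYPE('k) q) (\<lambda>_. 0)\<^esub> L) =
      mat_degree_part d N \<oplus>\<^bsub>\<bbbM> l (leavitt_ops TYPE('k) q) (\<lambda>_. 0)\<^esub> mat_degree_part d L"
    if "N \<in> carrier (\<bbbM> l (leavitt_ops TYPE('k) q) (\<lambda>_. 0))" "L \<in> carrier (\<bbbM> l (leavitt_ops TYPE('k) q) (\<lambda>_. 0))"
    for d N L l q
    using that by (intro eq_matI) (auto simp: graded_mat_simps mat_degree_part_def degree_part_add)
  have commute: "mat_degree_part d (h M) = h (mat_degree_part d M)" if "M \<in> carrier ?A" for M d
    using that
  proof (induction M rule: graded_mat_Lops_induct)
    case (hcomp e N)
    then have "h N \<in> hcomp ?B e"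
      using h(2) by blast
    then show ?case
      using mat_degree_part_hcomp[OF hcomp] mat_degree_part_hcomp[of "h N" m' n' e d]
        hom_zero by (simp add: graded_mat_Lops_zero)
  next
    case (add N L)
    have c: "mat_degree_part d N \<in> carrier ?A" "mat_degree_part d L \<in> carrier ?A"
      using mat_degree_part_closed[OF add(1), of d] mat_degree_part_closed[OF add(2), of d]
        hcomp_graded_mat_Lops_carrier by blast+
    show ?case
      unfolding part_add[OF add(1,2)] hom_add[OF add(1,2)] hom_add[OF c]
        part_add[OF hom_closed[OF add(1)] hom_closed[OF add(2)]] add ..
  qed
  define g where "g = inv_into (carrier ?A) h"
  have g: "g \<in> ring_iso ?B ?A"
    unfolding g_def by (rule ring_iso_set_sym[OF ring_graded_mat_Lops h(1)])
  have "g N \<in> hcomp ?A d" if N: "N \<in> hcomp ?B d" for N d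
  proof -
    have Nc: "N \<in> carrier ?B"
      using N hcomp_graded_mat_Lops_carrier by blast
    have gN: "g N \<in> carrier ?A" "h (g N) = N"
      using bij_betw_inv_into_right[OF bij Nc] bij_betw_imp_surj_on[OF bij] Nc
      unfolding g_def by (auto intro: inv_into_into)
    have part: "mat_degree_part d (g N) \<in> hcomp ?A d"
      by (rule mat_degree_part_closed[OF gN(1)])
    have "h (mat_degree_part d (g N)) = h (g N)"
      using commute[OF gN(1), of d] mat_degree_part_hcomp[OF N, of d] gN(2) by simp
    then have "mat_degree_part d (g N) = g N"
      using bij_betw_imp_inj_on[OF bij] part gN(1) hcomp_graded_mat_Lops_carrier
      by (meson inj_onD subsetD)
    with part show ?thesis
      by simp
  qed
  with g show ?thesis
    unfolding graded_iso_def by blast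
qed

section \<open>Invariants of the matrix rings\<close>

lemma graded_iso_graded_hom:
  assumes "h \<in> ring_iso (\<bbbM> m (leavitt_ops TYPE('k::field) n) (\<lambda>_. 0)) (\<bbbM> m' (leavitt_ops TYPE('k) n') (\<lambda>_. 0))"
    and "\<And>d. h ` hcomp (\<bbbM> m (leavitt_ops TYPE('k) n) (\<lambda>_. 0)) d \<subseteq> hcomp (\<bbbM> m' (leavitt_ops TYPE('k) n') (\<lambda>_. 0)) d"
  shows "graded_hom (\<bbbM> m (leavitt_ops TYPE('k) n) (\<lambda>_. 0)) (\<bbbM> m' (leavitt_ops TYPE('k) n') (\<lambda>_. 0)) h"
  using assms unfolding ring_iso_def
  by (intro graded_hom.intro ring_graded_mat_Lops hcomp_graded_mat_Lops_carrier) blast+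

text \<open>
  The images of the matrix units \<open>e\<^sub>i\<^sub>0\<close> and \<open>e\<^sub>0\<^sub>i\<close> form a partition of one with \<open>m\<close> members.
\<close>
lemma graded_iso_dvd:
  assumes "m > 0" "n' > 0"
    and "\<bbbM> m (leavitt_ops TYPE('k::field) n) (\<lambda>_. 0) \<cong>\<^sub>g\<^sub>r \<bbbM> m' (leavitt_ops TYPE('k) n') (\<lambda>_. 0)"
  shows "\<exists>r. m dvd m' * n' ^ r"
proof -
  obtain h where h: "graded_hom (\<bbbM> m (leavitt_ops TYPE('k) n) (\<lambda>_. 0)) (\<bbbM> m' (leavitt_ops TYPE('k) n') (\<lambda>_. 0)) h"
    using assms(3) graded_iso_graded_hom unfolding graded_iso_def by blast
  from op_rank_partition[OF assms(2) graded_hom.partition_of_one_hom[OF h partition_of_matrix_units[OF assms(1)]]]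
  obtain R where "m * op_rank n' m' r (h (matrix_unit m 0 0)) = m' * n' ^ r" if "r \<ge> R" for r
    by blast
  then show ?thesis
    by (metis dvd_triv_left order_refl)
qed

text \<open>
  In the target ring there are two Leavitt families: the image of the one with \<open>n\<close> members and its
  own with \<open>n'\<close> members.  Both partition \<open>1\<close> into idempotents equivalent to the same \<open>D\<close>, so
  \<open>n\<close> and \<open>n'\<close> times the rank of \<open>D\<close> agree, and they are positive.
\<close>
lemma graded_iso_order_eq:
  assumes "m' > 0" "n > 0" "n' > 0"
    and "\<bbbM> m (leavitt_ops TYPE('k::field) n) (\<lambda>_. 0) \<cong>\<^sub>g\<^sub>r \<bbbM> m' (leavitt_ops TYPE('k) n') (\<lambda>_. 0)"
  shows "n = n'"
proof -
  let ?B = "\<bbbM> m' (leavitt_ops TYPE('k) n') (\<lambda>_. 0)"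
  obtain h where h: "graded_hom (\<bbbM> m (leavitt_ops TYPE('k) n) (\<lambda>_. 0)) ?B h"
    using assms(4) graded_iso_graded_hom unfolding graded_iso_def by blast
  obtain x y where xy: "leavitt_family ?B n x y"
    using graded_hom.leavitt_family_hom[OF h graded_hom.leavitt_family_hom[OF graded_hom_diag leavitt_family_Lops[OF assms(2)]]]
    by blast
  obtain x' y' where x'y': "leavitt_family ?B n' x' y'"
    using graded_hom.leavitt_family_hom[OF graded_hom_diag leavitt_family_Lops[OF assms(3)]] by blast
  have x'y'_0: "x' 0 \<in> hcomp ?B (-1)" "y' 0 \<in> hcomp ?B 1" "x' 0 \<otimes>\<^bsub>?B\<^esub> y' 0 = \<one>\<^bsub>?B\<^esub>"
    using x'y' assms(3) unfolding leavitt_family_def by auto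
  have mult: "s \<otimes>\<^bsub>?B\<^esub> t \<in> hcomp ?B (a + b)" if st: "s \<in> hcomp ?B a" "t \<in> hcomp ?B b" for s t a b
  proof -
    have "s \<in> carrier ?B" "t \<in> carrier ?B"
      using st hcomp_graded_mat_Lops_carrier by blast+
    then show ?thesis
      using mats_mult_hcomp[of s m' m' n' a "\<lambda>_. 0" "\<lambda>_. 0" t m' b "\<lambda>_. 0"] st
      unfolding graded_mat_mats(2) by (subst graded_mat_Lops_simps(1)) simp_all
  qed
  let ?D = "y' 0 \<otimes>\<^bsub>?B\<^esub> x' 0"
  have part: "partition_of_one ?B q (\<lambda>i. b i \<otimes>\<^bsub>?B\<^esub> x' 0) (\<lambda>i. y' 0 \<otimes>\<^bsub>?B\<^esub> a i) ?D"
    if "leavitt_family ?B q a b" for q a b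
    by (rule partition_of_leavitt_families[OF ring_graded_mat_Lops hcomp_graded_mat_Lops_carrier _ that x'y'_0])
      (rule mult)
  obtain R where R: "n * op_rank n' m' r ?D = m' * n' ^ r" if "r \<ge> R" for r
    using op_rank_partition[OF assms(3) part[OF xy]] by blast
  obtain R' where R': "n' * op_rank n' m' r ?D = m' * n' ^ r" if "r \<ge> R'" for r
    using op_rank_partition[OF assms(3) part[OF x'y']] by blast
  define r where "r = max R R'"
  have "n * op_rank n' m' r ?D = n' * op_rank n' m' r ?D" "n * op_rank n' m' r ?D > 0"
    using R[of r] R'[of r] assms by (simp_all add: r_def)
  then show ?thesis
    by auto
qed

section \<open>The classification\<close>

text \<open>
  The parts of \<open>m\<close> and \<open>m'\<close> prime to \<open>p\<close> divide each other.
\<close>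
lemma prime_power_ratio:
  fixes m m' p :: nat
  assumes p: "Factorial_Ring.prime p" and m: "m > 0" "m' > 0" and dvd: "m dvd m' * p ^ r" "m' dvd m * p ^ s"
  shows "\<exists>j::int. rat_of_nat p powi j * rat_of_nat m = rat_of_nat m'"
proof -
  have decomp: "\<exists>a c. q = p ^ a * c \<and> coprime c p" if q: "q > 0" for q
  proof -
    obtain c where "q = p ^ multiplicity p q * c" "\<not> p dvd c"
      by (rule multiplicity_decompose'[of q p]) (use q p not_prime_unit in auto)
    then show ?thesis
      using p by (metis coprime_commute prime_imp_coprime)
  qed
  obtain a c where ac: "m = p ^ a * c" "coprime c p"
    using decomp[OF m(1)] by blast
  obtain b c' where bc: "m' = p ^ b * c'" "coprime c' p"
    using decomp[OF m(2)] by blast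
  have "c dvd c'"
  proof -
    have "c dvd c' * p ^ (b + r)"
      using dvd(1) dvd_mult_right[of "p ^ a" c] by (simp add: ac bc power_add mult_ac)
    then show ?thesis
      using ac(2) by (simp add: coprime_dvd_mult_left_iff)
  qed
  moreover have "c' dvd c"
  proof -
    have "c' dvd c * p ^ (a + s)"
      using dvd(2) dvd_mult_right[of "p ^ b" c'] by (simp add: ac bc power_add mult_ac)
    then show ?thesis
      using bc(2) by (simp add: coprime_dvd_mult_left_iff)
  qed
  ultimately have "c = c'"
    by (rule dvd_antisym)
  moreover have "p > 0"
    using p prime_gt_0_nat by blast
  ultimately have "rat_of_nat p powi (int b - int a) * rat_of_nat m = rat_of_nat m'"
    by (simp add: ac bc power_int_diff)
  then show ?thesis
    by blast
qed

lemma rat_expanded_size: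
  assumes "n > 0" "\<And>i. i < k \<Longrightarrow> lam i \<le> N"
  shows "rat_of_nat (\<Sum>i<k. n ^ nat (N - lam i)) =
    rat_of_nat n powi N * (\<Sum>i<k. rat_of_nat n powi (- lam i))"
proof -
  have "rat_of_nat (n ^ nat (N - lam i)) = rat_of_nat n powi N * rat_of_nat n powi (- lam i)" if "i < k" for i
  proof -
    have "rat_of_nat (n ^ nat (N - lam i)) = rat_of_nat n powi (N + - lam i)"
      using assms(2)[OF that] by (simp add: power_int_def)
    also have "\<dots> = rat_of_nat n powi N * rat_of_nat n powi (- lam i)"
      using assms(1) by (intro power_int_add) simp
    finally show ?thesis .
  qed
  then show ?thesis
    by (simp add: sum_distrib_left)
qed

text \<open>
  In this standard form all shifts are zero, so that for given \<open>n\<close> only the size is left.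
\<close>
lemma gr_equiv_leavitt_standard:
  assumes "n > 0" "\<And>i. i < k \<Longrightarrow> lam i \<le> N"
  shows "gr_equiv (\<bbbM> k (leavitt TYPE('k::field) n) lam)
    (\<bbbM> (\<Sum>i<k. n ^ nat (N - lam i)) (leavitt_ops TYPE('k) n) (\<lambda>_. 0))"
  using gr_equiv_trans[OF gr_equiv_graded_mat[OF ring_leavitt ring_leavitt_ops gr_equiv_leavitt_ops[OF assms(1)]]
      gr_equiv_expansion[OF assms(1), of k lam "\<lambda>i. nat (N - lam i)" N]] assms(2)
  by simp

theorem theorem4p11:
  fixes k k' n n' :: nat and lam gam :: "nat \<Rightarrow> int"
  assumes "k > 0" and "k' > 0" and "n' > 0" and "Factorial_Ring.prime n"
  shows "\<bbbM> k (leavitt TYPE('k::field) n) lam \<cong>\<^sub>g\<^sub>r \<bbbM> k' (leavitt TYPE('k) n') gam \<longleftrightarrow>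
    n = n' \<and>
    (\<exists>j::int. (rat_of_nat n) powi j * (\<Sum>i<k. (rat_of_nat n) powi (- lam i)) =
      (\<Sum>i<k'. (rat_of_nat n) powi (- gam i)))"
proof -
  have n: "n > 0"
    using assms(4) prime_gt_0_nat by blast
  define L G where "L = (\<Sum>i<k. \<bar>lam i\<bar>)" and "G = (\<Sum>i<k'. \<bar>gam i\<bar>)"
  have L: "lam i \<le> L" if "i < k" for i
    using member_le_sum[of i "{..<k}" "\<lambda>i. \<bar>lam i\<bar>"] that unfolding L_def by simp
  have G: "gam i \<le> G" if "i < k'" for i
    using member_le_sum[of i "{..<k'}" "\<lambda>i. \<bar>gam i\<bar>"] that unfolding G_def by simp
  let ?m = "\<lambda>N. \<Sum>i<k. n ^ nat (N - lam i)" and ?m' = "\<lambda>N. \<Sum>i<k'. n' ^ nat (N - gam i)"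
  have m: "?m N > 0" "?m' N > 0" for N
    using assms n by (auto intro!: sum_pos)
  have nz: "rat_of_nat n \<noteq> 0"
    using n by simp
  show ?thesis
  proof
    assume iso: "\<bbbM> k (leavitt TYPE('k) n) lam \<cong>\<^sub>g\<^sub>r \<bbbM> k' (leavitt TYPE('k) n') gam"
    have iso': "\<bbbM> (?m L) (leavitt_ops TYPE('k) n) (\<lambda>_. 0) \<cong>\<^sub>g\<^sub>r \<bbbM> (?m' G) (leavitt_ops TYPE('k) n') (\<lambda>_. 0)"
      by (rule gr_equiv_graded_iso_trans[OF gr_equiv_sym[OF gr_equiv_leavitt_standard[OF n L]] iso
            gr_equiv_leavitt_standard[OF assms(3) G]])
    have eq: "n = n'"
      by (rule graded_iso_order_eq[OF m(2) n assms(3) iso'])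
    obtain r s where "?m L dvd ?m' G * n ^ r" "?m' G dvd ?m L * n ^ s"
      using graded_iso_dvd[OF m(1) assms(3) iso'] graded_iso_dvd[OF m(2) n graded_iso_Lops_sym[OF iso']]
      unfolding eq by blast
    then obtain j :: int where "rat_of_nat n powi j * rat_of_nat (?m L) = rat_of_nat (?m' G)"
      using prime_power_ratio[OF assms(4) m] by blast
    then have "rat_of_nat n powi j * (rat_of_nat n powi L * (\<Sum>i<k. rat_of_nat n powi (- lam i))) =
        rat_of_nat n powi G * (\<Sum>i<k'. rat_of_nat n powi (- gam i))"
      using rat_expanded_size[OF n, of k lam L, OF L] rat_expanded_size[OF n, of k' gam G, OF G]
      unfolding eq by simp
    then have "rat_of_nat n powi (j + L - G) * (\<Sum>i<k. rat_of_nat n powi (- lam i)) =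
        (\<Sum>i<k'. rat_of_nat n powi (- gam i))"
      using nz by (simp add: power_int_diff power_int_add field_simps)
    with eq show "n = n' \<and> (\<exists>j::int. (rat_of_nat n) powi j * (\<Sum>i<k. (rat_of_nat n) powi (- lam i)) =
      (\<Sum>i<k'. (rat_of_nat n) powi (- gam i)))"
      by blast
  next
    assume "n = n' \<and> (\<exists>j::int. (rat_of_nat n) powi j * (\<Sum>i<k. (rat_of_nat n) powi (- lam i)) =
      (\<Sum>i<k'. (rat_of_nat n) powi (- gam i)))"
    then obtain j :: int where eq: "n = n'" and j: "rat_of_nat n powi j * (\<Sum>i<k. rat_of_nat n powi (- lam i)) =
      (\<Sum>i<k'. rat_of_nat n powi (- gam i))"
      by blast
    \<comment> \<open>Expanding to level \<open>N' + j\<close> on the left and \<open>N'\<close> on the right absorbs the factor \<open>n\<^sup>j\<close>.\<close>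
    define N' where "N' = max G (L - j)"
    have lam: "lam i \<le> N' + j" if "i < k" for i
      using L[OF that] unfolding N'_def by linarith
    have gam: "gam i \<le> N'" if "i < k'" for i
      using G[OF that] unfolding N'_def by linarith
    have "rat_of_nat (?m (N' + j)) = rat_of_nat (?m' N')"
      using rat_expanded_size[OF n, of k lam "N' + j", OF lam] rat_expanded_size[OF n, of k' gam N', OF gam]
        j nz unfolding eq by (simp add: power_int_add mult.assoc)
    then have "?m (N' + j) = ?m' N'"
      using of_nat_eq_iff by blast
    moreover have "gr_equiv (\<bbbM> k (leavitt TYPE('k) n) lam)
        (\<bbbM> (?m (N' + j)) (leavitt_ops TYPE('k) n) (\<lambda>_. 0))"
      by (rule gr_equiv_leavitt_standard[OF n lam])
    moreover have "gr_equiv (\<bbbM> k' (leavitt TYPE('k) n') gam)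
        (\<bbbM> (?m' N') (leavitt_ops TYPE('k) n') (\<lambda>_. 0))"
      by (rule gr_equiv_leavitt_standard[OF assms(3) gam])
    ultimately show "\<bbbM> k (leavitt TYPE('k) n) lam \<cong>\<^sub>g\<^sub>r \<bbbM> k' (leavitt TYPE('k) n') gam"
      unfolding eq by (auto intro: gr_equiv_imp_graded_iso gr_equiv_trans gr_equiv_sym)
  qed
qed

end
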